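(* Let $k,l,m\ge2$ and $r\ge1$ be integers, and let $\mathcal T^{(\lambda)}=\{T_i^{(\lambda)}\}_{i=1}^k$ ($\lambda\in\mathcal I_\epsilon$) and $\mathcal G^{(\theta)}=\{g_i^{(\theta)}\}_{i=1}^k$ ($\theta\in\mathcal I_\epsilon$) be families of contractions and weight functions satisfying the assumptions listed in the context, with stationary measures $\mu_{\lambda,\theta}$. Let $w:[0,1]\to\mathbb R$ be a $\mathcal C^\infty$ function. Given $\theta\in\mathcal I_\epsilon$, the function $(-\epsilon,\epsilon)\ni\lambda\mapsto\int w\,d\mu_{\lambda,\theta}\in\mathbb R$ is $\mathcal C^{\min(l,m)-1}$.
   Context: Function spaces: for an integer $n>0$ and $0<\delta<1$, $\mathcal C^{n+\delta}([0,1],\mathbb R)$ is the Banach space of $n$ times differentiable $v:[0,1]\to\mathbb R$ with finite norm $\|v\|_{\mathcal C^{n+\delta}}=\max(\|d^nv\|_{\mathcal C^\delta},\|v\|_{\mathcal C^n})$, where $\|v\|_{\mathcal C^0}=\sup|v|$, $\|v\|_{\mathcal C^n}=\max_{0\le i\le n}\|d^iv\|_{\mathcal C^0}$, $\|d^nv\|_{\mathcal C^\delta}=\sup_{x\ne y}|d^nv(x)-d^nv(y)|/|x-y|^\delta$. $Lip(A)$ is the best Lipschitz constant of $A$; a contraction is a map with $Lip<1$. $\mathbb R^+$ denotes the positive reals. Setting: $\epsilon>0$ is small, $\mathcal I_\epsilon=(-\epsilon,\epsilon)$, $\beta,\varepsilon>0$. (a) For $\lambda\in\mathcal I_\epsilon$,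 $\mathcal T^{(\lambda)}=\{T_i^{(\lambda)}\}_{i=1}^k$ is a family of $\mathcal C^{m+\beta}$ contractions of $[0,1]$ admitting for $\lambda\in\mathcal I_\epsilon$ an expansion $T_i^{(\lambda)}=T_i+\lambda T_{i,1}+\cdots+\lambda^{m-1}T_{i,m-1}+o(\lambda^{m-1})$ (in the $\mathcal C^{m+\beta}$ norm), where $T_i,T_{i,j}\in\mathcal C^{m+\beta}([0,1],[0,1])$, $\|dT_i\|_{\mathcal C^1}<1$, and $dT_i=dT_j$ for all $i,j\in\{1,\dots,k\}$. (b) For $\theta\in\mathcal I_\epsilon$, $\mathcal G^{(\theta)}=\{g_i^{(\theta)}\}_{i=1}^k$ is a family of functions in $\mathcal C^{l+\varepsilon}([0,1],\mathbb R^+)$ with $\sum_{i=1}^k g_i^{(\theta)}\equiv1$ and $\sum_{i=1}^k\|g_i^{(\theta)}\|_{\mathcal C^0}Lip(T_i^{(\lambda)})<1$ for all $\lambda,\theta\in\mathcal I_\epsilon$, where $g_i^{(\theta)}=g_i+\theta g_{i,1}+\cdots+\theta^rg_{i,r}+o(\theta^r)$ (in the $\mathcal C^{l+\varepsilon}$ norm) with $g_i\in\mathcal C^{l+\varepsilon}([0,1],\mathbb R^+)$ and $g_{i,j}\in\mathcal C^{l+\varepsilon}([0,1],\mathbb R)$. Stationary measure: $\mu_{\lambda,\theta}$ is the unique probability measure $\mu$ on $[0,1]$ with $\int f\,d\mu=\sum_{i=1}^k\int g_i^{(\theta)}(x)f(T_i^{(\lambda)}x)\,d\mu(x)$ for every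 continuous $f:[0,1]\to\mathbb R$.
   Formalization: Besides the expansion at λ=0, the map λ ↦ T_i^{(λ)} is assumed to be C^{m-1} from I_ε into C^{m+β}; with the expansion at 0 alone the claim fails, e.g. T_i^{(λ)}(x)=x/3+i/6+λ²1_Q(λ), g_i=1/2, k=l=m=2, w(x)=x. *)

theory Defs
  imports "HOL-Probability.Probability" "HOL-Library.Landau_Symbols"
begin

text \<open>
  Functions on \<open>[0,1]\<close> are represented by functions \<open>real \<Rightarrow> real\<close> of which only the values on
  \<open>{0..1}\<close> matter; derivatives at the end points are one-sided.
\<close>

primrec diffI :: "nat \<Rightarrow> (real \<Rightarrow> real) \<Rightarrow> real \<Rightarrow> real" where
  "diffI 0 v = v"
| "diffI (Suc n) v = (\<lambda>x. vector_derivative (diffI n v) (at x within {0..1}))"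

definition times_differentiable :: "nat \<Rightarrow> (real \<Rightarrow> real) \<Rightarrow> bool" where
  "times_differentiable n v \<longleftrightarrow>
     (\<forall>i<n. \<forall>x\<in>{0..1}. diffI i v differentiable (at x within {0..1}))"

definition smooth_I :: "(real \<Rightarrow> real) \<Rightarrow> bool" where
  "smooth_I v \<longleftrightarrow> (\<forall>n. times_differentiable n v)"

definition norm_C0 :: "(real \<Rightarrow> real) \<Rightarrow> real" where
  "norm_C0 v = (SUP x\<in>{0..1}. \<bar>v x\<bar>)"

definition norm_C :: "nat \<Rightarrow> (real \<Rightarrow> real) \<Rightarrow> real" where
  "norm_C n v = (MAX i\<in>{0..n}. norm_C0 (diffI i v))"

definition holder_quotients :: "real \<Rightarrow> (real \<Rightarrow> real) \<Rightarrow> real set" where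
  "holder_quotients \<delta> u =
     {\<bar>u x - u y\<bar> / \<bar>x - y\<bar> powr \<delta> | x y. x \<in> {0..1} \<and> y \<in> {0..1} \<and> x \<noteq> y}"

definition norm_CH :: "nat \<Rightarrow> real \<Rightarrow> (real \<Rightarrow> real) \<Rightarrow> real" where
  "norm_CH n \<delta> v = max (Sup (holder_quotients \<delta> (diffI n v))) (norm_C n v)"

text \<open>
  \<open>Sup\<close> on the reals is unspecified for unbounded sets, so finiteness of the norm is expressed
  by boundedness of the sets whose suprema enter it.
\<close>

definition CH :: "nat \<Rightarrow> real \<Rightarrow> (real \<Rightarrow> real) set" where
  "CH n \<delta> = {v. times_differentiable n v \<and>
     (\<forall>i\<le>n. bdd_above ((\<lambda>x. \<bar>diffI i v x\<bar>) ` {0..1})) \<and>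
     bdd_above (holder_quotients \<delta> (diffI n v))}"

definition Lip :: "(real \<Rightarrow> real) \<Rightarrow> real" where
  "Lip A = Inf {L. L-lipschitz_on {0..1} A}"

definition contraction_I :: "(real \<Rightarrow> real) \<Rightarrow> bool" where
  "contraction_I A \<longleftrightarrow> A ` {0..1} \<subseteq> {0..1} \<and> (\<exists>L. L-lipschitz_on {0..1} A) \<and> Lip A < 1"

text \<open>
  \<open>F t = A + t a\<^sub>1 + \<dots> + t\<^sup>p a\<^sub>p + o(t\<^sup>p)\<close> as \<open>t \<rightarrow> 0\<close>, in the norm of \<open>C\<^sup>n\<^sup>+\<^sup>\<delta>\<close>. The filter
  \<open>nhds 0\<close> includes the parameter \<open>t = 0\<close>; for \<open>p \<ge> 1\<close> this forces \<open>F 0 = A\<close> on \<open>[0,1]\<close>.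
\<close>

definition has_expansion ::
  "nat \<Rightarrow> real \<Rightarrow> nat \<Rightarrow> (real \<Rightarrow> real \<Rightarrow> real) \<Rightarrow> (real \<Rightarrow> real) \<Rightarrow> (nat \<Rightarrow> real \<Rightarrow> real) \<Rightarrow> bool" where
  "has_expansion n \<delta> p F A a \<longleftrightarrow>
     (\<lambda>t. norm_CH n \<delta> (\<lambda>x. F t x - (A x + (\<Sum>j=1..p. t ^ j * a j x)))) \<in> o[nhds 0](\<lambda>t. t ^ p)"

text \<open>
  The curve \<open>F\<close>, defined on an open set \<open>I\<close> of parameters and with values in the Banach space
  \<open>C\<^sup>n\<^sup>+\<^sup>\<delta>\<close>, is \<open>p\<close> times continuously differentiable; \<open>D j\<close> is its \<open>j\<close>-th derivative. An expansion
  at the single parameter 0 says nothing about the dependence on the parameter elsewhere (the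
  remainder may even be discontinuous in it); this is the condition that makes an expansion of
  order \<open>p\<close> available at every parameter of \<open>I\<close>, with coefficients \<open>D j t / j!\<close> continuous in \<open>t\<close>.
\<close>

definition C_curve :: "nat \<Rightarrow> real \<Rightarrow> nat \<Rightarrow> real set \<Rightarrow> (real \<Rightarrow> real \<Rightarrow> real) \<Rightarrow> bool" where
  "C_curve n \<delta> p I F \<longleftrightarrow>
     (\<exists>D. (\<forall>t\<in>I. \<forall>x\<in>{0..1}. D 0 t x = F t x) \<and>
          (\<forall>j\<le>p. \<forall>t\<in>I. D j t \<in> CH n \<delta>) \<and>
          (\<forall>j<p. \<forall>t\<in>I.
             ((\<lambda>h. norm_CH n \<delta> (\<lambda>x. (D j (t + h) x - D j t x) / h - D (Suc j) t x)) \<longlongrightarrow> 0) (at 0)) \<and>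
          (\<forall>t\<in>I. ((\<lambda>h. norm_CH n \<delta> (\<lambda>x. D p (t + h) x - D p t x)) \<longlongrightarrow> 0) (at 0)))"

definition stationary_measure ::
  "nat \<Rightarrow> (nat \<Rightarrow> real \<Rightarrow> real) \<Rightarrow> (nat \<Rightarrow> real \<Rightarrow> real) \<Rightarrow> real measure \<Rightarrow> bool" where
  "stationary_measure k g T \<mu> \<longleftrightarrow>
     prob_space \<mu> \<and> sets \<mu> = sets (restrict_space borel {0..1}) \<and>
     (\<forall>f. continuous_on {0..1} f \<longrightarrow>
        (\<integral>x. f x \<partial>\<mu>) = (\<Sum>i=1..k. \<integral>x. g i x * f (T i x) \<partial>\<mu>))"

text \<open>The class \<open>C\<^sup>p\<close> on an open set of reals.\<close>

definition C_on :: "nat \<Rightarrow> real set \<Rightarrow> (real \<Rightarrow> real) \<Rightarrow> bool" where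
  "C_on p S f \<longleftrightarrow>
     (\<forall>j<p. (deriv ^^ j) f differentiable_on S) \<and> continuous_on S ((deriv ^^ p) f)"

end

theory Submission
  imports Defs
begin

text \<open>
  Write \<open>L\<^sub>t f = (\<Sum>i. g\<^sub>i \<cdot> f \<circ> T\<^sub>i\<^sup>t)\<close> for the averaging operator at the parameter \<open>t\<close> (the weights
  belong to the fixed \<open>\<theta>\<close>) and put \<open>u\<^sub>N(t, x) = (L\<^sub>t\<^sup>N w)(x)\<close>. Since \<open>\<integral>w d\<mu>\<^sub>t = \<integral>u\<^sub>N(t, \<cdot>) d\<mu>\<^sub>t\<close>, the
  integral is the limit of \<open>u\<^sub>N(t, 0)\<close> as soon as the oscillation of \<open>u\<^sub>N(t, \<cdot>)\<close> tends to \<open>0\<close>. So it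
  suffices to show that, for \<open>j < min l m\<close>, the derivatives \<open>\<partial>\<^sub>t\<^sup>j u\<^sub>N(t, 0)\<close> converge locally
  uniformly in \<open>t\<close>; in fact the increments \<open>\<partial>\<^sub>t\<^sup>j u\<^sub>N\<^sub>+\<^sub>1 - \<partial>\<^sub>t\<^sup>j u\<^sub>N\<close> decay exponentially.

  For one parameter the reason is a spectral gap (\<open>average_spectral_gap\<close>): \<open>L\<^sub>t\<^sup>N\<close> contracts the
  supremum of \<open>\<bar>f'\<bar>\<close> exponentially. Differentiating \<open>L\<^sub>t f\<close> gives
  \<open>\<bar>(L\<^sub>t f)'\<bar> \<le> \<alpha> sup \<bar>f'\<bar> + G osc f\<close> with \<open>\<alpha> < 1\<close> by average contraction, and the oscillation is
  reduced by a coupling: with probability at least \<open>\<gamma>\<^sup>N\<close> two orbits use the first map \<open>N\<close> times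
  and end up at distance at most \<open>\<kappa>\<^sup>N\<close>. Combining the two estimates, with a small weight on the
  derivative, yields a contraction with constants that are locally uniform in the parameter.

  Higher \<open>x\<close> derivatives are easier: \<open>v = \<partial>\<^sub>x u\<close> obeys a recursion whose weights are \<open>g\<^sub>i T\<^sub>i'\<close>,
  of total mass below one, with the inhomogeneity \<open>(\<Sum>i. g\<^sub>i' \<cdot> u \<circ> T\<^sub>i)\<close>. As \<open>(\<Sum>i. g\<^sub>i') = 0\<close>, in that
  inhomogeneity \<open>u\<close> may be replaced by \<open>u - u(\<cdot>, 0)\<close>, an antiderivative of \<open>v\<close>: its decay at one
  order follows from that of \<open>v\<close> at the order below (\<open>x_derivative_decays\<close>).

  Derivatives in \<open>t\<close> are treated by induction (\<open>derivatives_decay\<close>): \<open>\<partial>\<^sub>t u\<^sub>N\<close> obeys the recursion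
  of \<open>u\<^sub>N\<close> with the additional inhomogeneity \<open>(\<Sum>i. g\<^sub>i \<cdot> \<partial>\<^sub>t T\<^sub>i \<cdot> (\<partial>\<^sub>x u\<^sub>N) \<circ> T\<^sub>i)\<close>. It contains only
  an \<open>x\<close> derivative of \<open>u\<^sub>N\<close>, hence decays by the previous step. Each \<open>t\<close> derivative costs one
  derivative in \<open>x\<close>, and one \<open>x\<close> derivative must be left at the end for the spectral gap; this is
  why \<open>min l m\<close> orders of smoothness give \<open>min l m - 1\<close> derivatives in \<open>t\<close>.
\<close>

section \<open>Regularity of sequences of functions on a strip\<close>

lemma derivative_unique_unit_interval:
  fixes f :: "real \<Rightarrow> real"
  assumes "(f has_real_derivative D) (at x within {0..1})"
    and "(f has_real_derivative D') (at x within {0..1})" and "x \<in> {0..1}"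
  shows "D = D'"
  using assms vector_derivative_unique_within_closed_interval[of 0 1 x f D D']
  by (simp add: has_real_derivative_iff_has_vector_derivative cbox_interval)

text \<open>
  This cancellation makes the derivative of an average insensitive to constants: the weights'
  derivatives only see differences of the averaged function.
\<close>
lemma sum_derivatives_of_weights:
  fixes g g' :: "nat \<Rightarrow> real \<Rightarrow> real"
  assumes "\<And>i. i \<in> A \<Longrightarrow> (g i has_real_derivative g' i x) (at x within {0..1})"
    and "\<And>y. y \<in> {0..1} \<Longrightarrow> (\<Sum>i\<in>A. g i y) = 1" and x: "x \<in> {0..1}"
  shows "(\<Sum>i\<in>A. g' i x) = 0"
proof (rule derivative_unique_unit_interval[OF _ _ x])
  show "((\<lambda>x. \<Sum>i\<in>A. g i x) has_real_derivative (\<Sum>i\<in>A. g' i x)) (at x within {0..1})"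
    by (rule DERIV_sum) (rule assms(1))
  show "((\<lambda>x. \<Sum>i\<in>A. g i x) has_real_derivative 0) (at x within {0..1})"
    by (rule has_field_derivative_transform_within[OF DERIV_const zero_less_one x])
      (rule assms(2)[symmetric])
qed

text \<open>
  The strip is \<open>I \<times> {0..1}\<close>; its points are written \<open>t\<close> (parameter) and \<open>x\<close>. Derivatives in \<open>x\<close>
  are one-sided at the end points.
\<close>
locale strip =
  fixes I :: "real set"
  assumes open_I: "open I"
begin

definition strip_cont :: "(real \<Rightarrow> real \<Rightarrow> real) \<Rightarrow> bool" where
  "strip_cont f \<longleftrightarrow> continuous_on (I \<times> {0..1}) (\<lambda>p. f (fst p) (snd p))"

definition x_deriv :: "(real \<Rightarrow> real \<Rightarrow> real) \<Rightarrow> (real \<Rightarrow> real \<Rightarrow> real) \<Rightarrow> bool" where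
  "x_deriv f f' \<longleftrightarrow>
     (\<forall>t\<in>I. \<forall>x\<in>{0..1}. (f t has_real_derivative f' t x) (at x within {0..1}))"

definition t_deriv :: "(real \<Rightarrow> real \<Rightarrow> real) \<Rightarrow> (real \<Rightarrow> real \<Rightarrow> real) \<Rightarrow> bool" where
  "t_deriv f f' \<longleftrightarrow>
     (\<forall>t\<in>I. \<forall>x\<in>{0..1}. ((\<lambda>s. f s x) has_real_derivative f' t x) (at t))"

text \<open>
  The rate may depend on \<open>t0\<close>: the contraction factors are below one at each parameter but need
  not be bounded away from one on all of \<open>I\<close>.
\<close>
definition decaying :: "(nat \<Rightarrow> real \<Rightarrow> real \<Rightarrow> real) \<Rightarrow> bool" where
  "decaying F \<longleftrightarrow> (\<forall>t0\<in>I. \<exists>\<delta>>0. \<exists>C\<ge>0. \<exists>\<rho>. 0 < \<rho> \<and> \<rho> < 1 \<and>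
     (\<forall>N. \<forall>t\<in>I. \<forall>x\<in>{0..1}. \<bar>t - t0\<bar> < \<delta> \<longrightarrow> \<bar>F N t x\<bar> \<le> C * \<rho> ^ N))"

text \<open>
  The flag allows coefficients, viewed as constant sequences and only asked to be continuous, to
  share one calculus with sequences that are also asked to decay.
\<close>
definition controlled :: "bool \<Rightarrow> (nat \<Rightarrow> real \<Rightarrow> real \<Rightarrow> real) \<Rightarrow> bool" where
  "controlled d F \<longleftrightarrow> (\<forall>N. strip_cont (F N)) \<and> (d \<longrightarrow> decaying F)"

text \<open>
  In \<open>regular d a s F\<close> the number \<open>s\<close> bounds the total order of differentiation and \<open>a\<close> the number
  of \<open>t\<close> derivatives: \<open>\<partial>\<^sub>t\<^sup>j F\<close> has \<open>s - j\<close> controlled \<open>x\<close> derivatives for each \<open>j \<le> a\<close>. Taking the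
  \<open>t\<close> derivatives first keeps the recursion simple; that the order does not matter is
  shown in \<open>regular_of_x_deriv\<close>. The value \<open>False\<close> in the middle
  equation of \<open>regular\<close> enforces \<open>a \<le> s\<close>.
\<close>
fun regular_x :: "bool \<Rightarrow> nat \<Rightarrow> (nat \<Rightarrow> real \<Rightarrow> real \<Rightarrow> real) \<Rightarrow> bool" where
  "regular_x d 0 F \<longleftrightarrow> controlled d F"
| "regular_x d (Suc s) F \<longleftrightarrow>
     controlled d F \<and> (\<exists>F'. (\<forall>N. x_deriv (F N) (F' N)) \<and> regular_x d s F')"

fun regular :: "bool \<Rightarrow> nat \<Rightarrow> nat \<Rightarrow> (nat \<Rightarrow> real \<Rightarrow> real \<Rightarrow> real) \<Rightarrow> bool" where
  "regular d 0 s F \<longleftrightarrow> regular_x d s F"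
| "regular d (Suc a) 0 F \<longleftrightarrow> False"
| "regular d (Suc a) (Suc s) F \<longleftrightarrow>
     regular_x d (Suc s) F \<and> (\<exists>F'. (\<forall>N. t_deriv (F N) (F' N)) \<and> regular d a s F')"

abbreviation smooth_coeff :: "nat \<Rightarrow> nat \<Rightarrow> (real \<Rightarrow> real \<Rightarrow> real) \<Rightarrow> bool" where
  "smooth_coeff a s c \<equiv> regular False a s (\<lambda>_. c)"

lemma regular_order: "regular d a s F \<Longrightarrow> a \<le> s"
  by (induction d a s F rule: regular.induct) auto

lemma regular_x_controlled: "regular_x d s F \<Longrightarrow> controlled d F"
  by (cases s) auto

lemma regular_regular_x: "regular d a s F \<Longrightarrow> regular_x d s F"
  by (cases "(d, a, s, F)" rule: regular.cases) auto

lemma strip_cong: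
  assumes "\<And>t x. t \<in> I \<Longrightarrow> x \<in> {0..1} \<Longrightarrow> f t x = g t x"
  shows strip_cont_cong: "strip_cont f \<Longrightarrow> strip_cont g"
    and x_deriv_cong: "x_deriv f f' \<Longrightarrow> x_deriv g f'"
    and t_deriv_cong: "t_deriv f f' \<Longrightarrow> t_deriv g f'"
proof -
  show "strip_cont f \<Longrightarrow> strip_cont g"
    unfolding strip_cont_def by (erule continuous_on_eq) (use assms in auto)
  show "x_deriv f f' \<Longrightarrow> x_deriv g f'"
    unfolding x_deriv_def
  proof (intro ballI)
    fix t x assume *: "\<forall>t\<in>I. \<forall>x\<in>{0..1}. (f t has_real_derivative f' t x) (at x within {0..1})"
      "t \<in> I" "x \<in> {0..1::real}"
    then have "(f t has_real_derivative f' t x) (at x within {0..1})"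
      by blast
    then show "(g t has_real_derivative f' t x) (at x within {0..1})"
      by (rule has_field_derivative_transform_within[OF _ zero_less_one *(3)])
        (rule assms[OF *(2)])
  qed
  show "t_deriv f f' \<Longrightarrow> t_deriv g f'"
    unfolding t_deriv_def
  proof (intro ballI)
    fix t x assume *: "\<forall>t\<in>I. \<forall>x\<in>{0..1}. ((\<lambda>s. f s x) has_real_derivative f' t x) (at t)"
      "t \<in> I" "x \<in> {0..1::real}"
    then have "((\<lambda>s. f s x) has_real_derivative f' t x) (at t)"
      by blast
    then show "((\<lambda>s. g s x) has_real_derivative f' t x) (at t)"
      by (rule has_field_derivative_transform_within_open[OF _ open_I *(2)])
        (rule assms[OF _ *(3)])
  qed
qed

lemma decaying_mono:
  assumes "decaying F"
    and "\<And>N t x. t \<in> I \<Longrightarrow> x \<in> {0..1} \<Longrightarrow> \<bar>G N t x\<bar> \<le> \<bar>F N t x\<bar>"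
  shows "decaying G"
  unfolding decaying_def
proof
  fix t0 assume "t0 \<in> I"
  then obtain \<delta> C \<rho> where "\<delta> > 0" "C \<ge> 0" "0 < \<rho>" "\<rho> < 1"
    and F: "\<And>N t x. t \<in> I \<Longrightarrow> x \<in> {0..1} \<Longrightarrow> \<bar>t - t0\<bar> < \<delta> \<Longrightarrow> \<bar>F N t x\<bar> \<le> C * \<rho> ^ N"
    using assms(1) unfolding decaying_def by blast
  moreover have "\<bar>G N t x\<bar> \<le> C * \<rho> ^ N"
    if "t \<in> I" "x \<in> {0..1}" "\<bar>t - t0\<bar> < \<delta>" for N t x
    using assms(2)[OF that(1,2), of N] F[OF that, of N] by simp
  ultimately show "\<exists>\<delta>>0. \<exists>C\<ge>0. \<exists>\<rho>. 0 < \<rho> \<and> \<rho> < 1 \<and>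
     (\<forall>N. \<forall>t\<in>I. \<forall>x\<in>{0..1}. \<bar>t - t0\<bar> < \<delta> \<longrightarrow> \<bar>G N t x\<bar> \<le> C * \<rho> ^ N)"
    by blast
qed

lemma controlled_cong:
  assumes "controlled d F"
    and "\<And>N t x. t \<in> I \<Longrightarrow> x \<in> {0..1} \<Longrightarrow> F N t x = G N t x"
  shows "controlled d G"
  using assms strip_cont_cong[of "F _" "G _"] decaying_mono[of F G]
  unfolding controlled_def by auto

lemma regular_x_cong:
  assumes "regular_x d s F"
    and eq: "\<And>N t x. t \<in> I \<Longrightarrow> x \<in> {0..1} \<Longrightarrow> F N t x = G N t x"
  shows "regular_x d s G"
proof (cases s)
  case 0
  then show ?thesis using assms controlled_cong by simp
next
  case (Suc s')
  obtain F' where F': "\<And>N. x_deriv (F N) (F' N)" "regular_x d s' F'" "controlled d F"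
    using assms(1) Suc by auto
  have "x_deriv (G N) (F' N)" for N
    by (rule x_deriv_cong[OF eq F'(1)])
  moreover have "controlled d G"
    by (rule controlled_cong[OF F'(3) eq])
  ultimately show ?thesis using F'(2) Suc by auto
qed

lemma regular_cong:
  assumes "regular d a s F"
    and eq: "\<And>N t x. t \<in> I \<Longrightarrow> x \<in> {0..1} \<Longrightarrow> F N t x = G N t x"
  shows "regular d a s G"
proof (cases a)
  case 0
  then show ?thesis using assms regular_x_cong by simp
next
  case (Suc a')
  then obtain F' s' where F': "s = Suc s'" "\<And>N. t_deriv (F N) (F' N)" "regular d a' s' F'"
    "regular_x d s F"
    using assms(1) by (cases s) auto
  have "t_deriv (G N) (F' N)" for N
    by (rule t_deriv_cong[OF eq F'(2)])
  moreover have "regular_x d s G"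
    by (rule regular_x_cong[OF F'(4) eq])
  ultimately show ?thesis using F' Suc by auto
qed

lemma x_deriv_unique:
  assumes "x_deriv f f'" "x_deriv f f''" "t \<in> I" "x \<in> {0..1}"
  shows "f' t x = f'' t x"
  using assms derivative_unique_unit_interval unfolding x_deriv_def by blast

lemma t_deriv_unique:
  assumes "t_deriv f f'" "t_deriv f f''" "t \<in> I" "x \<in> {0..1}"
  shows "f' t x = f'' t x"
  using assms unfolding t_deriv_def by (blast intro: DERIV_unique)

lemma regular_x_of_x_deriv:
  assumes "regular_x d (Suc s) F" "\<And>N. x_deriv (F N) (F' N)"
  shows "regular_x d s F'"
proof -
  obtain F'' where F'': "\<And>N. x_deriv (F N) (F'' N)" "regular_x d s F''"
    using assms(1) by auto
  show ?thesis
    by (rule regular_x_cong[OF F''(2)]) (rule x_deriv_unique[OF F''(1) assms(2)])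
qed

lemma regular_x_Suc_mono: "regular_x d (Suc s) F \<Longrightarrow> regular_x d s F"
  by (induction s arbitrary: F) auto

lemma regular_Suc_mono: "regular d a (Suc s) F \<Longrightarrow> a \<le> s \<Longrightarrow> regular d a s F"
proof (induction a arbitrary: s F)
  case (Suc a)
  then obtain s' where s: "s = Suc s'" by (cases s) auto
  show ?case using Suc s regular_x_Suc_mono[of d s F] by auto
qed (use regular_x_Suc_mono in simp)

lemma regular_mono: "regular d a s' F \<Longrightarrow> a \<le> s \<Longrightarrow> s \<le> s' \<Longrightarrow> regular d a s F"
proof (induction s')
  case (Suc n)
  then show ?case
    using regular_Suc_mono[of d a n F] by (auto simp: le_Suc_eq)
qed simp

lemma regular_mono_t: "regular d a s F \<Longrightarrow> a' \<le> a \<Longrightarrow> regular d a' s F"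
proof (induction a arbitrary: a' s F)
  case (Suc a)
  then show ?case
    by (cases s; cases a') auto
qed auto

text \<open>
  When no decay is asked for, the terms of a sequence are unrelated, and their derivatives can be
  chosen one by one.
\<close>
lemma regular_x_pointwise:
  "(\<And>N. regular_x False s (\<lambda>_. F N)) \<Longrightarrow> regular_x False s F"
proof (induction s arbitrary: F)
  case 0
  then show ?case by (auto simp: controlled_def)
next
  case (Suc s)
  have "\<exists>G. x_deriv (F N) G \<and> regular_x False s (\<lambda>_. G)" for N
  proof -
    obtain G where G: "\<And>n::nat. x_deriv (F N) (G n)" "regular_x False s G"
      using Suc.prems[of N] by auto
    have "regular_x False s (\<lambda>_. G 0)"
      by (rule regular_x_cong[OF G(2)]) (rule x_deriv_unique[OF G(1) G(1)])
    then show ?thesis using G by auto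
  qed
  then obtain G where "\<And>N. x_deriv (F N) (G N) \<and> regular_x False s (\<lambda>_. G N)"
    by metis
  then have "\<forall>N. x_deriv (F N) (G N)" "regular_x False s G"
    using Suc.IH[of G] by auto
  moreover have "controlled False F"
    using Suc.prems by (auto simp: controlled_def)
  ultimately show ?case by auto
qed

lemma regular_pointwise:
  "(\<And>N. regular False a s (\<lambda>_. F N)) \<Longrightarrow> regular False a s F"
proof (induction a arbitrary: s F)
  case 0
  then show ?case by (simp add: regular_x_pointwise)
next
  case (Suc a)
  obtain s' where s: "s = Suc s'" using Suc.prems[of 0] by (cases s) auto
  have "\<exists>G. t_deriv (F N) G \<and> regular False a s' (\<lambda>_. G)" for N
  proof -
    obtain G where G: "\<And>n::nat. t_deriv (F N) (G n)" "regular False a s' G"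
      using Suc.prems[of N] s by auto
    have "regular False a s' (\<lambda>_. G 0)"
      by (rule regular_cong[OF G(2)]) (rule t_deriv_unique[OF G(1) G(1)])
    then show ?thesis using G by auto
  qed
  then obtain G where "\<And>N. t_deriv (F N) (G N) \<and> regular False a s' (\<lambda>_. G N)"
    by metis
  moreover have "regular_x False (Suc s') F"
    using Suc.prems s regular_regular_x by (blast intro: regular_x_pointwise)
  ultimately show ?case using Suc.IH[of s' G] s by auto
qed

lemma regular_imp_x_deriv:
  assumes "regular d a (Suc s) F"
  obtains F' where "\<And>N. x_deriv (F N) (F' N)"
  using regular_regular_x[OF assms] by auto

lemma regular_imp_t_deriv:
  assumes "regular d (Suc a) s F"
  obtains F' s' where "s = Suc s'" "\<And>N. t_deriv (F N) (F' N)" "regular d a s' F'"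
  using assms by (cases s) auto

subsection \<open>Continuity, decay and derivatives on the strip\<close>

lemma decayingE:
  assumes "decaying F" "t0 \<in> I"
  obtains \<delta> C \<rho> where "\<delta> > 0" "C \<ge> 0" "0 < \<rho>" "\<rho> < 1"
    "\<And>N t x. t \<in> I \<Longrightarrow> x \<in> {0..1} \<Longrightarrow> \<bar>t - t0\<bar> < \<delta> \<Longrightarrow> \<bar>F N t x\<bar> \<le> C * \<rho> ^ N"
  using assms unfolding decaying_def by blast

lemma decayingI:
  assumes "\<And>t0. t0 \<in> I \<Longrightarrow> \<exists>\<delta>>0. \<exists>C\<ge>0. \<exists>\<rho>. 0 < \<rho> \<and> \<rho> < 1 \<and>
     (\<forall>N. \<forall>t\<in>I. \<forall>x\<in>{0..1}. \<bar>t - t0\<bar> < \<delta> \<longrightarrow> \<bar>F N t x\<bar> \<le> C * \<rho> ^ N)"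
  shows "decaying F"
  using assms unfolding decaying_def by blast

text \<open>
  Compactness turns pointwise strict bounds into locally uniform ones: the bound is the value of
  \<open>h\<close> at a point of the strip.
\<close>
lemma strip_cont_max:
  assumes "strip_cont h" "t0 \<in> I"
  obtains \<delta> t1 x1 where "\<delta> > 0" "t1 \<in> I" "x1 \<in> {0..1}"
    "\<And>t x. x \<in> {0..1} \<Longrightarrow> \<bar>t - t0\<bar> < \<delta> \<Longrightarrow> h t x \<le> h t1 x1"
proof -
  obtain \<delta> where \<delta>: "\<delta> > 0" "cball t0 \<delta> \<subseteq> I"
    using open_I assms(2) open_contains_cball by blast
  let ?K = "cball t0 \<delta> \<times> {0..1::real}"
  have "compact ?K" by (intro compact_Times) auto
  moreover have "?K \<noteq> {}" using \<delta> by auto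
  moreover have "continuous_on ?K (\<lambda>p. h (fst p) (snd p))"
    using assms(1) unfolding strip_cont_def
    by (rule continuous_on_subset) (use \<delta>(2) in auto)
  ultimately obtain p where p: "p \<in> ?K" "\<forall>y\<in>?K. h (fst y) (snd y) \<le> h (fst p) (snd p)"
    using continuous_attains_sup by blast
  show thesis
  proof (rule that[OF \<delta>(1)])
    show "fst p \<in> I" "snd p \<in> {0..1}" using p(1) \<delta>(2) by auto
    show "h t x \<le> h (fst p) (snd p)" if "x \<in> {0..1}" "\<bar>t - t0\<bar> < \<delta>" for t x
      using p(2)[rule_format, of "(t, x)"] that by (auto simp: dist_real_def abs_minus_commute)
  qed
qed

lemma strip_cont_intros:
  shows strip_cont_add: "strip_cont f \<Longrightarrow> strip_cont g \<Longrightarrow> strip_cont (\<lambda>t x. f t x + g t x)"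
    and strip_cont_mult: "strip_cont f \<Longrightarrow> strip_cont g \<Longrightarrow> strip_cont (\<lambda>t x. f t x * g t x)"
    and strip_cont_abs: "strip_cont f \<Longrightarrow> strip_cont (\<lambda>t x. \<bar>f t x\<bar>)"
    and strip_cont_const: "strip_cont (\<lambda>t x. b)"
    and strip_cont_sum: "(\<And>i. i \<in> A \<Longrightarrow> strip_cont (F i)) \<Longrightarrow> strip_cont (\<lambda>t x. \<Sum>i\<in>A. F i t x)"
  unfolding strip_cont_def by (auto intro!: continuous_intros)

lemma strip_cont_comp:
  assumes "strip_cont f" "strip_cont \<tau>" "\<And>t x. t \<in> I \<Longrightarrow> x \<in> {0..1} \<Longrightarrow> \<tau> t x \<in> {0..1}"
  shows "strip_cont (\<lambda>t x. f t (\<tau> t x))"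
proof -
  have "continuous_on (I \<times> {0..1}) (\<lambda>p. (fst p, \<tau> (fst p) (snd p)))"
    using assms(2) unfolding strip_cont_def by (intro continuous_intros)
  moreover have "(\<lambda>p. (fst p, \<tau> (fst p) (snd p))) ` (I \<times> {0..1}) \<subseteq> I \<times> {0..1}"
    using assms(3) by auto
  ultimately show ?thesis
    using continuous_on_compose2[OF assms(1)[unfolded strip_cont_def], of _ "\<lambda>p. (fst p, \<tau> (fst p) (snd p))"]
    unfolding strip_cont_def by simp
qed

lemma strip_cont_x:
  assumes "strip_cont f" "t \<in> I"
  shows "continuous_on {0..1} (f t)"
proof -
  have "continuous_on {0..1} (\<lambda>x. (t, x))" by (intro continuous_intros)
  moreover have "(\<lambda>x. (t, x)) ` {0..1} \<subseteq> I \<times> {0..1}" using assms(2) by auto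
  ultimately show ?thesis
    using continuous_on_compose2[OF assms(1)[unfolded strip_cont_def], of _ "\<lambda>x. (t, x)"] by simp
qed

lemma strip_cont_t:
  assumes "strip_cont f" "x \<in> {0..1}"
  shows "continuous_on I (\<lambda>t. f t x)"
proof -
  have "continuous_on I (\<lambda>t. (t, x))" by (intro continuous_intros)
  moreover have "(\<lambda>t. (t, x)) ` I \<subseteq> I \<times> {0..1}" using assms(2) by auto
  ultimately show ?thesis
    using continuous_on_compose2[OF assms(1)[unfolded strip_cont_def], of _ "\<lambda>t. (t, x)"] by simp
qed

lemma decaying_add:
  assumes "decaying F" "decaying G"
  shows "decaying (\<lambda>N t x. F N t x + G N t x)"
proof (rule decayingI)
  fix t0 assume t0: "t0 \<in> I"
  obtain \<delta>1 C1 \<rho>1 where 1: "\<delta>1 > 0" "C1 \<ge> 0" "0 < \<rho>1" "\<rho>1 < 1"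
    "\<And>N t x. t \<in> I \<Longrightarrow> x \<in> {0..1} \<Longrightarrow> \<bar>t - t0\<bar> < \<delta>1 \<Longrightarrow> \<bar>F N t x\<bar> \<le> C1 * \<rho>1 ^ N"
    using decayingE[OF assms(1) t0] by metis
  obtain \<delta>2 C2 \<rho>2 where 2: "\<delta>2 > 0" "C2 \<ge> 0" "0 < \<rho>2" "\<rho>2 < 1"
    "\<And>N t x. t \<in> I \<Longrightarrow> x \<in> {0..1} \<Longrightarrow> \<bar>t - t0\<bar> < \<delta>2 \<Longrightarrow> \<bar>G N t x\<bar> \<le> C2 * \<rho>2 ^ N"
    using decayingE[OF assms(2) t0] by metis
  define \<rho> where "\<rho> = max \<rho>1 \<rho>2"
  have "\<bar>F N t x + G N t x\<bar> \<le> (C1 + C2) * \<rho> ^ N"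
    if "t \<in> I" "x \<in> {0..1}" "\<bar>t - t0\<bar> < min \<delta>1 \<delta>2" for N t x
  proof -
    have "\<rho>1 ^ N \<le> \<rho> ^ N" "\<rho>2 ^ N \<le> \<rho> ^ N"
      using 1 2 by (auto simp: \<rho>_def intro!: power_mono)
    then have "C1 * \<rho>1 ^ N \<le> C1 * \<rho> ^ N" "C2 * \<rho>2 ^ N \<le> C2 * \<rho> ^ N"
      using 1 2 by (auto intro: mult_left_mono)
    then show ?thesis
      using 1(5)[OF that(1,2), of N] 2(5)[OF that(1,2), of N] that(3)
      by (simp add: algebra_simps)
  qed
  then show "\<exists>\<delta>>0. \<exists>C\<ge>0. \<exists>\<rho>. 0 < \<rho> \<and> \<rho> < 1 \<and>
     (\<forall>N. \<forall>t\<in>I. \<forall>x\<in>{0..1}. \<bar>t - t0\<bar> < \<delta> \<longrightarrow> \<bar>F N t x + G N t x\<bar> \<le> C * \<rho> ^ N)"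
    using 1 2 by (intro exI[of _ "min \<delta>1 \<delta>2"] exI[of _ "C1 + C2"] exI[of _ \<rho>] conjI)
      (auto simp: \<rho>_def)
qed

lemma decaying_mult:
  assumes "strip_cont c" "decaying F"
  shows "decaying (\<lambda>N t x. c t x * F N t x)"
proof (rule decayingI)
  fix t0 assume t0: "t0 \<in> I"
  obtain \<delta>1 C1 \<rho>1 where 1: "\<delta>1 > 0" "C1 \<ge> 0" "0 < \<rho>1" "\<rho>1 < 1"
    "\<And>N t x. t \<in> I \<Longrightarrow> x \<in> {0..1} \<Longrightarrow> \<bar>t - t0\<bar> < \<delta>1 \<Longrightarrow> \<bar>F N t x\<bar> \<le> C1 * \<rho>1 ^ N"
    using decayingE[OF assms(2) t0] by metis
  obtain \<delta>2 t2 x2 where 2: "\<delta>2 > 0"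
    "\<And>t x. x \<in> {0..1} \<Longrightarrow> \<bar>t - t0\<bar> < \<delta>2 \<Longrightarrow> \<bar>c t x\<bar> \<le> \<bar>c t2 x2\<bar>"
    using strip_cont_max[OF strip_cont_abs[OF assms(1)] t0] by metis
  have "\<bar>c t x * F N t x\<bar> \<le> (\<bar>c t2 x2\<bar> * C1) * \<rho>1 ^ N"
    if "t \<in> I" "x \<in> {0..1}" "\<bar>t - t0\<bar> < min \<delta>1 \<delta>2" for N t x
  proof -
    have "\<bar>c t x\<bar> * \<bar>F N t x\<bar> \<le> \<bar>c t2 x2\<bar> * (C1 * \<rho>1 ^ N)"
      using 1(5)[OF that(1,2), of N] 2(2)[OF that(2)] that(3) by (intro mult_mono) auto
    then show ?thesis by (simp add: abs_mult mult.assoc)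
  qed
  then show "\<exists>\<delta>>0. \<exists>C\<ge>0. \<exists>\<rho>. 0 < \<rho> \<and> \<rho> < 1 \<and>
     (\<forall>N. \<forall>t\<in>I. \<forall>x\<in>{0..1}. \<bar>t - t0\<bar> < \<delta> \<longrightarrow> \<bar>c t x * F N t x\<bar> \<le> C * \<rho> ^ N)"
    using 1 2 by (intro exI[of _ "min \<delta>1 \<delta>2"] exI[of _ "\<bar>c t2 x2\<bar> * C1"] exI[of _ \<rho>1] conjI)
      auto
qed

lemma decaying_comp:
  assumes "decaying F" "\<And>t x. t \<in> I \<Longrightarrow> x \<in> {0..1} \<Longrightarrow> \<tau> t x \<in> {0..1}"
  shows "decaying (\<lambda>N t x. F N t (\<tau> t x))"
proof (rule decayingI)
  fix t0 assume t0: "t0 \<in> I"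
  obtain \<delta> C \<rho> where "\<delta> > 0" "C \<ge> 0" "0 < \<rho>" "\<rho> < 1"
    "\<And>N t x. t \<in> I \<Longrightarrow> x \<in> {0..1} \<Longrightarrow> \<bar>t - t0\<bar> < \<delta> \<Longrightarrow> \<bar>F N t x\<bar> \<le> C * \<rho> ^ N"
    using decayingE[OF assms(1) t0] by metis
  then show "\<exists>\<delta>>0. \<exists>C\<ge>0. \<exists>\<rho>. 0 < \<rho> \<and> \<rho> < 1 \<and>
     (\<forall>N. \<forall>t\<in>I. \<forall>x\<in>{0..1}. \<bar>t - t0\<bar> < \<delta> \<longrightarrow> \<bar>F N t (\<tau> t x)\<bar> \<le> C * \<rho> ^ N)"
    using assms(2) by (intro exI[of _ \<delta>] exI[of _ C] exI[of _ \<rho>] conjI) auto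
qed

lemma controlled_add:
  "controlled d F \<Longrightarrow> controlled d G \<Longrightarrow> controlled d (\<lambda>N t x. F N t x + G N t x)"
  by (auto simp: controlled_def intro: strip_cont_add decaying_add)

lemma controlled_mult:
  "strip_cont c \<Longrightarrow> controlled d F \<Longrightarrow> controlled d (\<lambda>N t x. c t x * F N t x)"
  by (auto simp: controlled_def intro: strip_cont_mult decaying_mult)

lemma controlled_comp:
  "controlled d F \<Longrightarrow> strip_cont \<tau> \<Longrightarrow> (\<And>t x. t \<in> I \<Longrightarrow> x \<in> {0..1} \<Longrightarrow> \<tau> t x \<in> {0..1}) \<Longrightarrow>
    controlled d (\<lambda>N t x. F N t (\<tau> t x))"
  by (auto simp: controlled_def intro: strip_cont_comp decaying_comp)

lemma x_deriv_intros:
  shows x_deriv_add: "x_deriv f f' \<Longrightarrow> x_deriv g g' \<Longrightarrow>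
      x_deriv (\<lambda>t x. f t x + g t x) (\<lambda>t x. f' t x + g' t x)"
    and x_deriv_mult: "x_deriv f f' \<Longrightarrow> x_deriv g g' \<Longrightarrow>
      x_deriv (\<lambda>t x. f t x * g t x) (\<lambda>t x. f' t x * g t x + f t x * g' t x)"
  unfolding x_deriv_def by (auto intro!: derivative_eq_intros)

lemma t_deriv_intros:
  shows t_deriv_add: "t_deriv f f' \<Longrightarrow> t_deriv g g' \<Longrightarrow>
      t_deriv (\<lambda>t x. f t x + g t x) (\<lambda>t x. f' t x + g' t x)"
    and t_deriv_mult: "t_deriv f f' \<Longrightarrow> t_deriv g g' \<Longrightarrow>
      t_deriv (\<lambda>t x. f t x * g t x) (\<lambda>t x. f' t x * g t x + f t x * g' t x)"
  unfolding t_deriv_def by (auto intro!: derivative_eq_intros)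

lemma x_deriv_comp:
  assumes "x_deriv f f'" "x_deriv \<tau> \<tau>'" "\<And>t x. t \<in> I \<Longrightarrow> x \<in> {0..1} \<Longrightarrow> \<tau> t x \<in> {0..1}"
  shows "x_deriv (\<lambda>t x. f t (\<tau> t x)) (\<lambda>t x. \<tau>' t x * f' t (\<tau> t x))"
  unfolding x_deriv_def
proof (intro ballI)
  fix t x assume *: "t \<in> I" "x \<in> {0..1::real}"
  have "(f t has_real_derivative f' t (\<tau> t x)) (at (\<tau> t x) within {0..1})"
    using assms * unfolding x_deriv_def by blast
  then have "(f t has_real_derivative f' t (\<tau> t x)) (at (\<tau> t x) within \<tau> t ` {0..1})"
    by (rule has_field_derivative_subset) (use assms(3) * in auto)
  moreover have "(\<tau> t has_real_derivative \<tau>' t x) (at x within {0..1})"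
    using assms * unfolding x_deriv_def by blast
  ultimately show "((\<lambda>x. f t (\<tau> t x)) has_real_derivative \<tau>' t x * f' t (\<tau> t x)) (at x within {0..1})"
    by (subst mult.commute) (rule DERIV_image_chain[of "f t" _ "\<tau> t", unfolded o_def])
qed

text \<open>
  Both slots depend on \<open>t\<close>. Continuity of the partial derivative in \<open>x\<close> provides total
  differentiability relative to the strip, including its boundary lines \<open>x = 0\<close> and \<open>x = 1\<close>, which
  the inner function may reach.
\<close>
lemma t_deriv_comp:
  assumes f: "t_deriv f ft" "x_deriv f fx" "strip_cont fx"
    and \<tau>: "t_deriv \<tau> \<tau>'" "\<And>t x. t \<in> I \<Longrightarrow> x \<in> {0..1} \<Longrightarrow> \<tau> t x \<in> {0..1}"
  shows "t_deriv (\<lambda>t x. f t (\<tau> t x)) (\<lambda>t x. ft t (\<tau> t x) + \<tau>' t x * fx t (\<tau> t x))"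
  unfolding t_deriv_def
proof (intro ballI)
  fix t x assume *: "t \<in> I" "x \<in> {0..1::real}"
  define y where "y = \<tau> t x"
  have y: "y \<in> {0..1}" using \<tau>(2) * by (simp add: y_def)
  have "((\<lambda>(s, z). f s z) has_derivative (\<lambda>(h, k). ft t y * h + blinfun_mult_right (fx t y) k))
          (at (t, y) within I \<times> {0..1})"
  proof (rule has_derivative_partialsI[where fy = "\<lambda>s z. blinfun_mult_right (fx s z)"])
    show "((\<lambda>s. f s y) has_derivative (*) (ft t y)) (at t within I)"
      using f(1) * y unfolding t_deriv_def has_field_derivative_def
      by (auto intro: has_derivative_at_withinI)
    show "(f s has_derivative blinfun_apply (blinfun_mult_right (fx s z))) (at z within {0..1})"
      if "s \<in> I" "z \<in> {0..1}" for s z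
      using f(2) that unfolding x_deriv_def has_field_derivative_def by auto
    have "continuous_on (I \<times> {0..1}) (\<lambda>(s, z). blinfun_mult_right (fx s z))"
      using f(3) unfolding strip_cont_def
      by (auto simp: split_beta intro!: bounded_linear.continuous_on[OF bounded_linear_blinfun_mult_right])
    then show "continuous (at (t, y) within I \<times> {0..1}) (\<lambda>(s, z). blinfun_mult_right (fx s z))"
      using * y by (simp add: continuous_on_eq_continuous_within)
  qed (use y in auto)
  then have D: "((\<lambda>(s, z). f s z) has_derivative (\<lambda>(h, k). ft t y * h + fx t y * k))
          (at (t, y) within (\<lambda>s. (s, \<tau> s x)) ` I)"
    unfolding blinfun_mult_right.rep_eq
    by (rule has_derivative_subset) (use \<tau>(2) *(2) in auto)
  have "((\<lambda>s. (s, \<tau> s x)) has_derivative (\<lambda>h. (h, \<tau>' t x * h))) (at t within I)"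
    using \<tau>(1) * unfolding t_deriv_def has_field_derivative_def
    by (auto intro!: derivative_intros intro: has_derivative_at_withinI)
  from has_derivative_in_compose[OF this D[unfolded y_def]]
  have "((\<lambda>s. f s (\<tau> s x)) has_derivative (\<lambda>h. ft t y * h + fx t y * (\<tau>' t x * h))) (at t within I)"
    by (simp add: y_def)
  moreover have "(\<lambda>h. ft t y * h + fx t y * (\<tau>' t x * h)) = (*) (ft t y + \<tau>' t x * fx t y)"
    by (auto simp: algebra_simps)
  ultimately show "((\<lambda>s. f s (\<tau> s x)) has_real_derivative ft t (\<tau> t x) + \<tau>' t x * fx t (\<tau> t x)) (at t)"
    using at_within_open[OF *(1) open_I] by (simp add: has_field_derivative_def y_def)
qed

text \<open>
  The mixed derivative is only assumed in one order. Integrating \<open>ft\<close> over \<open>t\<close> recovers \<open>f\<close>;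
  differentiating under the integral in \<open>x\<close> shows that \<open>fx\<close> is an integral of \<open>ftx\<close>.
\<close>
lemma t_deriv_x_deriv_commute:
  assumes f: "x_deriv f fx" "t_deriv f ft"
    and ft: "x_deriv ft ftx" "strip_cont ft" "strip_cont ftx"
  shows "t_deriv fx ftx"
  unfolding t_deriv_def
proof (intro ballI)
  fix t0 x0 assume t0: "t0 \<in> I" and x0: "x0 \<in> {0..1::real}"
  obtain e where e: "e > 0" "cball t0 e \<subseteq> I"
    using open_I t0 open_contains_cball by blast
  define a b where "a = t0 - e" and "b = t0 + e"
  have ab: "{a..b} \<subseteq> I" "a < t0" "t0 < b"
    using e by (auto simp: a_def b_def cball_eq_atLeastAtMost)
  then have "a \<in> I" by auto
  have fx: "fx t x0 = fx a x0 + integral {a..t} (\<lambda>s. ftx s x0)" if t: "t \<in> {a..b}" for t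
  proof -
    have at: "{a..t} \<subseteq> I" using ab t by auto
    have cont: "continuous_on {a..t} (\<lambda>s. ft s x)" if "x \<in> {0..1}" for x
      using strip_cont_t[OF ft(2) that] at continuous_on_subset by blast
    have eq: "f t x = f a x + integral {a..t} (\<lambda>s. ft s x)" if x: "x \<in> {0..1}" for x
    proof -
      have "((\<lambda>s. f s x) has_vector_derivative ft s x) (at s within {a..t})" if "s \<in> {a..t}" for s
      proof -
        have "((\<lambda>s. f s x) has_real_derivative ft s x) (at s)"
          using f(2) x at that unfolding t_deriv_def by blast
        then show ?thesis
          unfolding has_real_derivative_iff_has_vector_derivative
          by (rule has_vector_derivative_at_within)
      qed
      then have "((\<lambda>s. ft s x) has_integral (f t x - f a x)) {a..t}"
        using t by (intro fundamental_theorem_of_calculus) auto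
      then show ?thesis by (simp add: integral_unique)
    qed
    have "((\<lambda>x. f a x + integral (cbox a t) (\<lambda>s. ft s x)) has_real_derivative
        fx a x0 + integral (cbox a t) (\<lambda>s. ftx s x0)) (at x0 within {0..1})"
    proof (rule DERIV_add)
      show "(f a has_real_derivative fx a x0) (at x0 within {0..1})"
        using f(1) x0 \<open>a \<in> I\<close> unfolding x_deriv_def by blast
      have "continuous_on ({0..1} \<times> cbox a t) (\<lambda>p. (snd p, fst p))"
        by (intro continuous_intros)
      moreover have "(\<lambda>p. (snd p, fst p)) ` ({0..1} \<times> cbox a t) \<subseteq> I \<times> {0..1}"
        using at by auto
      ultimately have cont_ftx: "continuous_on ({0..1} \<times> cbox a t) (\<lambda>(x, s). ftx s x)"
        using continuous_on_compose2[OF ft(3)[unfolded strip_cont_def], of "{0..1} \<times> cbox a t" "\<lambda>p. (snd p, fst p)"]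
        by (simp add: split_beta)
      show "((\<lambda>x. integral (cbox a t) (\<lambda>s. ft s x)) has_real_derivative
          integral (cbox a t) (\<lambda>s. ftx s x0)) (at x0 within {0..1})"
      proof (rule leibniz_rule_field_derivative[OF _ _ cont_ftx x0])
        show "((\<lambda>x. ft s x) has_real_derivative ftx s x) (at x within {0..1})"
          if "x \<in> {0..1}" "s \<in> cbox a t" for x s
          using ft(1) at that unfolding x_deriv_def cbox_interval by blast
        show "(\<lambda>s. ft s x) integrable_on cbox a t" if "x \<in> {0..1}" for x
          using cont[OF that] unfolding cbox_interval by (rule integrable_continuous_real)
      qed simp
    qed
    then have "(f t has_real_derivative fx a x0 + integral {a..t} (\<lambda>s. ftx s x0)) (at x0 within {0..1})"
      unfolding cbox_interval
      by (rule has_field_derivative_transform_within[OF _ zero_less_one x0]) (rule eq[symmetric])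
    moreover have "(f t has_real_derivative fx t x0) (at x0 within {0..1})"
      using f(1) x0 at t unfolding x_deriv_def by auto
    ultimately show ?thesis
      using derivative_unique_unit_interval[OF _ _ x0] by blast
  qed
  have "continuous_on {a..b} (\<lambda>s. ftx s x0)"
    using strip_cont_t[OF ft(3) x0] ab continuous_on_subset by blast
  then have D: "((\<lambda>t. fx a x0 + integral {a..t} (\<lambda>s. ftx s x0)) has_real_derivative ftx t0 x0) (at t0 within {a..b})"
    using ab DERIV_add[OF DERIV_const integral_has_real_derivative] by fastforce
  have "((\<lambda>t. fx t x0) has_real_derivative ftx t0 x0) (at t0 within {a..b})"
    by (rule has_field_derivative_transform_within[OF D zero_less_one _ fx[symmetric]]) (use ab in auto)
  then show "((\<lambda>t. fx t x0) has_real_derivative ftx t0 x0) (at t0)"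
    using at_within_Icc_at[OF ab(2,3)] by simp
qed

subsection \<open>Closure properties of regularity\<close>

lemma regular_x_SucI:
  "regular_x d s F' \<Longrightarrow> (\<And>N. x_deriv (F N) (F' N)) \<Longrightarrow> controlled d F \<Longrightarrow> regular_x d (Suc s) F"
  by auto

lemma regular_SucI:
  "regular d a s F' \<Longrightarrow> (\<And>N. t_deriv (F N) (F' N)) \<Longrightarrow> regular_x d (Suc s) F \<Longrightarrow>
    regular d (Suc a) (Suc s) F"
  by (auto simp del: regular_x.simps)

lemma regular_x_add:
  "regular_x d s F \<Longrightarrow> regular_x d s G \<Longrightarrow> regular_x d s (\<lambda>N t x. F N t x + G N t x)"
proof (induction s arbitrary: F G)
  case 0
  then show ?case by (simp add: controlled_add)
next
  case (Suc s)
  then obtain F' G' where *: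
    "\<And>N. x_deriv (F N) (F' N)" "regular_x d s F'" "\<And>N. x_deriv (G N) (G' N)" "regular_x d s G'"
    by auto
  show ?case
    by (rule regular_x_SucI[OF Suc.IH[OF *(2,4)] x_deriv_add[OF *(1,3)]
          controlled_add[OF Suc.prems[THEN regular_x_controlled]]])
qed

lemma regular_add:
  "regular d a s F \<Longrightarrow> regular d a s G \<Longrightarrow> regular d a s (\<lambda>N t x. F N t x + G N t x)"
proof (induction a arbitrary: s F G)
  case 0
  then show ?case by (simp add: regular_x_add)
next
  case (Suc a)
  obtain F' s' where F': "s = Suc s'" "\<And>N. t_deriv (F N) (F' N)" "regular d a s' F'"
    using Suc.prems(1) by (rule regular_imp_t_deriv) (rule that)
  obtain G' where G': "\<And>N. t_deriv (G N) (G' N)" "regular d a s' G'"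
    using Suc.prems(2) F'(1) by auto
  have "regular_x d s (\<lambda>N t x. F N t x + G N t x)"
    using Suc.prems regular_regular_x regular_x_add by blast
  then show ?case
    unfolding F'(1)
    by (rule regular_SucI[OF Suc.IH[OF F'(3) G'(2)] t_deriv_add[OF F'(2) G'(1)]])
qed

lemma smooth_coeff_x:
  assumes "regular_x False (Suc s) (\<lambda>_. c)"
  obtains c' where "x_deriv c c'" "regular_x False s (\<lambda>_. c')" "strip_cont c"
    "regular_x False s (\<lambda>_. c)"
proof -
  obtain G where G: "\<And>n::nat. x_deriv c (G n)" "regular_x False s G"
    using assms by auto
  have "regular_x False s (\<lambda>_. G 0)"
    by (rule regular_x_cong[OF G(2)]) (rule x_deriv_unique[OF G(1) G(1)])
  then show thesis
    using that G(1) assms regular_x_Suc_mono[OF assms] by (auto simp: controlled_def)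
qed

lemma smooth_coeff_t:
  assumes "smooth_coeff (Suc a) (Suc s) c"
  obtains c' where "t_deriv c c'" "smooth_coeff a s c'"
proof -
  obtain G where G: "\<And>n::nat. t_deriv c (G n)" "regular False a s G"
    using assms by auto
  have "regular False a s (\<lambda>_. G 0)"
    by (rule regular_cong[OF G(2)]) (rule t_deriv_unique[OF G(1) G(1)])
  then show thesis using that G(1) by auto
qed

lemma regular_x_mult:
  "regular_x False s (\<lambda>_. c) \<Longrightarrow> regular_x d s F \<Longrightarrow> regular_x d s (\<lambda>N t x. c t x * F N t x)"
proof (induction s arbitrary: c F)
  case 0
  then show ?case by (auto simp: controlled_mult controlled_def[of False])
next
  case (Suc s)
  obtain c' where c': "x_deriv c c'" "regular_x False s (\<lambda>_. c')" "strip_cont c"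
    "regular_x False s (\<lambda>_. c)"
    using Suc.prems(1) by (rule smooth_coeff_x)
  obtain F' where F': "\<And>N. x_deriv (F N) (F' N)" "regular_x d s F'"
    using Suc.prems(2) by auto
  have "regular_x d s F" using Suc.prems(2) by (rule regular_x_Suc_mono)
  then have "regular_x d s (\<lambda>N t x. c' t x * F N t x + c t x * F' N t x)"
    using Suc.IH c' F' by (intro regular_x_add) auto
  moreover have "x_deriv (\<lambda>t x. c t x * F N t x) (\<lambda>t x. c' t x * F N t x + c t x * F' N t x)" for N
    by (intro x_deriv_mult c' F')
  moreover have "controlled d (\<lambda>N t x. c t x * F N t x)"
    using c'(3) regular_x_controlled[OF Suc.prems(2)] by (rule controlled_mult)
  ultimately show ?case
    by (rule regular_x_SucI)
qed

lemma regular_mult: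
  "smooth_coeff a s c \<Longrightarrow> regular d a s F \<Longrightarrow> regular d a s (\<lambda>N t x. c t x * F N t x)"
proof (induction a arbitrary: s c F)
  case 0
  then show ?case by (simp add: regular_x_mult)
next
  case (Suc a)
  obtain F' s' where F': "s = Suc s'" "\<And>N. t_deriv (F N) (F' N)" "regular d a s' F'"
    using Suc.prems(2) by (rule regular_imp_t_deriv) (rule that)
  obtain c' where c': "t_deriv c c'" "smooth_coeff a s' c'"
    using Suc.prems(1) unfolding F'(1) by (rule smooth_coeff_t)
  have lower: "smooth_coeff a s' c" "regular d a s' F"
    using Suc.prems F'(1) regular_order[OF F'(3)] by (auto intro: regular_Suc_mono dest: regular_mono_t[of _ _ _ _ a] simp del: regular.simps)
  have "regular d a s' (\<lambda>N t x. c' t x * F N t x + c t x * F' N t x)"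
    using Suc.IH c' F' lower by (intro regular_add) auto
  moreover have "t_deriv (\<lambda>t x. c t x * F N t x) (\<lambda>t x. c' t x * F N t x + c t x * F' N t x)" for N
    by (intro t_deriv_mult c' F')
  moreover have "regular_x d s (\<lambda>N t x. c t x * F N t x)"
    using Suc.prems regular_regular_x regular_x_mult by blast
  ultimately show ?case
    unfolding F'(1) by (rule regular_SucI)
qed

lemma regular_const: "a \<le> s \<Longrightarrow> regular False a s (\<lambda>_ _ _. b)"
proof -
  have x: "regular_x False s (\<lambda>_ _ _. b)" for s b
    by (induction s arbitrary: b)
      (auto simp: controlled_def strip_cont_const x_deriv_def intro!: exI[of _ "\<lambda>_ _ _. 0"])
  show "a \<le> s \<Longrightarrow> regular False a s (\<lambda>_ _ _. b)"
  proof (induction a arbitrary: s b)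
    case (Suc a)
    then obtain s' where "s = Suc s'" "a \<le> s'" by (cases s) auto
    then show ?case
      using Suc.IH[of s' 0] x[of s b] by (auto simp: t_deriv_def simp del: regular_x.simps
          intro!: exI[of _ "\<lambda>_ _ _. 0"])
  qed (simp add: x)
qed

lemma regular_zero: "a \<le> s \<Longrightarrow> regular d a s (\<lambda>_ _ _. 0)"
proof -
  have "decaying (\<lambda>_ _ _. 0)"
    by (rule decayingI) (auto intro!: exI[of _ 1] exI[of _ 0] exI[of _ "1/2"])
  then have x: "regular_x d s (\<lambda>_ _ _. 0)" for s
    by (induction s)
      (auto simp: controlled_def strip_cont_const x_deriv_def intro!: exI[of _ "\<lambda>_ _ _. 0"])
  show "a \<le> s \<Longrightarrow> regular d a s (\<lambda>_ _ _. 0)"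
  proof (induction a arbitrary: s)
    case (Suc a)
    then obtain s' where "s = Suc s'" "a \<le> s'" by (cases s) auto
    then show ?case
      using Suc.IH[of s'] x[of s] by (auto simp: t_deriv_def simp del: regular_x.simps
          intro!: exI[of _ "\<lambda>_ _ _. 0"])
  qed (simp add: x)
qed

lemma regular_sum:
  assumes "finite A" "a \<le> s" "\<And>i. i \<in> A \<Longrightarrow> regular d a s (F i)"
  shows "regular d a s (\<lambda>N t x. \<Sum>i\<in>A. F i N t x)"
  using assms(1,3)
  by (induction A rule: finite_induct) (auto simp: regular_zero assms(2) intro: regular_add)

lemma regular_diff:
  assumes "regular d a s F" "regular d a s G"
  shows "regular d a s (\<lambda>N t x. F N t x - G N t x)"
proof -
  have "regular d a s (\<lambda>N t x. F N t x + (-1) * G N t x)"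
    using assms regular_order[OF assms(1)] by (intro regular_add regular_mult regular_const)
  then show ?thesis by simp
qed

lemma regular_t_independent:
  assumes "regular_x False s (\<lambda>_ t x. h x)" "a \<le> s"
  shows "smooth_coeff a s (\<lambda>t x. h x)"
proof (cases a)
  case (Suc a')
  then obtain s' where "s = Suc s'" "a' \<le> s'" using assms(2) by (cases s) auto
  then show ?thesis
    using Suc assms(1) regular_zero[of a' s' False]
    by (auto simp: t_deriv_def simp del: regular_x.simps intro!: exI[of _ "\<lambda>_ _ _. 0"])
qed (use assms in simp)

text \<open>
  An \<open>x\<close> derivative can be taken first: by \<open>t_deriv_x_deriv_commute\<close>, the \<open>t\<close> derivative of
  \<open>\<partial>\<^sub>x F\<close> is the \<open>x\<close> derivative of \<open>\<partial>\<^sub>t F\<close>. The premise \<open>a \<le> s\<close> says that the \<open>t\<close> derivatives leave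
  room for one derivative in \<open>x\<close>.
\<close>
lemma regular_of_x_deriv:
  "regular d a (Suc s) F \<Longrightarrow> a \<le> s \<Longrightarrow> (\<And>N. x_deriv (F N) (F' N)) \<Longrightarrow> regular d a s F'"
proof (induction a arbitrary: s F F')
  case 0
  then show ?case using regular_x_of_x_deriv by simp
next
  case (Suc a)
  then obtain s' where s: "s = Suc s'" "a \<le> s'" by (cases s) auto
  obtain Ft where Ft: "\<And>N. t_deriv (F N) (Ft N)" "regular d a (Suc s') Ft"
    using Suc.prems(1) unfolding s(1) by auto
  obtain Ftx where Ftx: "\<And>N. x_deriv (Ft N) (Ftx N)"
    using Ft(2) by (rule regular_imp_x_deriv) (rule that)
  have Ftx_regular: "regular d a s' Ftx"
    by (rule Suc.IH[OF Ft(2) s(2) Ftx])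
  moreover have "t_deriv (F' N) (Ftx N)" for N
    using t_deriv_x_deriv_commute[OF Suc.prems(3) Ft(1) Ftx]
      regular_x_controlled[OF regular_regular_x[OF Ft(2)]]
      regular_x_controlled[OF regular_regular_x[OF Ftx_regular]]
    by (simp add: controlled_def)
  moreover have "regular_x d s F'"
    using Suc.prems(1,3) regular_regular_x regular_x_of_x_deriv by blast
  ultimately show ?case unfolding s(1) by (rule regular_SucI)
qed

lemma regular_x_comp:
  assumes maps: "\<And>t x. t \<in> I \<Longrightarrow> x \<in> {0..1} \<Longrightarrow> \<tau> t x \<in> {0..1}"
  shows "regular_x False s (\<lambda>_. \<tau>) \<Longrightarrow> regular_x d s F \<Longrightarrow> regular_x d s (\<lambda>N t x. F N t (\<tau> t x))"
proof (induction s arbitrary: F)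
  case 0
  then show ?case by (auto intro: controlled_comp maps simp: controlled_def[of False])
next
  case (Suc s)
  obtain \<tau>' where \<tau>': "x_deriv \<tau> \<tau>'" "regular_x False s (\<lambda>_. \<tau>')" "strip_cont \<tau>"
    "regular_x False s (\<lambda>_. \<tau>)"
    using Suc.prems(1) by (rule smooth_coeff_x)
  obtain F' where F': "\<And>N. x_deriv (F N) (F' N)" "regular_x d s F'" "controlled d F"
    using Suc.prems(2) by auto
  have "regular_x d s (\<lambda>N t x. \<tau>' t x * F' N t (\<tau> t x))"
    using Suc.IH \<tau>' F' by (intro regular_x_mult) auto
  moreover have "x_deriv (\<lambda>t x. F N t (\<tau> t x)) (\<lambda>t x. \<tau>' t x * F' N t (\<tau> t x))" for N
    by (rule x_deriv_comp[OF F'(1) \<tau>'(1) maps])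
  moreover have "controlled d (\<lambda>N t x. F N t (\<tau> t x))"
    by (rule controlled_comp[OF F'(3) \<tau>'(3) maps])
  ultimately show ?case by (rule regular_x_SucI)
qed

text \<open>
  The \<open>t\<close> derivative of the composition contains \<open>\<partial>\<^sub>x F\<close>, so the induction on the number of \<open>t\<close>
  derivatives needs the regularity of \<open>x\<close> derivatives from \<open>regular_of_x_deriv\<close>.
\<close>
lemma regular_comp:
  assumes maps: "\<And>t x. t \<in> I \<Longrightarrow> x \<in> {0..1} \<Longrightarrow> \<tau> t x \<in> {0..1}"
  shows "smooth_coeff a s \<tau> \<Longrightarrow> regular d a s F \<Longrightarrow> regular d a s (\<lambda>N t x. F N t (\<tau> t x))"
proof (induction a arbitrary: s F)
  case 0
  then show ?case using regular_x_comp[OF maps] by simp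
next
  case (Suc a)
  obtain Ft s' where Ft: "s = Suc s'" "\<And>N. t_deriv (F N) (Ft N)" "regular d a s' Ft"
    using Suc.prems(2) by (rule regular_imp_t_deriv) (rule that)
  have as: "a \<le> s'" using Ft(3) by (rule regular_order)
  have F: "regular d a (Suc s') F"
    using Suc.prems(2) Ft(1) regular_mono_t[of d "Suc a" s F a] by simp
  obtain Fx where Fx: "\<And>N. x_deriv (F N) (Fx N)"
    using F by (rule regular_imp_x_deriv) (rule that)
  have Fx_regular: "regular d a s' Fx"
    by (rule regular_of_x_deriv[OF F as Fx])
  obtain \<tau>' where \<tau>': "t_deriv \<tau> \<tau>'" "smooth_coeff a s' \<tau>'"
    using Suc.prems(1) unfolding Ft(1) by (rule smooth_coeff_t)
  have \<tau>: "smooth_coeff a s' \<tau>"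
    using Suc.prems(1) Ft(1) regular_mono_t[of _ "Suc a" s _ a] regular_Suc_mono as by auto
  have "regular d a s' (\<lambda>N t x. Ft N t (\<tau> t x) + \<tau>' t x * Fx N t (\<tau> t x))"
    using Suc.IH[OF \<tau>] \<tau>' Ft Fx_regular by (intro regular_add regular_mult) auto
  moreover have "t_deriv (\<lambda>t x. F N t (\<tau> t x)) (\<lambda>t x. Ft N t (\<tau> t x) + \<tau>' t x * Fx N t (\<tau> t x))" for N
    using regular_x_controlled[OF regular_regular_x[OF Fx_regular]]
    by (intro t_deriv_comp[OF Ft(2) Fx _ \<tau>'(1) maps]) (auto simp: controlled_def)
  moreover have "regular_x d s (\<lambda>N t x. F N t (\<tau> t x))"
    by (rule regular_x_comp[OF maps Suc.prems[THEN regular_regular_x]])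
  ultimately show ?case unfolding Ft(1) by (rule regular_SucI)
qed

end

section \<open>Averaging operators contract derivatives\<close>

definition average :: "nat \<Rightarrow> (nat \<Rightarrow> real \<Rightarrow> real) \<Rightarrow> (nat \<Rightarrow> real \<Rightarrow> real) \<Rightarrow> (real \<Rightarrow> real) \<Rightarrow> real \<Rightarrow> real" where
  "average k g T f x = (\<Sum>i=1..k. g i x * f (T i x))"

definition slope_bound :: "(real \<Rightarrow> real) \<Rightarrow> real \<Rightarrow> bool" where
  "slope_bound f m \<longleftrightarrow>
     (\<exists>f'. \<forall>x\<in>{0..1}. (f has_real_derivative f' x) (at x within {0..1}) \<and> \<bar>f' x\<bar> \<le> m)"

definition range_bound :: "(real \<Rightarrow> real) \<Rightarrow> real \<Rightarrow> bool" where
  "range_bound f v \<longleftrightarrow> (\<exists>b. \<forall>x\<in>{0..1}. b \<le> f x \<and> f x \<le> b + v)"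

lemma slope_bound_nonneg: "slope_bound f m \<Longrightarrow> 0 \<le> m"
  unfolding slope_bound_def by (auto dest!: bspec[of _ _ 0])

lemma range_bound_nonneg: "range_bound f v \<Longrightarrow> 0 \<le> v"
  unfolding range_bound_def by (auto dest!: bspec[of _ _ 0])

lemma slope_bound_mono: "slope_bound f m \<Longrightarrow> m \<le> m' \<Longrightarrow> slope_bound f m'"
  unfolding slope_bound_def by (meson order_trans)

lemma range_bound_mono: "range_bound f v \<Longrightarrow> v \<le> v' \<Longrightarrow> range_bound f v'"
  unfolding range_bound_def by (meson add_left_mono order_trans)

lemma slope_bound_add:
  assumes "slope_bound f m" "slope_bound h m'"
  shows "slope_bound (\<lambda>x. f x + h x) (m + m')"
proof -
  obtain f' h' where
    "\<And>x. x \<in> {0..1} \<Longrightarrow> (f has_real_derivative f' x) (at x within {0..1}) \<and> \<bar>f' x\<bar> \<le> m"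
    "\<And>x. x \<in> {0..1} \<Longrightarrow> (h has_real_derivative h' x) (at x within {0..1}) \<and> \<bar>h' x\<bar> \<le> m'"
    using assms unfolding slope_bound_def by metis
  then have "((\<lambda>x. f x + h x) has_real_derivative f' x + h' x) (at x within {0..1}) \<and> \<bar>f' x + h' x\<bar> \<le> m + m'"
    if "x \<in> {0..1}" for x
    using that by (auto intro!: derivative_intros order_trans[OF abs_triangle_ineq] add_mono)
  then show ?thesis unfolding slope_bound_def by (intro exI[of _ "\<lambda>x. f' x + h' x"]) blast
qed

lemma slope_bound_cong:
  assumes "slope_bound f m" "\<And>x. x \<in> {0..1} \<Longrightarrow> f x = h x"
  shows "slope_bound h m"
proof -
  obtain f' where f': "\<And>x. x \<in> {0..1} \<Longrightarrow> (f has_real_derivative f' x) (at x within {0..1})"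
    "\<And>x. x \<in> {0..1} \<Longrightarrow> \<bar>f' x\<bar> \<le> m"
    using assms unfolding slope_bound_def by metis
  have "(h has_real_derivative f' x) (at x within {0..1})" if "x \<in> {0..1}" for x
    by (rule has_field_derivative_transform_within[OF f'(1)[OF that] zero_less_one that]) (rule assms(2))
  then show ?thesis using f'(2) unfolding slope_bound_def by blast
qed

lemma slope_bound_lipschitz:
  assumes "slope_bound f m" "x \<in> {0..1}" "y \<in> {0..1}"
  shows "\<bar>f x - f y\<bar> \<le> m * \<bar>x - y\<bar>"
proof -
  obtain f' where "\<And>x. x \<in> {0..1} \<Longrightarrow> (f has_real_derivative f' x) (at x within {0..1})"
    "\<And>x. x \<in> {0..1} \<Longrightarrow> \<bar>f' x\<bar> \<le> m"
    using assms unfolding slope_bound_def by metis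
  then show ?thesis
    using field_differentiable_bound[of "{0..1}" f f' m x y] assms(2,3) by auto
qed

lemma slope_bound_range_bound:
  assumes "slope_bound f m"
  shows "range_bound f (2 * m)"
  unfolding range_bound_def
proof (intro exI[of _ "f 0 - m"] ballI)
  fix x :: real assume x: "x \<in> {0..1}"
  have "\<bar>f x - f 0\<bar> \<le> m * \<bar>x - 0\<bar>"
    using slope_bound_lipschitz[OF assms x, of 0] by simp
  also have "\<dots> \<le> m"
    using x slope_bound_nonneg[OF assms] by (auto intro: mult_left_le)
  finally show "f 0 - m \<le> f x \<and> f x \<le> f 0 - m + 2 * m" by (auto simp: abs_le_iff)
qed

text \<open>
  A single system, with explicit constants: the rate of contraction obtained below depends only on
  \<open>\<alpha>\<close>, \<open>\<kappa>\<close>, \<open>\<gamma>\<close> and \<open>G\<close>, which is what makes it locally uniform in a parameter.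
\<close>
locale contracting_average =
  fixes \<alpha> \<kappa> \<gamma> G :: real and k :: nat and g g' T T' :: "nat \<Rightarrow> real \<Rightarrow> real"
  assumes T_maps: "i \<in> {1..k} \<Longrightarrow> x \<in> {0..1} \<Longrightarrow> T i x \<in> {0..1}"
    and T_deriv: "i \<in> {1..k} \<Longrightarrow> x \<in> {0..1} \<Longrightarrow> (T i has_real_derivative T' i x) (at x within {0..1})"
    and g_deriv: "i \<in> {1..k} \<Longrightarrow> x \<in> {0..1} \<Longrightarrow> (g i has_real_derivative g' i x) (at x within {0..1})"
    and T'_bound: "i \<in> {1..k} \<Longrightarrow> x \<in> {0..1} \<Longrightarrow> \<bar>T' i x\<bar> \<le> \<kappa>"
    and average_bound: "x \<in> {0..1} \<Longrightarrow> (\<Sum>i=1..k. g i x * \<bar>T' i x\<bar>) \<le> \<alpha>"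
    and g_lower: "i \<in> {1..k} \<Longrightarrow> x \<in> {0..1} \<Longrightarrow> \<gamma> \<le> g i x"
    and g_sum: "x \<in> {0..1} \<Longrightarrow> (\<Sum>i=1..k. g i x) = 1"
    and g'_bound: "x \<in> {0..1} \<Longrightarrow> (\<Sum>i=1..k. \<bar>g' i x\<bar>) \<le> G"
    and \<alpha>: "0 \<le> \<alpha>" "\<alpha> < 1" and \<kappa>: "0 \<le> \<kappa>" "\<kappa> < 1" and \<gamma>: "0 < \<gamma>" and G: "0 \<le> G"
begin

abbreviation "L \<equiv> average k g T"

lemma g_nonneg: "i \<in> {1..k} \<Longrightarrow> x \<in> {0..1} \<Longrightarrow> 0 \<le> g i x"
  using g_lower \<gamma> by fastforce

lemma one_in: "1 \<in> {1..k}"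
  using g_sum[of 0] by (cases k) auto

lemma g'_sum: "x \<in> {0..1} \<Longrightarrow> (\<Sum>i=1..k. g' i x) = 0"
  using g_deriv g_sum by (intro sum_derivatives_of_weights) auto

lemma average_minus:
  "x \<in> {0..1} \<Longrightarrow> L f x - b = (\<Sum>i=1..k. g i x * (f (T i x) - b))"
  using g_sum[of x]
  by (simp add: average_def right_diff_distrib sum_subtractf flip: sum_distrib_right)

text \<open>
  Every term of the average of \<open>f - b\<close> is nonnegative, and the first one has weight at least \<open>\<gamma>\<close>.
\<close>
lemma average_lower:
  assumes "\<And>x. x \<in> {0..1} \<Longrightarrow> b \<le> f x" "x \<in> {0..1}"
  shows "b + \<gamma> * (f (T 1 x) - b) \<le> L f x"
proof -
  have "\<gamma> * (f (T 1 x) - b) \<le> g 1 x * (f (T 1 x) - b)"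
    using assms g_lower T_maps one_in by (intro mult_right_mono) auto
  also have "\<dots> \<le> (\<Sum>i=1..k. g i x * (f (T i x) - b))"
    using assms g_nonneg T_maps one_in
    by (intro member_le_sum[where f = "\<lambda>i. g i x * (f (T i x) - b)"]) auto
  finally show ?thesis using average_minus[OF assms(2), of f b] by simp
qed

lemma average_upper:
  assumes "\<And>x. x \<in> {0..1} \<Longrightarrow> f x \<le> b" "x \<in> {0..1}"
  shows "L f x \<le> b + \<gamma> * (f (T 1 x) - b)"
proof -
  have "L (\<lambda>x. - f x) x = - L f x"
    by (simp add: average_def sum_negf)
  then show ?thesis
    using average_lower[of "- b" "\<lambda>x. - f x" x] assms by (simp add: algebra_simps)
qed

lemma average_between:
  assumes f: "\<And>x. x \<in> {0..1} \<Longrightarrow> b \<le> f x \<and> f x \<le> b + v" and x: "x \<in> {0..1}"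
  shows "b \<le> L f x \<and> L f x \<le> b + v"
proof -
  have T1: "T 1 x \<in> {0..1}" using T_maps one_in x by auto
  have "0 \<le> \<gamma> * (f (T 1 x) - b)" "\<gamma> * (f (T 1 x) - (b + v)) \<le> 0"
    using f[OF T1] \<gamma> by (auto intro: mult_nonneg_nonpos)
  then show ?thesis
    using average_lower[of b f x] average_upper[of f "b + v" x] f x by fastforce
qed

lemma average_power_between:
  assumes f: "\<And>x. x \<in> {0..1} \<Longrightarrow> b \<le> f x \<and> f x \<le> b + v" and x: "x \<in> {0..1}"
  shows "b \<le> (L ^^ N) f x \<and> (L ^^ N) f x \<le> b + v"
  using x
proof (induction N arbitrary: x)
  case (Suc N)
  then show ?case using average_between[of b "(L ^^ N) f" v x] by simp
qed (use f in simp)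

lemma T1_power_maps: "x \<in> {0..1} \<Longrightarrow> (T 1 ^^ N) x \<in> {0..1}"
  by (induction N) (use T_maps one_in in auto)

lemma T1_power_lipschitz:
  "x \<in> {0..1} \<Longrightarrow> y \<in> {0..1} \<Longrightarrow> \<bar>(T 1 ^^ N) x - (T 1 ^^ N) y\<bar> \<le> \<kappa> ^ N * \<bar>x - y\<bar>"
proof (induction N)
  case (Suc N)
  have "slope_bound (T 1) \<kappa>"
    unfolding slope_bound_def using T_deriv T'_bound one_in by blast
  then have "\<bar>(T 1 ^^ Suc N) x - (T 1 ^^ Suc N) y\<bar> \<le> \<kappa> * \<bar>(T 1 ^^ N) x - (T 1 ^^ N) y\<bar>"
    using slope_bound_lipschitz Suc.prems T1_power_maps by simp
  also have "\<dots> \<le> \<kappa> * (\<kappa> ^ N * \<bar>x - y\<bar>)"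
    using Suc \<kappa> by (intro mult_left_mono) auto
  finally show ?case by (simp add: mult.assoc)
qed simp

text \<open>
  A fraction \<open>\<gamma>\<^sup>N\<close> of the mass follows the orbit of \<open>x\<close> under the first map alone; the rest
  averages values of \<open>f\<close>, which lie between \<open>b\<close> and \<open>b + v\<close>.
\<close>
lemma average_power_coupling:
  assumes f: "\<And>x. x \<in> {0..1} \<Longrightarrow> b \<le> f x \<and> f x \<le> b + v" and x: "x \<in> {0..1}"
  shows "b + \<gamma> ^ N * (f ((T 1 ^^ N) x) - b) \<le> (L ^^ N) f x \<and>
    (L ^^ N) f x \<le> b + v + \<gamma> ^ N * (f ((T 1 ^^ N) x) - (b + v))"
  using x
proof (induction N arbitrary: x)
  case (Suc N)
  let ?u = "(L ^^ N) f"
  have T1: "T 1 x \<in> {0..1}" using T_maps one_in Suc.prems by auto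
  have u: "b \<le> ?u y \<and> ?u y \<le> b + v" if "y \<in> {0..1}" for y
    by (rule average_power_between[OF f that])
  have "\<gamma> * (\<gamma> ^ N * (f ((T 1 ^^ N) (T 1 x)) - b)) \<le> \<gamma> * (?u (T 1 x) - b)"
    using Suc.IH[OF T1] \<gamma> by (intro mult_left_mono) auto
  moreover have "\<gamma> * (?u (T 1 x) - (b + v)) \<le> \<gamma> * (\<gamma> ^ N * (f ((T 1 ^^ N) (T 1 x)) - (b + v)))"
    using Suc.IH[OF T1] \<gamma> by (intro mult_left_mono) auto
  ultimately show ?case
    using average_lower[of b ?u x] average_upper[of ?u "b + v" x] u Suc.prems
    by (simp add: funpow_swap1 mult.assoc)
qed simp

text \<open>
  The fraction \<open>\<gamma>\<^sup>N\<close> of the mass that follows the first map lands in an interval of length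
  \<open>\<kappa>\<^sup>N\<close> common to all starting points, on which \<open>f\<close> is nearly constant; the rest contributes at most the old range.
\<close>
lemma average_power_range:
  assumes "range_bound f v" "slope_bound f m"
  shows "range_bound ((L ^^ N) f) ((1 - \<gamma> ^ N) * v + 2 * \<gamma> ^ N * \<kappa> ^ N * m)"
proof -
  obtain b where b: "\<And>x. x \<in> {0..1} \<Longrightarrow> b \<le> f x \<and> f x \<le> b + v"
    using assms(1) unfolding range_bound_def by blast
  define c where "c = f ((T 1 ^^ N) 0)"
  define q where "q = \<gamma> ^ N"
  have q: "0 \<le> q" using \<gamma> by (simp add: q_def)
  define r where "r = \<kappa> ^ N * m"
  have close: "c - r \<le> f ((T 1 ^^ N) x) \<and> f ((T 1 ^^ N) x) \<le> c + r" if x: "x \<in> {0..1}" for x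
  proof -
    have "\<bar>f ((T 1 ^^ N) x) - c\<bar> \<le> m * \<bar>(T 1 ^^ N) x - (T 1 ^^ N) 0\<bar>"
      unfolding c_def by (intro slope_bound_lipschitz[OF assms(2)] T1_power_maps x) simp
    also have "\<dots> \<le> m * (\<kappa> ^ N * \<bar>x - 0\<bar>)"
      using slope_bound_nonneg[OF assms(2)] T1_power_lipschitz[OF x, of 0]
      by (intro mult_left_mono) auto
    also have "\<dots> \<le> m * (\<kappa> ^ N * 1)"
      using slope_bound_nonneg[OF assms(2)] \<kappa> x by (intro mult_left_mono) auto
    finally show ?thesis by (auto simp: r_def abs_le_iff algebra_simps)
  qed
  show ?thesis
    unfolding range_bound_def
  proof (intro exI[of _ "b + q * (c - r - b)"] ballI conjI)
    fix x :: real assume x: "x \<in> {0..1}"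
    have "q * (c - r - b) \<le> q * (f ((T 1 ^^ N) x) - b)"
      using close[OF x] q by (intro mult_left_mono) auto
    then show "b + q * (c - r - b) \<le> (L ^^ N) f x"
      using average_power_coupling[of b f v x N, OF b x] by (simp add: q_def)
    have "q * (f ((T 1 ^^ N) x) - (b + v)) \<le> q * (c + r - (b + v))"
      using close[OF x] q by (intro mult_left_mono) auto
    then show "(L ^^ N) f x \<le> b + q * (c - r - b) + ((1 - \<gamma> ^ N) * v + 2 * \<gamma> ^ N * \<kappa> ^ N * m)"
      using average_power_coupling[of b f v x N, OF b x] by (simp add: q_def r_def algebra_simps)
  qed
qed

text \<open>
  The weights' derivatives have sum \<open>0\<close>, so they act on \<open>f - b\<close>, which is bounded by the range
  of \<open>f\<close>; the remaining part is damped by the average contraction.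
\<close>
lemma average_slope:
  assumes "range_bound f v" "slope_bound f m"
  shows "slope_bound (L f) (\<alpha> * m + G * v)"
proof -
  obtain b where b: "\<And>x. x \<in> {0..1} \<Longrightarrow> b \<le> f x \<and> f x \<le> b + v"
    using assms(1) unfolding range_bound_def by blast
  obtain f' where f': "\<And>x. x \<in> {0..1} \<Longrightarrow> (f has_real_derivative f' x) (at x within {0..1})"
    "\<And>x. x \<in> {0..1} \<Longrightarrow> \<bar>f' x\<bar> \<le> m"
    using assms(2) unfolding slope_bound_def by metis
  define h where "h x = (\<Sum>i=1..k. g' i x * f (T i x) + g i x * (f' (T i x) * T' i x))" for x
  have "(L f has_real_derivative h x) (at x within {0..1})" if x: "x \<in> {0..1}" for x
    unfolding average_def[abs_def] h_def
  proof (rule DERIV_sum)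
    fix i assume i: "i \<in> {1..k}"
    have "(f has_real_derivative f' (T i x)) (at (T i x) within T i ` {0..1})"
      using f'(1)[OF T_maps[OF i x]] by (rule has_field_derivative_subset) (use T_maps i in auto)
    then have "((\<lambda>x. f (T i x)) has_real_derivative f' (T i x) * T' i x) (at x within {0..1})"
      using DERIV_image_chain[of f _ "T i" x "{0..1}", unfolded o_def] T_deriv[OF i x] by blast
    then show "((\<lambda>x. g i x * f (T i x)) has_real_derivative
        g' i x * f (T i x) + g i x * (f' (T i x) * T' i x)) (at x within {0..1})"
      using g_deriv[OF i x] by (auto intro!: derivative_eq_intros)
  qed
  moreover have "\<bar>h x\<bar> \<le> \<alpha> * m + G * v" if x: "x \<in> {0..1}" for x
  proof -
    have "(\<Sum>i=1..k. g' i x * f (T i x)) = (\<Sum>i=1..k. g' i x * (f (T i x) - b))"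
      using g'_sum[OF x] by (simp add: right_diff_distrib sum_subtractf flip: sum_distrib_right)
    also have "\<bar>\<dots>\<bar> \<le> (\<Sum>i=1..k. \<bar>g' i x\<bar> * v)"
      using b T_maps[OF _ x]
      by (intro order_trans[OF sum_abs] sum_mono) (fastforce simp: abs_mult intro!: mult_left_mono)
    also have "\<dots> \<le> G * v"
      using g'_bound[OF x] range_bound_nonneg[OF assms(1)]
      by (auto simp flip: sum_distrib_right intro: mult_right_mono)
    finally have 1: "\<bar>\<Sum>i=1..k. g' i x * f (T i x)\<bar> \<le> G * v" .
    have "\<bar>\<Sum>i=1..k. g i x * (f' (T i x) * T' i x)\<bar> \<le> (\<Sum>i=1..k. g i x * \<bar>T' i x\<bar> * m)"
    proof (intro order_trans[OF sum_abs] sum_mono)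
      fix i assume i: "i \<in> {1..k}"
      have "\<bar>g i x * (f' (T i x) * T' i x)\<bar> = g i x * \<bar>T' i x\<bar> * \<bar>f' (T i x)\<bar>"
        using g_nonneg[OF i x] by (simp add: abs_mult mult_ac)
      also have "\<dots> \<le> g i x * \<bar>T' i x\<bar> * m"
        using g_nonneg[OF i x] f'(2)[OF T_maps[OF i x]] by (intro mult_left_mono) auto
      finally show "\<bar>g i x * (f' (T i x) * T' i x)\<bar> \<le> g i x * \<bar>T' i x\<bar> * m" .
    qed
    also have "\<dots> \<le> \<alpha> * m"
      using average_bound[OF x] slope_bound_nonneg[OF assms(2)]
      by (auto simp flip: sum_distrib_right intro: mult_right_mono)
    finally show ?thesis using 1 by (simp add: h_def sum.distrib)
  qed
  ultimately show ?thesis unfolding slope_bound_def by blast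
qed

lemma average_power_slope:
  assumes "range_bound f v" "slope_bound f m"
  shows "slope_bound ((L ^^ j) f) (\<alpha> ^ j * m + G / (1 - \<alpha>) * v)"
proof (induction j)
  case 0
  show ?case
    using assms \<alpha> G range_bound_nonneg[OF assms(1)] by (auto intro: slope_bound_mono)
next
  case (Suc j)
  have "range_bound ((L ^^ j) f) v"
    using assms(1) average_power_between unfolding range_bound_def by blast
  from average_slope[OF this Suc]
  have "slope_bound ((L ^^ Suc j) f) (\<alpha> * (\<alpha> ^ j * m + G / (1 - \<alpha>) * v) + G * v)" by simp
  moreover have "\<alpha> * (\<alpha> ^ j * m + G / (1 - \<alpha>) * v) + G * v = \<alpha> ^ Suc j * m + G / (1 - \<alpha>) * v"
    using \<alpha> by (simp add: field_simps)
  ultimately show ?case by simp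
qed

end

text \<open>
  The pair (range, slope) is contracted by a fixed power of the operator when the slope is measured
  in units of \<open>1 / \<delta>\<close>: the range enters the new slope with the factor \<open>\<delta> G / (1 - \<alpha>)\<close>, small by
  the choice of \<open>\<delta>\<close>, and the slope enters the new range only with a factor \<open>\<kappa>\<^sup>N\<close>.
\<close>
lemma average_spectral_gap:
  fixes \<alpha> \<kappa> \<gamma> G :: real
  assumes "0 \<le> \<alpha>" "\<alpha> < 1" "0 \<le> \<kappa>" "\<kappa> < 1" "0 < \<gamma>" "\<gamma> \<le> 1" "0 \<le> G"
  obtains C \<rho> where "0 \<le> C" "0 < \<rho>" "\<rho> < 1"
    "\<And>k g g' T T' f m j. contracting_average \<alpha> \<kappa> \<gamma> G k g g' T T' \<Longrightarrow> slope_bound f m \<Longrightarrow>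
       slope_bound ((average k g T ^^ j) f) (C * \<rho> ^ j * m)"
proof -
  define G' where "G' = G / (1 - \<alpha>)"
  have G': "0 \<le> G'" using assms by (simp add: G'_def)
  define \<delta> where "\<delta> = 1 / (2 * (G' + 1))"
  have \<delta>: "0 < \<delta>" "\<delta> \<le> 1" "\<delta> * G' \<le> 1/2"
    using G' by (auto simp: \<delta>_def field_simps)
  \<comment> \<open>The weight \<open>\<delta>\<close> is chosen before the power \<open>N\<close>, as \<open>G'\<close> bounds all powers at once.\<close>
  have "(\<lambda>N. \<alpha> ^ N) \<longlonglongrightarrow> 0" "(\<lambda>N. \<kappa> ^ N) \<longlonglongrightarrow> 0"
    using assms by (auto intro: LIMSEQ_power_zero)
  then have "\<forall>\<^sub>F N in sequentially. \<alpha> ^ N < 1/4" "\<forall>\<^sub>F N in sequentially. \<kappa> ^ N < \<delta>/4"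
    using \<delta>(1) by (simp_all only: order_tendstoD(2) divide_pos_pos zero_less_numeral zero_less_one)
  then have "\<forall>\<^sub>F N in sequentially. \<alpha> ^ N < 1/4 \<and> \<kappa> ^ N < \<delta>/4 \<and> 1 \<le> N"
    using eventually_ge_at_top[of 1] by eventually_elim auto
  then obtain N where N: "\<alpha> ^ N < 1/4" "\<kappa> ^ N < \<delta>/4" "1 \<le> N"
    by (auto simp: eventually_sequentially)
  define q where "q = \<gamma> ^ N"
  have q: "0 < q" "q \<le> 1" using assms by (auto simp: q_def power_le_one)
  define \<rho>0 where "\<rho>0 = max (1 - q/2) (3/4)"
  have \<rho>0: "0 < \<rho>0" "\<rho>0 < 1" using q by (auto simp: \<rho>0_def)
  define \<rho> where "\<rho> = root N \<rho>0"
  have \<rho>: "0 < \<rho>" "\<rho> < 1" "\<rho> ^ N = \<rho>0"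
    using \<rho>0 N(3) by (auto simp: \<rho>_def real_root_pow_pos real_root_lt_1_iff)
  show thesis
  proof (rule that[of "4 / (\<delta> * \<rho>0)" \<rho>])
    fix k g g' T T' f m j
    assume *: "contracting_average \<alpha> \<kappa> \<gamma> G k g g' T T'" and f: "slope_bound f m"
    interpret contracting_average \<alpha> \<kappa> \<gamma> G k g g' T T' by (rule *)
    have step: "range_bound ((L ^^ N) h) (\<rho>0 * b) \<and> slope_bound ((L ^^ N) h) (\<rho>0 * b / \<delta>)"
      if h: "range_bound h b" "slope_bound h (b / \<delta>)" for h b
    proof
      have b: "0 \<le> b" using h(1) by (rule range_bound_nonneg)
      have "2 * q * \<kappa> ^ N * (b / \<delta>) \<le> 2 * q * (\<delta> / 4) * (b / \<delta>)"
        using N(2) q b \<delta>(1) by (intro mult_right_mono mult_left_mono) auto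
      then have "(1 - q) * b + 2 * q * \<kappa> ^ N * (b / \<delta>) \<le> (1 - q/2) * b"
        using \<delta>(1) by (simp add: field_simps)
      also have "\<dots> \<le> \<rho>0 * b"
        using b by (intro mult_right_mono) (auto simp: \<rho>0_def)
      finally show "range_bound ((L ^^ N) h) (\<rho>0 * b)"
        using average_power_range[OF h, of N] by (auto simp: q_def intro: range_bound_mono)
      have "\<alpha> ^ N * (b / \<delta>) + G' * b = (\<alpha> ^ N + \<delta> * G') * (b / \<delta>)"
        using \<delta>(1) by (simp add: field_simps)
      also have "\<dots> \<le> \<rho>0 * (b / \<delta>)"
        using N(1) \<delta> b by (intro mult_right_mono) (auto simp: \<rho>0_def)
      finally show "slope_bound ((L ^^ N) h) (\<rho>0 * b / \<delta>)"
        using average_power_slope[OF h, of N] by (auto simp: G'_def intro: slope_bound_mono)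
    qed
    have m: "0 \<le> m" using f by (rule slope_bound_nonneg)
    have blocks: "range_bound ((L ^^ (N * d)) f) (\<rho>0 ^ d * (2 * m)) \<and>
        slope_bound ((L ^^ (N * d)) f) (\<rho>0 ^ d * (2 * m) / \<delta>)" for d
    proof (induction d)
      case 0
      have "m * \<delta> \<le> m * 2" using m \<delta> by (intro mult_left_mono) auto
      then have "m \<le> 2 * m / \<delta>" using \<delta>(1) by (simp add: field_simps)
      then show ?case
        using slope_bound_range_bound[OF f] slope_bound_mono[OF f] by simp
    next
      case (Suc d)
      then show ?case
        using step[of "(L ^^ (N * d)) f" "\<rho>0 ^ d * (2 * m)"]
        by (simp add: funpow_add mult.assoc)
    qed
    \<comment> \<open>The exponent is split into blocks of length \<open>N\<close>; the incomplete block costs a factor 2.\<close>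
    define d where "d = j div N"
    define r where "r = j mod N"
    have j: "j = r + N * d" by (simp add: d_def r_def)
    have r: "r \<le> N" using N(3) by (simp add: r_def less_imp_le)
    define M where "M = \<rho>0 ^ d * (2 * m)"
    have M: "0 \<le> M" using m \<rho>0 by (simp add: M_def)
    have "slope_bound ((L ^^ r) ((L ^^ (N * d)) f)) (\<alpha> ^ r * (M / \<delta>) + G' * M)"
      using average_power_slope blocks[of d] unfolding G'_def M_def by blast
    moreover have "\<alpha> ^ r * (M / \<delta>) + G' * M \<le> 2 * (M / \<delta>)"
    proof -
      have "\<alpha> ^ r * (M / \<delta>) \<le> 1 * (M / \<delta>)"
        using M \<delta> assms by (intro mult_right_mono power_le_one) auto
      moreover have "G' * M = (\<delta> * G') * (M / \<delta>)" using \<delta> by simp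
      moreover have "(\<delta> * G') * (M / \<delta>) \<le> 1 * (M / \<delta>)"
        using M \<delta> by (intro mult_right_mono) auto
      ultimately show ?thesis by simp
    qed
    moreover have "2 * (M / \<delta>) \<le> 4 / (\<delta> * \<rho>0) * \<rho> ^ j * m"
    proof -
      have "\<rho>0 \<le> \<rho> ^ r"
        using \<rho> r power_decreasing[OF r, of \<rho>] by simp
      then have "\<rho>0 ^ d * \<rho>0 \<le> \<rho> ^ j"
        using \<rho>0 \<rho>(1) by (simp add: j power_add power_mult \<rho>(3) mult.commute)
      then have "\<rho>0 ^ d \<le> \<rho> ^ j / \<rho>0" using \<rho>0 by (simp add: field_simps)
      then have "4 * m / \<delta> * \<rho>0 ^ d \<le> 4 * m / \<delta> * (\<rho> ^ j / \<rho>0)"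
        using m \<delta> by (intro mult_left_mono) auto
      then show ?thesis by (simp add: M_def mult_ac)
    qed
    ultimately show "slope_bound ((L ^^ j) f) (4 / (\<delta> * \<rho>0) * \<rho> ^ j * m)"
      unfolding j funpow_add by (auto intro: slope_bound_mono)
  qed (use \<rho> \<rho>0 \<delta> in auto)
qed

section \<open>Series of decaying terms\<close>

lemma higher_deriv_cong:
  assumes "open S" "\<And>t. t \<in> S \<Longrightarrow> u t = v t" "t \<in> S"
  shows "(deriv ^^ j) u t = (deriv ^^ j) v t"
  using assms(3)
proof (induction j arbitrary: t)
  case (Suc j)
  have "\<forall>\<^sub>F s in nhds t. (deriv ^^ j) u s = (deriv ^^ j) v s"
    using eventually_nhds_in_open[OF assms(1) Suc.prems] by eventually_elim (rule Suc.IH)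
  then show ?case by (simp add: deriv_cong_ev)
qed (use assms in simp)

lemma C_on_cong:
  assumes "open S" "\<And>t. t \<in> S \<Longrightarrow> u t = v t" "C_on p S u"
  shows "C_on p S v"
  unfolding C_on_def
proof (intro conjI allI impI)
  fix j assume "j < p"
  then have "(deriv ^^ j) u differentiable_on S" using assms(3) by (simp add: C_on_def)
  then show "(deriv ^^ j) v differentiable_on S"
    unfolding differentiable_on_def
  proof (intro ballI)
    fix t assume *: "\<forall>x\<in>S. (deriv ^^ j) u differentiable at x within S" "t \<in> S"
    then have "(deriv ^^ j) u differentiable at t within S" by blast
    then show "(deriv ^^ j) v differentiable at t within S"
      by (rule differentiable_transform_within[OF _ zero_less_one *(2)])
        (rule higher_deriv_cong[OF assms(1,2)])
  qed
next
  have "continuous_on S ((deriv ^^ p) u)" using assms(3) by (simp add: C_on_def)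
  then show "continuous_on S ((deriv ^^ p) v)"
    by (rule continuous_on_eq) (rule higher_deriv_cong[OF assms(1,2)])
qed

lemma C_on_Suc:
  assumes "open S" "\<And>t. t \<in> S \<Longrightarrow> (f has_real_derivative f' t) (at t)" "C_on p S f'"
  shows "C_on (Suc p) S f"
proof -
  have "C_on p S (deriv f)"
    using assms(2) by (intro C_on_cong[OF assms(1) _ assms(3)]) (metis DERIV_imp_deriv)
  moreover have "f differentiable_on S"
    using assms(2) unfolding differentiable_on_def real_differentiable_def
    by (blast intro: has_field_derivative_at_within)
  ultimately show ?thesis
    unfolding C_on_def by (auto simp: less_Suc_eq_0_disj funpow_swap1)
qed

context strip
begin

lemma decaying_series:
  assumes "decaying F" "t0 \<in> I" "x \<in> {0..1}"
  obtains \<delta> where "\<delta> > 0" "ball t0 \<delta> \<subseteq> I" "\<And>t. t \<in> ball t0 \<delta> \<Longrightarrow> summable (\<lambda>N. F N t x)"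
    "uniform_limit (ball t0 \<delta>) (\<lambda>N t. \<Sum>i<N. F i t x) (\<lambda>t. \<Sum>N. F N t x) sequentially"
proof -
  obtain \<delta>1 where \<delta>1: "\<delta>1 > 0" "ball t0 \<delta>1 \<subseteq> I"
    using open_I assms(2) open_contains_ball by blast
  obtain \<delta>2 C \<rho> where 2: "\<delta>2 > 0" "C \<ge> 0" "0 < \<rho>" "\<rho> < 1"
    "\<And>N t x. t \<in> I \<Longrightarrow> x \<in> {0..1} \<Longrightarrow> \<bar>t - t0\<bar> < \<delta>2 \<Longrightarrow> \<bar>F N t x\<bar> \<le> C * \<rho> ^ N"
    using decayingE[OF assms(1,2)] by metis
  define \<delta> where "\<delta> = min \<delta>1 \<delta>2"
  have le: "norm (F N t x) \<le> C * \<rho> ^ N" if "t \<in> ball t0 \<delta>" for N t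
    using 2(5)[of t x N] assms(3) \<delta>1 that by (auto simp: \<delta>_def dist_real_def abs_minus_commute subset_iff)
  have sum: "summable (\<lambda>N. C * \<rho> ^ N)"
    using 2 by (intro summable_mult summable_geometric) auto
  show thesis
  proof (rule that[of \<delta>])
    show "summable (\<lambda>N. F N t x)" if "t \<in> ball t0 \<delta>" for t
      by (rule summable_comparison_test'[OF sum]) (rule le[OF that])
    show "uniform_limit (ball t0 \<delta>) (\<lambda>N t. \<Sum>i<N. F i t x) (\<lambda>t. \<Sum>N. F N t x) sequentially"
      by (rule Weierstrass_m_test[OF le sum])
  qed (use \<delta>1 2 in \<open>auto simp: \<delta>_def\<close>)
qed

text \<open>
  Decay of a sequence and of its \<open>t\<close> derivatives allows differentiation of the series term by term.
\<close>
lemma regular_series_C_on: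
  "regular True a s F \<Longrightarrow> x \<in> {0..1} \<Longrightarrow> C_on a I (\<lambda>t. \<Sum>N. F N t x)"
proof (induction a arbitrary: s F)
  case 0
  then have F: "controlled True F" using regular_x_controlled by simp
  have "isCont (\<lambda>t. \<Sum>N. F N t x) t0" if t0: "t0 \<in> I" for t0
  proof -
    obtain \<delta> where \<delta>: "\<delta> > 0" "ball t0 \<delta> \<subseteq> I"
      "uniform_limit (ball t0 \<delta>) (\<lambda>N t. \<Sum>i<N. F i t x) (\<lambda>t. \<Sum>N. F N t x) sequentially"
      using decaying_series[OF _ t0 \<open>x \<in> {0..1}\<close>] F unfolding controlled_def by metis
    have "continuous_on (ball t0 \<delta>) (\<lambda>t. F i t x)" for i
      using strip_cont_t[of "F i", OF _ \<open>x \<in> {0..1}\<close>] F \<delta>(2) continuous_on_subset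
      unfolding controlled_def by blast
    then have "continuous_on (ball t0 \<delta>) (\<lambda>t. \<Sum>N. F N t x)"
      by (intro uniform_limit_theorem[OF _ \<delta>(3)] always_eventually allI continuous_on_sum) auto
    then show ?thesis using \<delta>(1) by (simp add: continuous_on_eq_continuous_at)
  qed
  then show ?case using open_I by (simp add: C_on_def continuous_on_eq_continuous_at)
next
  case (Suc a)
  obtain F' s' where F': "s = Suc s'" "\<And>N. t_deriv (F N) (F' N)" "regular True a s' F'"
    using Suc.prems(1) by (rule regular_imp_t_deriv) (rule that)
  have F: "decaying F" "decaying F'"
    using Suc.prems(1) F'(3) regular_regular_x regular_x_controlled
    unfolding controlled_def by blast+
  have "((\<lambda>t. \<Sum>N. F N t x) has_real_derivative (\<Sum>N. F' N t0 x)) (at t0)" if t0: "t0 \<in> I" for t0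
  proof -
    obtain \<delta> where \<delta>: "\<delta> > 0" "ball t0 \<delta> \<subseteq> I"
      "uniform_limit (ball t0 \<delta>) (\<lambda>N t. \<Sum>i<N. F' i t x) (\<lambda>t. \<Sum>N. F' N t x) sequentially"
      using decaying_series[OF F(2) t0 \<open>x \<in> {0..1}\<close>] by metis
    have sum: "summable (\<lambda>N. F N t0 x)"
      by (rule decaying_series[OF F(1) t0 \<open>x \<in> {0..1}\<close>]) simp
    have "\<exists>h. \<forall>t\<in>ball t0 \<delta>. (\<lambda>N. F N t x) sums h t \<and>
        (h has_real_derivative (\<Sum>N. F' N t x)) (at t within ball t0 \<delta>)"
    proof (rule has_field_derivative_series[where f = "\<lambda>N t. F N t x" and f' = "\<lambda>N t. F' N t x" and ?x0.0 = t0])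
      show "((\<lambda>t. F N t x) has_real_derivative F' N t x) (at t within ball t0 \<delta>)"
        if "t \<in> ball t0 \<delta>" for N t
        by (rule has_field_derivative_at_within, rule F'(2)[of N, unfolded t_deriv_def, rule_format])
          (use \<delta>(2) that \<open>x \<in> {0..1}\<close> in auto)
      show "convex (ball t0 \<delta>)" "t0 \<in> ball t0 \<delta>" using \<delta>(1) by auto
      show "uniform_limit (ball t0 \<delta>) (\<lambda>N t. \<Sum>i<N. F' i t x) (\<lambda>t. \<Sum>N. F' N t x) sequentially"
        by (rule \<delta>(3))
      show "summable (\<lambda>N. F N t0 x)" by (rule sum)
    qed
    then obtain h where h: "\<And>t. t \<in> ball t0 \<delta> \<Longrightarrow> (\<lambda>N. F N t x) sums h t"
      "(h has_real_derivative (\<Sum>N. F' N t0 x)) (at t0 within ball t0 \<delta>)"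
      using \<delta>(1) by (metis centre_in_ball)
    have "(h has_real_derivative (\<Sum>N. F' N t0 x)) (at t0)"
      using h(2) \<delta>(1) at_within_open[of t0 "ball t0 \<delta>"] by simp
    then show ?thesis
      by (rule has_field_derivative_transform_within_open[of _ _ _ "ball t0 \<delta>"])
        (use \<delta>(1) in simp_all, rule sums_unique[OF h(1)], simp)
  qed
  then show ?case
    using Suc.IH[OF F'(3) Suc.prems(2)] by (intro C_on_Suc[OF open_I])
qed

lemma x_deriv_sum:
  "(\<And>i. i \<in> A \<Longrightarrow> x_deriv (f i) (f' i)) \<Longrightarrow> x_deriv (\<lambda>t x. \<Sum>i\<in>A. f i t x) (\<lambda>t x. \<Sum>i\<in>A. f' i t x)"
  unfolding x_deriv_def by (auto intro!: DERIV_sum)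

lemma t_deriv_sum:
  "(\<And>i. i \<in> A \<Longrightarrow> t_deriv (f i) (f' i)) \<Longrightarrow> t_deriv (\<lambda>t x. \<Sum>i\<in>A. f i t x) (\<lambda>t x. \<Sum>i\<in>A. f' i t x)"
  unfolding t_deriv_def by (auto intro!: DERIV_sum)

lemma decaying_increment:
  assumes "decaying V" "\<And>N. x_deriv (U N) (V N)"
  shows "decaying (\<lambda>N t x. U N t x - U N t 0)"
proof (rule decayingI)
  fix t0 assume t0: "t0 \<in> I"
  obtain \<delta> C \<rho> where *: "\<delta> > 0" "C \<ge> 0" "0 < \<rho>" "\<rho> < 1"
    "\<And>N t x. t \<in> I \<Longrightarrow> x \<in> {0..1} \<Longrightarrow> \<bar>t - t0\<bar> < \<delta> \<Longrightarrow> \<bar>V N t x\<bar> \<le> C * \<rho> ^ N"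
    using decayingE[OF assms(1) t0] by metis
  have "\<bar>U N t x - U N t 0\<bar> \<le> C * \<rho> ^ N"
    if "t \<in> I" "x \<in> {0..1}" "\<bar>t - t0\<bar> < \<delta>" for N t x
  proof -
    have "slope_bound (U N t) (C * \<rho> ^ N)"
      unfolding slope_bound_def using assms(2)[of N] *(5)[OF that(1) _ that(3)] that(1)
      by (intro exI[of _ "V N t"]) (auto simp: x_deriv_def)
    then have "\<bar>U N t x - U N t 0\<bar> \<le> C * \<rho> ^ N * \<bar>x - 0\<bar>"
      by (rule slope_bound_lipschitz) (use that in auto)
    also have "\<dots> \<le> C * \<rho> ^ N * 1"
      using that * by (intro mult_left_mono) auto
    finally show ?thesis by simp
  qed
  then show "\<exists>\<delta>>0. \<exists>C\<ge>0. \<exists>\<rho>. 0 < \<rho> \<and> \<rho> < 1 \<and>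
     (\<forall>N. \<forall>t\<in>I. \<forall>x\<in>{0..1}. \<bar>t - t0\<bar> < \<delta> \<longrightarrow> \<bar>U N t x - U N t 0\<bar> \<le> C * \<rho> ^ N)"
    using * by blast
qed

end

section \<open>Families of iterated function systems\<close>

text \<open>
  The number \<open>n\<close> of derivatives in \<open>t\<close> is one less than the order of smoothness. The two
  contraction hypotheses are pointwise; \<open>strip_cont_max\<close> makes them locally uniform.
\<close>
locale ifs_family = strip I for I :: "real set" +
  fixes k n :: nat and \<tau> \<tau>' :: "nat \<Rightarrow> real \<Rightarrow> real \<Rightarrow> real" and g g' :: "nat \<Rightarrow> real \<Rightarrow> real"
  assumes \<tau>_maps: "i \<in> {1..k} \<Longrightarrow> t \<in> I \<Longrightarrow> x \<in> {0..1} \<Longrightarrow> \<tau> i t x \<in> {0..1}"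
    and \<tau>_regular: "i \<in> {1..k} \<Longrightarrow> smooth_coeff n (Suc n) (\<tau> i)"
    and \<tau>_deriv: "i \<in> {1..k} \<Longrightarrow> x_deriv (\<tau> i) (\<tau>' i)"
    and g_regular: "i \<in> {1..k} \<Longrightarrow> regular_x False (Suc n) (\<lambda>_ _. g i)"
    and g_deriv: "i \<in> {1..k} \<Longrightarrow> x \<in> {0..1} \<Longrightarrow> (g i has_real_derivative g' i x) (at x within {0..1})"
    and g_pos: "i \<in> {1..k} \<Longrightarrow> x \<in> {0..1} \<Longrightarrow> 0 < g i x"
    and g_sum: "x \<in> {0..1} \<Longrightarrow> (\<Sum>i=1..k. g i x) = 1"
    and \<tau>'_less_1: "i \<in> {1..k} \<Longrightarrow> t \<in> I \<Longrightarrow> x \<in> {0..1} \<Longrightarrow> \<bar>\<tau>' i t x\<bar> < 1"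
    and average_less_1: "t \<in> I \<Longrightarrow> x \<in> {0..1} \<Longrightarrow> (\<Sum>i=1..k. g i x * \<bar>\<tau>' i t x\<bar>) < 1"
begin

text \<open>
  Operators of this shape are closed under differentiation: the derivative of \<open>weighted c u\<close> is a
  sum of such operators, with other coefficients, applied to \<open>u\<close> and its derivatives.
\<close>
definition weighted :: "(nat \<Rightarrow> real \<Rightarrow> real \<Rightarrow> real) \<Rightarrow> (real \<Rightarrow> real \<Rightarrow> real) \<Rightarrow> real \<Rightarrow> real \<Rightarrow> real" where
  "weighted c u t x = (\<Sum>i=1..k. c i t x * u t (\<tau> i t x))"

abbreviation "transfer \<equiv> weighted (\<lambda>i _. g i)"

lemma smooth_\<tau>: "i \<in> {1..k} \<Longrightarrow> a \<le> n \<Longrightarrow> a \<le> s \<Longrightarrow> s \<le> Suc n \<Longrightarrow> smooth_coeff a s (\<tau> i)"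
  using \<tau>_regular regular_mono_t regular_mono by blast

lemma smooth_\<tau>': "i \<in> {1..k} \<Longrightarrow> a \<le> s \<Longrightarrow> s \<le> n \<Longrightarrow> smooth_coeff a s (\<tau>' i)"
  using regular_of_x_deriv[OF smooth_\<tau>[of i a "Suc s"]] \<tau>_deriv by simp

lemma x_deriv_g: "i \<in> {1..k} \<Longrightarrow> x_deriv (\<lambda>_. g i) (\<lambda>_. g' i)"
  using g_deriv by (simp add: x_deriv_def)

lemma smooth_g: "i \<in> {1..k} \<Longrightarrow> a \<le> s \<Longrightarrow> s \<le> Suc n \<Longrightarrow> smooth_coeff a s (\<lambda>_. g i)"
  using regular_t_independent[OF regular_mono[of False 0 "Suc n" _ s, simplified]] g_regular by simp

lemma smooth_g': "i \<in> {1..k} \<Longrightarrow> a \<le> s \<Longrightarrow> s \<le> n \<Longrightarrow> smooth_coeff a s (\<lambda>_. g' i)"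
  using regular_of_x_deriv[OF smooth_g[of i a "Suc s"]] x_deriv_g by simp

lemma regular_weighted:
  assumes "regular d a s F" "\<And>i. i \<in> {1..k} \<Longrightarrow> smooth_coeff a s (c i)" "a \<le> n" "s \<le> Suc n"
  shows "regular d a s (\<lambda>N. weighted c (F N))"
  unfolding weighted_def[abs_def]
proof (rule regular_sum)
  show "a \<le> s" using assms(1) by (rule regular_order)
  fix i assume i: "i \<in> {1..k}"
  show "regular d a s (\<lambda>N t x. c i t x * F N t (\<tau> i t x))"
    by (rule regular_mult[OF assms(2)[OF i]
          regular_comp[OF \<tau>_maps[OF i] smooth_\<tau>[OF i assms(3) \<open>a \<le> s\<close> assms(4)] assms(1)]])
qed simp

lemma x_deriv_weighted:
  assumes "x_deriv u u'" "\<And>i. i \<in> {1..k} \<Longrightarrow> x_deriv (c i) (c' i)"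
  shows "x_deriv (weighted c u)
    (\<lambda>t x. weighted c' u t x + weighted (\<lambda>i t x. c i t x * \<tau>' i t x) u' t x)"
proof -
  have "x_deriv (\<lambda>t x. \<Sum>i=1..k. c i t x * u t (\<tau> i t x))
    (\<lambda>t x. \<Sum>i=1..k. c' i t x * u t (\<tau> i t x) + c i t x * (\<tau>' i t x * u' t (\<tau> i t x)))"
  proof (rule x_deriv_sum)
    fix i assume i: "i \<in> {1..k}"
    show "x_deriv (\<lambda>t x. c i t x * u t (\<tau> i t x))
        (\<lambda>t x. c' i t x * u t (\<tau> i t x) + c i t x * (\<tau>' i t x * u' t (\<tau> i t x)))"
      by (rule x_deriv_mult[OF assms(2)[OF i] x_deriv_comp[OF assms(1) \<tau>_deriv[OF i] \<tau>_maps[OF i]]])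
  qed
  then show ?thesis by (simp add: weighted_def[abs_def] sum.distrib mult.assoc)
qed

lemma g'_sum: "x \<in> {0..1} \<Longrightarrow> (\<Sum>i=1..k. g' i x) = 0"
  using g_deriv g_sum by (intro sum_derivatives_of_weights) auto

text \<open>
  If the coefficients have total mass below one, the supremum of \<open>V\<close> obeys a scalar contracting
  recursion with exponentially small forcing.
\<close>
lemma contraction_decaying:
  assumes rec: "\<And>N t x. t \<in> I \<Longrightarrow> x \<in> {0..1} \<Longrightarrow> V (Suc N) t x = weighted c (V N) t x + S N t x"
    and c: "\<And>i. i \<in> {1..k} \<Longrightarrow> strip_cont (c i)"
      "\<And>t x. t \<in> I \<Longrightarrow> x \<in> {0..1} \<Longrightarrow> (\<Sum>i=1..k. \<bar>c i t x\<bar>) < 1"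
    and V: "strip_cont (V 0)" and S: "decaying S"
  shows "decaying V"
proof (rule decayingI)
  fix t0 assume t0: "t0 \<in> I"
  obtain \<delta>1 C \<rho> where 1: "\<delta>1 > 0" "C \<ge> 0" "0 < \<rho>" "\<rho> < 1"
    "\<And>N t x. t \<in> I \<Longrightarrow> x \<in> {0..1} \<Longrightarrow> \<bar>t - t0\<bar> < \<delta>1 \<Longrightarrow> \<bar>S N t x\<bar> \<le> C * \<rho> ^ N"
    using decayingE[OF S t0] by metis
  have "strip_cont (\<lambda>t x. \<Sum>i=1..k. \<bar>c i t x\<bar>)"
    by (intro strip_cont_sum strip_cont_abs c(1))
  then obtain \<delta>2 t2 x2 where 2: "\<delta>2 > 0" "t2 \<in> I" "x2 \<in> {0..1}"
    "\<And>t x. x \<in> {0..1} \<Longrightarrow> \<bar>t - t0\<bar> < \<delta>2 \<Longrightarrow> (\<Sum>i=1..k. \<bar>c i t x\<bar>) \<le> (\<Sum>i=1..k. \<bar>c i t2 x2\<bar>)"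
    by (rule strip_cont_max[OF _ t0]) (rule that)
  obtain \<delta>3 t3 x3 where 3: "\<delta>3 > 0" "t3 \<in> I" "x3 \<in> {0..1}"
    "\<And>t x. x \<in> {0..1} \<Longrightarrow> \<bar>t - t0\<bar> < \<delta>3 \<Longrightarrow> \<bar>V 0 t x\<bar> \<le> \<bar>V 0 t3 x3\<bar>"
    by (rule strip_cont_max[OF strip_cont_abs[OF V] t0]) (rule that)
  define \<alpha> where "\<alpha> = (\<Sum>i=1..k. \<bar>c i t2 x2\<bar>)"
  have \<alpha>: "0 \<le> \<alpha>" "\<alpha> < 1" using c(2)[OF 2(2,3)] by (auto simp: \<alpha>_def sum_nonneg)
  \<comment> \<open>A rate strictly above \<open>\<alpha>\<close> leaves the room \<open>D (\<sigma> - \<alpha>)\<close> to absorb the forcing.\<close>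
  define \<sigma> where "\<sigma> = (1 + max \<alpha> \<rho>) / 2"
  have \<sigma>: "\<alpha> < \<sigma>" "\<rho> \<le> \<sigma>" "0 < \<sigma>" "\<sigma> < 1"
    using \<alpha> 1(3,4) unfolding \<sigma>_def by auto
  define D where "D = \<bar>V 0 t3 x3\<bar> + C / (\<sigma> - \<alpha>)"
  have D: "\<bar>V 0 t3 x3\<bar> \<le> D" "0 \<le> D" "C \<le> D * (\<sigma> - \<alpha>)"
  proof -
    have "0 \<le> C / (\<sigma> - \<alpha>)" "0 \<le> \<bar>V 0 t3 x3\<bar> * (\<sigma> - \<alpha>)" using 1 \<sigma> by auto
    moreover have "D * (\<sigma> - \<alpha>) = \<bar>V 0 t3 x3\<bar> * (\<sigma> - \<alpha>) + C"
      using \<sigma> by (simp add: D_def distrib_right)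
    ultimately show "\<bar>V 0 t3 x3\<bar> \<le> D" "0 \<le> D" "C \<le> D * (\<sigma> - \<alpha>)"
      by (auto simp: D_def)
  qed
  have "\<bar>V N t x\<bar> \<le> D * \<sigma> ^ N"
    if "t \<in> I" "x \<in> {0..1}" "\<bar>t - t0\<bar> < min \<delta>1 (min \<delta>2 \<delta>3)" for N t x
    using that
  proof (induction N arbitrary: x)
    case 0
    then show ?case using 3(4)[of x t] D by simp
  next
    case (Suc N)
    have "\<bar>weighted c (V N) t x\<bar> \<le> (\<Sum>i=1..k. \<bar>c i t x\<bar> * (D * \<sigma> ^ N))"
      unfolding weighted_def
    proof (intro order_trans[OF sum_abs] sum_mono)
      fix i assume i: "i \<in> {1..k}"
      show "\<bar>c i t x * V N t (\<tau> i t x)\<bar> \<le> \<bar>c i t x\<bar> * (D * \<sigma> ^ N)"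
        using Suc.IH[OF _ \<tau>_maps[OF i]] Suc.prems by (auto simp: abs_mult intro!: mult_left_mono)
    qed
    also have "\<dots> \<le> \<alpha> * (D * \<sigma> ^ N)"
      unfolding sum_distrib_right[symmetric]
      using 2(4)[of x t] Suc.prems D \<sigma> by (intro mult_right_mono) (auto simp: \<alpha>_def)
    finally have "\<bar>V (Suc N) t x\<bar> \<le> \<alpha> * (D * \<sigma> ^ N) + C * \<rho> ^ N"
      using rec[OF Suc.prems(1,2), of N] 1(5)[OF Suc.prems(1,2), of N] Suc.prems(3) by simp
    also have "C * \<rho> ^ N \<le> D * (\<sigma> - \<alpha>) * \<sigma> ^ N"
      using 1 D \<sigma> by (intro mult_mono power_mono) auto
    finally show ?case by (simp add: algebra_simps)
  qed
  then show "\<exists>\<delta>>0. \<exists>C\<ge>0. \<exists>\<rho>. 0 < \<rho> \<and> \<rho> < 1 \<and>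
     (\<forall>N. \<forall>t\<in>I. \<forall>x\<in>{0..1}. \<bar>t - t0\<bar> < \<delta> \<longrightarrow> \<bar>V N t x\<bar> \<le> C * \<rho> ^ N)"
    using 1(1) 2(1) 3(1) D \<sigma>
    by (intro exI[of _ "min \<delta>1 (min \<delta>2 \<delta>3)"] exI[of _ D] exI[of _ \<sigma>] conjI) auto
qed

text \<open>
  Each \<open>x\<close> derivative multiplies the leading coefficients by \<open>\<tau>'\<close>, which only improves the
  contraction; all other terms involve lower derivatives and join the forcing.
\<close>
lemma contraction_regular:
  assumes "s \<le> n"
    and "\<And>N t x. t \<in> I \<Longrightarrow> x \<in> {0..1} \<Longrightarrow> V (Suc N) t x = weighted c (V N) t x + S N t x"
    and "\<And>i. i \<in> {1..k} \<Longrightarrow> smooth_coeff 0 s (c i)"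
    and "\<And>t x. t \<in> I \<Longrightarrow> x \<in> {0..1} \<Longrightarrow> (\<Sum>i=1..k. \<bar>c i t x\<bar>) < 1"
    and "regular False 0 s V" "regular True 0 s S"
  shows "regular True 0 s V"
  using assms
proof (induction s arbitrary: V c S)
  case 0
  have "decaying V"
    by (rule contraction_decaying[where V = V and c = c and S = S]) (use "0.prems" in \<open>auto simp: controlled_def\<close>)
  then show ?case using "0.prems" by (simp add: controlled_def)
next
  case (Suc s)
  have low: "regular True 0 s V"
    using Suc.prems by (intro Suc.IH[of V c S]) (auto intro: regular_Suc_mono simp del: regular.simps)
  obtain V' where V': "\<And>N. x_deriv (V N) (V' N)" "regular False 0 s V'"
    using Suc.prems(5) by auto
  obtain S' where S': "\<And>N. x_deriv (S N) (S' N)" "regular True 0 s S'"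
    using Suc.prems(6) by auto
  have "\<exists>c'. x_deriv (c i) c' \<and> smooth_coeff 0 s c'" if "i \<in> {1..k}" for i
    using smooth_coeff_x[of s "c i"] Suc.prems(3)[OF that] by auto
  then obtain c' where c': "\<And>i. i \<in> {1..k} \<Longrightarrow> x_deriv (c i) (c' i)"
    "\<And>i. i \<in> {1..k} \<Longrightarrow> smooth_coeff 0 s (c' i)"
    by metis
  have "regular True 0 s V'"
  proof (rule Suc.IH)
    show "V' (Suc N) t x = weighted (\<lambda>i t x. c i t x * \<tau>' i t x) (V' N) t x +
        (weighted c' (V N) t x + S' N t x)" if tx: "t \<in> I" "x \<in> {0..1}" for N t x
    proof -
      have "x_deriv (V (Suc N)) (\<lambda>t x. weighted c' (V N) t x
          + weighted (\<lambda>i t x. c i t x * \<tau>' i t x) (V' N) t x + S' N t x)"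
        by (rule x_deriv_cong[OF _ x_deriv_add[OF x_deriv_weighted[OF V'(1) c'(1)] S'(1)]])
          (simp_all add: Suc.prems(2))
      from x_deriv_unique[OF V'(1) this tx] show ?thesis by simp
    qed
    show "smooth_coeff 0 s (\<lambda>t x. c i t x * \<tau>' i t x)" if "i \<in> {1..k}" for i
      using Suc.prems(1)
      by (intro regular_mult[OF regular_Suc_mono[OF Suc.prems(3)[OF that]]] smooth_\<tau>'[OF that]) auto
    show "(\<Sum>i=1..k. \<bar>c i t x * \<tau>' i t x\<bar>) < 1" if "t \<in> I" "x \<in> {0..1}" for t x
    proof -
      have "(\<Sum>i=1..k. \<bar>c i t x * \<tau>' i t x\<bar>) \<le> (\<Sum>i=1..k. \<bar>c i t x\<bar>)"
        using \<tau>'_less_1[OF _ that]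
        by (intro sum_mono) (simp add: abs_mult mult_left_le order_less_imp_le)
      then show ?thesis using Suc.prems(4)[OF that] by simp
    qed
    show "regular True 0 s (\<lambda>N t x. weighted c' (V N) t x + S' N t x)"
      using Suc.prems(1) by (intro regular_add regular_weighted low c' S') auto
  qed (use Suc.prems(1) V' in auto)
  moreover have "controlled True V"
    using low regular_x_controlled by simp
  ultimately show ?case using V'(1) by auto
qed

text \<open>
  The undifferentiated recursion has total weight one and does not contract \<open>U\<close> itself. By linearity
  \<open>U\<close> is the sum of the forcings transported by powers of the operator, and the spectral gap
  contracts the derivative of each of them.
\<close>
lemma gap_decaying:
  assumes rec: "\<And>N t x. t \<in> I \<Longrightarrow> x \<in> {0..1} \<Longrightarrow> U (Suc N) t x = transfer (U N) t x + R N t x"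
    and V: "\<And>N. x_deriv (U N) (V N)" "strip_cont (V 0)"
    and R': "\<And>N. x_deriv (R N) (R' N)" "decaying R'"
  shows "decaying V"
proof (rule decayingI)
  fix t0 assume t0: "t0 \<in> I"
  obtain \<delta>1 Cr \<rho>r where 1: "\<delta>1 > 0" "Cr \<ge> 0" "0 < \<rho>r" "\<rho>r < 1"
    "\<And>N t x. t \<in> I \<Longrightarrow> x \<in> {0..1} \<Longrightarrow> \<bar>t - t0\<bar> < \<delta>1 \<Longrightarrow> \<bar>R' N t x\<bar> \<le> Cr * \<rho>r ^ N"
    using decayingE[OF R'(2) t0] by metis
  have cont: "strip_cont (\<tau>' i)" "strip_cont (\<lambda>_. g i)" "strip_cont (\<lambda>_. g' i)" if "i \<in> {1..k}" for i
    using smooth_\<tau>'[OF that, of 0 0] smooth_g[OF that, of 0 0] smooth_g'[OF that, of 0 0]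
    by (auto simp: controlled_def)
  have "strip_cont (\<lambda>t x. \<Sum>i=1..k. g i x * \<bar>\<tau>' i t x\<bar>)"
    by (intro strip_cont_sum strip_cont_mult strip_cont_abs cont)
  then obtain \<delta>2 t2 x2 where 2: "\<delta>2 > 0" "t2 \<in> I" "x2 \<in> {0..1}"
    "\<And>t x. x \<in> {0..1} \<Longrightarrow> \<bar>t - t0\<bar> < \<delta>2 \<Longrightarrow>
      (\<Sum>i=1..k. g i x * \<bar>\<tau>' i t x\<bar>) \<le> (\<Sum>i=1..k. g i x2 * \<bar>\<tau>' i t2 x2\<bar>)"
    by (rule strip_cont_max[OF _ t0]) (rule that)
  obtain \<delta>3 t3 x3 where 3: "\<delta>3 > 0" "t3 \<in> I" "x3 \<in> {0..1}"
    "\<And>t x. x \<in> {0..1} \<Longrightarrow> \<bar>t - t0\<bar> < \<delta>3 \<Longrightarrow> \<bar>V 0 t x\<bar> \<le> \<bar>V 0 t3 x3\<bar>"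
    by (rule strip_cont_max[OF strip_cont_abs[OF V(2)] t0]) (rule that)
  have "\<exists>\<delta> \<kappa>. \<delta> > 0 \<and> 0 \<le> \<kappa> \<and> \<kappa> < 1 \<and> (\<forall>t x. x \<in> {0..1} \<longrightarrow> \<bar>t - t0\<bar> < \<delta> \<longrightarrow> \<bar>\<tau>' i t x\<bar> \<le> \<kappa>)"
    if i: "i \<in> {1..k}" for i
  proof -
    obtain \<delta> t1 x1 where "\<delta> > 0" "t1 \<in> I" "x1 \<in> {0..1}"
      "\<And>t x. x \<in> {0..1} \<Longrightarrow> \<bar>t - t0\<bar> < \<delta> \<Longrightarrow> \<bar>\<tau>' i t x\<bar> \<le> \<bar>\<tau>' i t1 x1\<bar>"
      by (rule strip_cont_max[OF strip_cont_abs[OF cont(1)[OF i]] t0]) (rule that)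
    then show ?thesis using \<tau>'_less_1[OF i] by (intro exI[of _ \<delta>] exI[of _ "\<bar>\<tau>' i t1 x1\<bar>"]) auto
  qed
  then obtain \<delta>4 \<kappa>4 where 4: "\<And>i. i \<in> {1..k} \<Longrightarrow> \<delta>4 i > 0" "\<And>i. i \<in> {1..k} \<Longrightarrow> 0 \<le> \<kappa>4 i"
    "\<And>i. i \<in> {1..k} \<Longrightarrow> \<kappa>4 i < 1"
    "\<And>i t x. i \<in> {1..k} \<Longrightarrow> x \<in> {0..1} \<Longrightarrow> \<bar>t - t0\<bar> < \<delta>4 i \<Longrightarrow> \<bar>\<tau>' i t x\<bar> \<le> \<kappa>4 i"
    by metis
  have k: "{1..k} \<noteq> {}" using g_sum[of 0] by (cases k) auto
  define \<kappa> where "\<kappa> = Max (\<kappa>4 ` {1..k})"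
  have \<kappa>_ge: "\<kappa>4 i \<le> \<kappa>" if "i \<in> {1..k}" for i
    using that by (auto simp: \<kappa>_def intro!: Max_ge)
  have one: "1 \<in> {1..k}" using k by auto
  have \<kappa>: "0 \<le> \<kappa>" "\<kappa> < 1"
    using order_trans[OF 4(2)[OF one] \<kappa>_ge[OF one]] k 4(3) by (auto simp: \<kappa>_def)
  define \<delta>5 where "\<delta>5 = Min (\<delta>4 ` {1..k})"
  have \<delta>5: "\<delta>5 > 0" using k 4(1) by (auto simp: \<delta>5_def)
  have \<delta>5_le: "\<delta>5 \<le> \<delta>4 i" if "i \<in> {1..k}" for i
    using that by (auto simp: \<delta>5_def intro!: Min_le)
  have "\<exists>\<gamma>>0. \<forall>x\<in>{0..1}. \<gamma> \<le> g i x" if i: "i \<in> {1..k}" for i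
  proof -
    have "continuous_on {0..1} (g i)" using strip_cont_x[OF cont(2)[OF i] t0] .
    then obtain x1 where "x1 \<in> {0..1}" "\<forall>x\<in>{0..1}. g i x1 \<le> g i x"
      using continuous_attains_inf[of "{0..1::real}" "g i"] by auto
    then show ?thesis using g_pos[OF i] by blast
  qed
  then obtain \<gamma>6 where 6: "\<And>i. i \<in> {1..k} \<Longrightarrow> \<gamma>6 i > 0"
    "\<And>i x. i \<in> {1..k} \<Longrightarrow> x \<in> {0..1} \<Longrightarrow> \<gamma>6 i \<le> g i x"
    by metis
  define \<gamma> where "\<gamma> = Min (insert 1 (\<gamma>6 ` {1..k}))"
  have \<gamma>: "0 < \<gamma>" "\<gamma> \<le> 1" using 6(1) by (auto simp: \<gamma>_def)
  have \<gamma>_le: "\<gamma> \<le> g i x" if "i \<in> {1..k}" "x \<in> {0..1}" for i x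
  proof -
    have "\<gamma> \<le> \<gamma>6 i" unfolding \<gamma>_def using that(1) by (intro Min_le) auto
    then show ?thesis using 6(2)[OF that] by simp
  qed
  have "strip_cont (\<lambda>t x. \<Sum>i=1..k. \<bar>g' i x\<bar>)"
    by (intro strip_cont_sum strip_cont_abs[of "\<lambda>_. g' _"] cont)
  then obtain \<delta>7 t7 x7 where 7: "\<delta>7 > 0" "t7 \<in> I" "x7 \<in> {0..1}"
    "\<And>t x. x \<in> {0..1} \<Longrightarrow> \<bar>t - t0\<bar> < \<delta>7 \<Longrightarrow> (\<Sum>i=1..k. \<bar>g' i x\<bar>) \<le> (\<Sum>i=1..k. \<bar>g' i x7\<bar>)"
    by (rule strip_cont_max[OF _ t0]) (rule that)
  define G where "G = (\<Sum>i=1..k. \<bar>g' i x7\<bar>)"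
  have g'_le: "(\<Sum>i=1..k. \<bar>g' i x\<bar>) \<le> G" if "x \<in> {0..1}" for x
    using 7(4)[OF that, of t0] 7(1) by (simp add: G_def)
  have G: "0 \<le> G" by (simp add: G_def sum_nonneg)
  define \<alpha> where "\<alpha> = (\<Sum>i=1..k. g i x2 * \<bar>\<tau>' i t2 x2\<bar>)"
  have \<alpha>: "0 \<le> \<alpha>" "\<alpha> < 1"
  proof -
    show "0 \<le> \<alpha>"
      unfolding \<alpha>_def
      by (intro sum_nonneg mult_nonneg_nonneg order_less_imp_le[OF g_pos] 2(3)) auto
  qed (use average_less_1[OF 2(2,3)] in \<open>simp add: \<alpha>_def\<close>)
  obtain C \<rho> where gap: "0 \<le> C" "0 < \<rho>" "\<rho> < 1"
    "\<And>k g g' T T' f m j. contracting_average \<alpha> \<kappa> \<gamma> G k g g' T T' \<Longrightarrow> slope_bound f m \<Longrightarrow>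
       slope_bound ((average k g T ^^ j) f) (C * \<rho> ^ j * m)"
    using average_spectral_gap[OF \<alpha> \<kappa> \<gamma> G] by metis
  define \<delta> where "\<delta> = min (min \<delta>1 \<delta>2) (min \<delta>3 \<delta>5)"
  \<comment> \<open>A rate strictly above that of the gap absorbs the sum over all transported forcings.\<close>
  define \<sigma> where "\<sigma> = (1 + max \<rho> \<rho>r) / 2"
  have \<sigma>: "\<rho> < \<sigma>" "\<rho>r \<le> \<sigma>" "0 < \<sigma>" "\<sigma> < 1"
    using gap(2,3) 1(3,4) unfolding \<sigma>_def by auto
  define B where "B = \<bar>V 0 t3 x3\<bar>"
  define K where "K = C * B + C * Cr / (\<sigma> - \<rho>)"
  have K: "C * B \<le> K" "0 \<le> K" "C * Cr \<le> K * (\<sigma> - \<rho>)"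
  proof -
    have "0 \<le> C * Cr / (\<sigma> - \<rho>)" "0 \<le> C * B" "0 \<le> C * B * (\<sigma> - \<rho>)"
      using 1 \<sigma> gap by (auto simp: B_def)
    moreover have "K * (\<sigma> - \<rho>) = C * B * (\<sigma> - \<rho>) + C * Cr"
      using \<sigma> by (simp add: K_def distrib_right)
    ultimately show "C * B \<le> K" "0 \<le> K" "C * Cr \<le> K * (\<sigma> - \<rho>)"
      by (auto simp: K_def)
  qed
  have "\<bar>V N t x\<bar> \<le> K * \<sigma> ^ N" if tx: "t \<in> I" "x \<in> {0..1}" "\<bar>t - t0\<bar> < \<delta>" for N t x
  proof -
    let ?T = "\<lambda>i. \<tau> i t"
    let ?L = "average k g ?T"
    have ca: "contracting_average \<alpha> \<kappa> \<gamma> G k g g' ?T (\<lambda>i. \<tau>' i t)"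
    proof
      show "\<bar>\<tau>' i t x\<bar> \<le> \<kappa>" if "i \<in> {1..k}" "x \<in> {0..1}" for i x
        using 4(4)[OF that, of t] tx(3) \<delta>5_le[OF that(1)] \<kappa>_ge[OF that(1)] by (simp add: \<delta>_def)
      show "(\<Sum>i=1..k. g i x * \<bar>\<tau>' i t x\<bar>) \<le> \<alpha>" if "x \<in> {0..1}" for x
        using 2(4)[OF that, of t] tx(3) by (simp add: \<alpha>_def \<delta>_def)
      show "(\<tau> i t has_real_derivative \<tau>' i t x) (at x within {0..1})"
        if "i \<in> {1..k}" "x \<in> {0..1}" for i x
        using \<tau>_deriv[OF that(1)] that(2) tx(1) by (simp add: x_deriv_def)
    qed (use \<tau>_maps tx g_deriv \<gamma>_le g_sum g'_le \<alpha> \<kappa> \<gamma> G in auto)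
    have R: "slope_bound (R N t) (Cr * \<rho>r ^ N)" for N
      unfolding slope_bound_def using R'(1)[of N] 1(5)[OF tx(1)] tx
      by (intro exI[of _ "R' N t"]) (auto simp: x_deriv_def \<delta>_def)
    have cong: "(?L ^^ j) f x = (?L ^^ j) h x"
      if "\<And>x. x \<in> {0..1} \<Longrightarrow> f x = h x" "x \<in> {0..1}" for f h j x
      using that(2)
      by (induction j arbitrary: x) (use that(1) \<tau>_maps tx(1) in \<open>auto simp: average_def intro!: sum.cong\<close>)
    have add: "(?L ^^ j) (\<lambda>x. f x + h x) x = (?L ^^ j) f x + (?L ^^ j) h x" for f h j x
      by (induction j arbitrary: x) (auto simp: average_def algebra_simps sum.distrib)
    \<comment> \<open>Carrying along all further powers \<open>j\<close> replaces the explicit sum over the past forcings.\<close>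
    have "slope_bound ((?L ^^ j) (U N t)) (K * \<rho> ^ j * \<sigma> ^ N)" for j
    proof (induction N arbitrary: j)
      case 0
      have "slope_bound (U 0 t) B"
        unfolding slope_bound_def using V(1)[of 0] 3(4) tx
        by (intro exI[of _ "V 0 t"]) (auto simp: x_deriv_def \<delta>_def B_def)
      from gap(4)[OF ca this, of j] show ?case
        by (rule slope_bound_mono)
          (use K(1) gap(2) in \<open>auto simp: mult_ac intro!: mult_left_mono\<close>)
    next
      case (Suc N)
      have "slope_bound (\<lambda>x. (?L ^^ Suc j) (U N t) x + (?L ^^ j) (R N t) x)
          (K * \<rho> ^ Suc j * \<sigma> ^ N + C * \<rho> ^ j * (Cr * \<rho>r ^ N))"
        by (intro slope_bound_add Suc.IH gap(4)[OF ca R])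
      then have "slope_bound ((?L ^^ j) (U (Suc N) t))
          (K * \<rho> ^ Suc j * \<sigma> ^ N + C * \<rho> ^ j * (Cr * \<rho>r ^ N))"
      proof (rule slope_bound_cong)
        fix x :: real assume x: "x \<in> {0..1}"
        have "(?L ^^ j) (U (Suc N) t) x = (?L ^^ j) (\<lambda>x. ?L (U N t) x + R N t x) x"
          by (rule cong[OF _ x]) (use rec tx(1) in \<open>auto simp: weighted_def average_def\<close>)
        then show "(?L ^^ Suc j) (U N t) x + (?L ^^ j) (R N t) x = (?L ^^ j) (U (Suc N) t) x"
          by (simp add: add funpow_swap1)
      qed
      moreover have "K * \<rho> ^ Suc j * \<sigma> ^ N + C * \<rho> ^ j * (Cr * \<rho>r ^ N) \<le> K * \<rho> ^ j * \<sigma> ^ Suc N"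
      proof -
        have "(C * Cr) * \<rho>r ^ N \<le> (K * (\<sigma> - \<rho>)) * \<sigma> ^ N"
          by (rule mult_mono[OF K(3) power_mono]) (use K(2) \<sigma> 1(3) in auto)
        then have "\<rho> ^ j * ((C * Cr) * \<rho>r ^ N) \<le> \<rho> ^ j * ((K * (\<sigma> - \<rho>)) * \<sigma> ^ N)"
          using gap by (intro mult_left_mono) auto
        then show ?thesis by (simp add: algebra_simps)
      qed
      ultimately show ?case by (rule slope_bound_mono)
    qed
    from this[of 0] obtain v where v: "\<And>x. x \<in> {0..1} \<Longrightarrow>
        (U N t has_real_derivative v x) (at x within {0..1}) \<and> \<bar>v x\<bar> \<le> K * \<sigma> ^ N"
      unfolding slope_bound_def by (force simp del: atLeastAtMost_iff)
    moreover have "(U N t has_real_derivative V N t x) (at x within {0..1})"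
      using V(1)[of N] tx by (simp add: x_deriv_def)
    ultimately have "V N t x = v x"
      using derivative_unique_unit_interval[OF _ _ tx(2)] tx(2) by blast
    then show ?thesis using v[OF tx(2)] by simp
  qed
  then show "\<exists>\<delta>>0. \<exists>C\<ge>0. \<exists>\<rho>. 0 < \<rho> \<and> \<rho> < 1 \<and>
     (\<forall>N. \<forall>t\<in>I. \<forall>x\<in>{0..1}. \<bar>t - t0\<bar> < \<delta> \<longrightarrow> \<bar>V N t x\<bar> \<le> C * \<rho> ^ N)"
    using 1(1) 2(1) 3(1) \<delta>5 K \<sigma>
    by (intro exI[of _ \<delta>] exI[of _ K] exI[of _ \<sigma>] conjI) (auto simp: \<delta>_def)
qed

end

lemma C_on_add_const:
  assumes "C_on p S f"
  shows "C_on p S (\<lambda>t. c + f t)"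
proof -
  have "((\<lambda>t. c + f t) has_real_derivative D) (at x) \<longleftrightarrow> (f has_real_derivative D) (at x)" for D x
  proof
    assume "((\<lambda>t. c + f t) has_real_derivative D) (at x)"
    from DERIV_add[OF this DERIV_const[of "- c"]] show "(f has_real_derivative D) (at x)" by simp
  next
    assume "(f has_real_derivative D) (at x)"
    from DERIV_add[OF DERIV_const[of c] this]
    show "((\<lambda>t. c + f t) has_real_derivative D) (at x)" by simp
  qed
  then have "deriv (\<lambda>t. c + f t) = deriv f"
    by (intro ext) (simp add: deriv_def)
  then have higher: "(deriv ^^ Suc j) (\<lambda>t. c + f t) = (deriv ^^ Suc j) f" for j
    unfolding funpow_Suc_right o_apply by simp
  show ?thesis
    unfolding C_on_def
  proof (intro conjI allI impI)
    fix j assume j: "j < p"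
    then have f: "(deriv ^^ j) f differentiable_on S" using assms unfolding C_on_def by blast
    show "(deriv ^^ j) (\<lambda>t. c + f t) differentiable_on S"
    proof (cases j)
      case 0
      then show ?thesis using f by (simp add: differentiable_on_def)
    next
      case (Suc i)
      then show ?thesis using f higher[of i] by metis
    qed
  next
    have f: "continuous_on S ((deriv ^^ p) f)" using assms unfolding C_on_def by blast
    show "continuous_on S ((deriv ^^ p) (\<lambda>t. c + f t))"
    proof (cases p)
      case 0
      then show ?thesis using f by (auto intro!: continuous_intros)
    next
      case (Suc i)
      then show ?thesis using f higher[of i] by metis
    qed
  qed
qed

context ifs_family
begin

lemma transfer_diff:
  "t \<in> I \<Longrightarrow> x \<in> {0..1} \<Longrightarrow> transfer (\<lambda>t x. u t x - u t 0) t x = transfer u t x - u t 0"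
  using g_sum[of x]
  by (simp add: weighted_def right_diff_distrib sum_subtractf flip: sum_distrib_right)

lemma weighted_g'_diff:
  "x \<in> {0..1} \<Longrightarrow> weighted (\<lambda>i _. g' i) (\<lambda>t x. u t x - u t 0) t x = weighted (\<lambda>i _. g' i) u t x"
  using g'_sum[of x]
  by (simp add: weighted_def right_diff_distrib sum_subtractf flip: sum_distrib_right)

text \<open>
  Subtracting the value at \<open>0\<close> turns decay of the derivative into decay of the function, with one
  order of regularity gained.
\<close>
lemma increment_regular:
  assumes "regular True 0 s V" "\<And>N. x_deriv (U N) (V N)" "\<And>N. strip_cont (U N)"
  shows "regular True 0 (Suc s) (\<lambda>N t x. U N t x - U N t 0)"
proof -
  have "x_deriv (\<lambda>t x. U N t x - U N t 0) (V N)" for N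
    using assms(2)[of N] unfolding x_deriv_def by (auto intro!: derivative_eq_intros)
  moreover have "strip_cont (\<lambda>t x. U N t x - U N t 0)" for N
  proof -
    have "strip_cont (\<lambda>t x. U N t 0)"
      by (rule strip_cont_comp[OF assms(3) strip_cont_const]) simp
    then show ?thesis using assms(3)[of N] unfolding strip_cont_def by (intro continuous_intros)
  qed
  moreover have "decaying (\<lambda>N t x. U N t x - U N t 0)"
    using decaying_increment[OF _ assms(2)] regular_x_controlled[of True s V] assms(1)
    by (simp add: controlled_def)
  ultimately show ?thesis using assms(1) by (auto simp: controlled_def)
qed

text \<open>
  The spectral gap starts the induction. Afterwards the forcing in the recursion for \<open>V\<close> contains
  \<open>U\<close> only through its increments, whose regularity at order \<open>Suc s\<close> follows from that of \<open>V\<close> at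
  order \<open>s\<close>.
\<close>
lemma x_derivative_decays:
  assumes "s \<le> n"
    and rec: "\<And>N t x. t \<in> I \<Longrightarrow> x \<in> {0..1} \<Longrightarrow> U (Suc N) t x = transfer (U N) t x + R N t x"
    and V: "\<And>N. x_deriv (U N) (V N)"
    and "regular False 0 (Suc s) U" "regular True 0 (Suc s) R"
  shows "regular True 0 s V"
  using assms(1,4,5)
proof (induction s)
  case 0
  obtain R' where R': "\<And>N. x_deriv (R N) (R' N)" "regular_x True 0 R'"
    using "0.prems"(3) by auto
  have V0: "regular_x False 0 V"
    using "0.prems"(2) by (intro regular_x_of_x_deriv[of False 0 U V] V) simp
  have "decaying V"
    by (rule gap_decaying[of U R V R', OF rec V _ R'(1)]) (use V0 R' in \<open>auto simp: controlled_def\<close>)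
  then show ?case using V0 by (simp add: controlled_def)
next
  case (Suc s)
  let ?Z = "\<lambda>N t x. U N t x - U N t 0"
  have low: "regular True 0 s V"
    using Suc.prems regular_Suc_mono[of _ 0 "Suc s"] by (intro Suc.IH) auto
  have U: "strip_cont (U N)" for N
    using regular_x_controlled[of False "Suc (Suc s)" U] Suc.prems(2) by (simp add: controlled_def)
  have Z: "regular True 0 (Suc s) ?Z"
    by (rule increment_regular[OF low V U])
  obtain R' where R': "\<And>N. x_deriv (R N) (R' N)" "regular True 0 (Suc s) R'"
    using Suc.prems(3) by auto
  show ?case
  proof (rule contraction_regular[where c = "\<lambda>i t x. g i x * \<tau>' i t x"
        and S = "\<lambda>N t x. weighted (\<lambda>i _. g' i) (?Z N) t x + R' N t x"])
    show "V (Suc N) t x = weighted (\<lambda>i t x. g i x * \<tau>' i t x) (V N) t x +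
        (weighted (\<lambda>i _. g' i) (?Z N) t x + R' N t x)" if tx: "t \<in> I" "x \<in> {0..1}" for N t x
    proof -
      have "x_deriv (U (Suc N)) (\<lambda>t x. weighted (\<lambda>i _. g' i) (U N) t x
          + weighted (\<lambda>i t x. g i x * \<tau>' i t x) (V N) t x + R' N t x)"
        by (rule x_deriv_cong[OF _ x_deriv_add[OF x_deriv_weighted[OF V x_deriv_g] R'(1)]])
          (simp_all add: rec)
      from x_deriv_unique[OF V this tx] show ?thesis
        using weighted_g'_diff[OF tx(2), of "U N" t] by simp
    qed
    show "smooth_coeff 0 (Suc s) (\<lambda>t x. g i x * \<tau>' i t x)" if "i \<in> {1..k}" for i
      using Suc.prems(1) by (intro regular_mult smooth_g[OF that] smooth_\<tau>'[OF that]) auto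
    show "(\<Sum>i=1..k. \<bar>g i x * \<tau>' i t x\<bar>) < 1" if "t \<in> I" "x \<in> {0..1}" for t x
    proof -
      have "(\<Sum>i=1..k. \<bar>g i x * \<tau>' i t x\<bar>) = (\<Sum>i=1..k. g i x * \<bar>\<tau>' i t x\<bar>)"
      proof (rule sum.cong)
        fix i assume "i \<in> {1..k}"
        then show "\<bar>g i x * \<tau>' i t x\<bar> = g i x * \<bar>\<tau>' i t x\<bar>"
          using g_pos[OF _ that(2), of i] by (simp add: abs_mult)
      qed simp
      then show ?thesis using average_less_1[OF that] by simp
    qed
    show "regular False 0 (Suc s) V"
      unfolding regular.simps using Suc.prems(2) by (intro regular_x_of_x_deriv[of False _ U V] V) simp
    show "regular True 0 (Suc s) (\<lambda>N t x. weighted (\<lambda>i _. g' i) (?Z N) t x + R' N t x)"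
      using Suc.prems(1) by (intro regular_add[OF regular_weighted[OF Z smooth_g'] R'(2)]) auto
  qed (use Suc.prems in auto)
qed

text \<open>
  As the weights have sum one, a step of the recursion changes \<open>U\<close>, apart from the
  forcing, only by averages of its increments.
\<close>
lemma step_decays_x:
  assumes "s \<le> n"
    and rec: "\<And>N t x. t \<in> I \<Longrightarrow> x \<in> {0..1} \<Longrightarrow> U (Suc N) t x = transfer (U N) t x + R N t x"
    and "regular False 0 (Suc s) U" "regular True 0 (Suc s) R"
  shows "regular True 0 (Suc s) (\<lambda>N t x. U (Suc N) t x - U N t x)"
proof -
  let ?Z = "\<lambda>N t x. U N t x - U N t 0"
  obtain V where V: "\<And>N. x_deriv (U N) (V N)"
    using assms(3) by auto
  have "strip_cont (U N)" for N
    using regular_x_controlled[of False "Suc s" U] assms(3) by (simp add: controlled_def)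
  then have Z: "regular True 0 (Suc s) ?Z"
    using x_derivative_decays[of s U R V, OF assms(1) rec V assms(3,4)] V by (intro increment_regular)
  have "regular True 0 (Suc s) (\<lambda>N t x. transfer (?Z N) t x - ?Z N t x + R N t x)"
    using assms(1)
    by (intro regular_add[OF regular_diff[OF regular_weighted[OF Z smooth_g] Z] assms(4)]) auto
  then show ?thesis
    by (rule regular_cong) (simp add: rec transfer_diff)
qed

text \<open>
  Moving the maps produces the only new term, and it involves an \<open>x\<close> derivative of \<open>u\<close>.
\<close>
lemma t_deriv_transfer:
  assumes "t_deriv u ut" "x_deriv u ux" "strip_cont ux"
    and "\<And>i. i \<in> {1..k} \<Longrightarrow> t_deriv (\<tau> i) (\<tau>t i)"
  shows "t_deriv (transfer u) (\<lambda>t x. transfer ut t x + weighted (\<lambda>i t x. g i x * \<tau>t i t x) ux t x)"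
proof -
  have "t_deriv (\<lambda>t x. \<Sum>i=1..k. g i x * u t (\<tau> i t x))
    (\<lambda>t x. \<Sum>i=1..k. 0 * u t (\<tau> i t x) + g i x * (ut t (\<tau> i t x) + \<tau>t i t x * ux t (\<tau> i t x)))"
  proof (rule t_deriv_sum)
    fix i assume i: "i \<in> {1..k}"
    show "t_deriv (\<lambda>t x. g i x * u t (\<tau> i t x))
        (\<lambda>t x. 0 * u t (\<tau> i t x) + g i x * (ut t (\<tau> i t x) + \<tau>t i t x * ux t (\<tau> i t x)))"
      by (rule t_deriv_mult[OF _ t_deriv_comp[OF assms(1-3) assms(4)[OF i] \<tau>_maps[OF i]]])
        (auto simp: t_deriv_def)
  qed
  then show ?thesis
    by (simp add: weighted_def[abs_def] sum.distrib distrib_left mult.assoc)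
qed

text \<open>
  The \<open>t\<close> derivative \<open>U1\<close> of \<open>U\<close> satisfies the same recursion with a forcing \<open>R'\<close> that contains
  \<open>V\<close>, the \<open>x\<close> derivative of \<open>U\<close>. With one \<open>t\<close> derivative fewer, \<open>V\<close> is known to decay, so the
  induction hypothesis applies to \<open>U\<close> first and to \<open>U1\<close> afterwards. The forcing \<open>R\<close> is there for
  the sake of this second application.
\<close>
lemma derivatives_decay:
  assumes "a \<le> s" "s \<le> n"
    and rec: "\<And>N t x. t \<in> I \<Longrightarrow> x \<in> {0..1} \<Longrightarrow> U (Suc N) t x = transfer (U N) t x + R N t x"
    and V: "\<And>N. x_deriv (U N) (V N)"
    and "regular False a (Suc s) U" "regular True a (Suc s) R"
  shows "regular True a s V \<and> regular True a (Suc s) (\<lambda>N t x. U (Suc N) t x - U N t x)"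
  using assms
proof (induction a arbitrary: s U R V)
  case 0
  show ?case
    using x_derivative_decays[of s U R V, OF 0(2,3,4,5,6)] step_decays_x[of s U R, OF 0(2,3,5,6)] by blast
next
  case (Suc a)
  obtain s' where s: "s = Suc s'" "a \<le> s'" using Suc.prems(1) by (cases s) auto
  have as: "a \<le> s" "a \<le> n" using s Suc.prems(2) by auto
  obtain U1 where U1: "\<And>N. t_deriv (U N) (U1 N)" "regular False a s U1"
    using Suc.prems(5) by auto
  obtain R1 where R1: "\<And>N. t_deriv (R N) (R1 N)" "regular True a s R1"
    using Suc.prems(6) by auto
  have low: "regular False b (Suc s) U" "regular True b (Suc s) R" if "b \<le> a" for b
    using Suc.prems(5,6) that regular_mono_t[of _ "Suc a" "Suc s" _ b] by auto
  have V: "regular True a s V"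
    using Suc.IH[of s U R V, OF as(1) Suc.prems(2,3,4) low(1)[of a] low(2)[of a]] by simp
  have Vx: "regular True 0 s V"
    using x_derivative_decays[of s U R V, OF Suc.prems(2,3,4) low(1)[of 0] low(2)[of 0]] by simp
  have \<Delta>x: "regular True 0 (Suc s) (\<lambda>N t x. U (Suc N) t x - U N t x)"
    using step_decays_x[of s U R, OF Suc.prems(2,3) low(1)[of 0] low(2)[of 0]] by simp
  have "\<exists>\<tau>t. t_deriv (\<tau> i) \<tau>t \<and> smooth_coeff a s \<tau>t" if i: "i \<in> {1..k}" for i
  proof -
    have "smooth_coeff (Suc a) (Suc s) (\<tau> i)"
      using Suc.prems(1,2) by (intro smooth_\<tau>[OF i]) auto
    then show ?thesis by (rule smooth_coeff_t) blast
  qed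
  then obtain \<tau>t where \<tau>t: "\<And>i. i \<in> {1..k} \<Longrightarrow> t_deriv (\<tau> i) (\<tau>t i)"
    "\<And>i. i \<in> {1..k} \<Longrightarrow> smooth_coeff a s (\<tau>t i)"
    by metis
  define R' where "R' N t x = weighted (\<lambda>i t x. g i x * \<tau>t i t x) (V N) t x + R1 N t x" for N t x
  have R': "regular True a s R'"
    unfolding R'_def[abs_def] using as Suc.prems(2)
    by (intro regular_add[OF regular_weighted[OF V regular_mult[OF smooth_g \<tau>t(2)]] R1(2)]) auto
  have rec1: "U1 (Suc N) t x = transfer (U1 N) t x + R' N t x" if tx: "t \<in> I" "x \<in> {0..1}" for N t x
  proof -
    have "strip_cont (V N)"
      using regular_x_controlled[of True s V] Vx by (simp add: controlled_def)
    then have "t_deriv (\<lambda>t x. transfer (U N) t x + R N t x)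
        (\<lambda>t x. transfer (U1 N) t x + weighted (\<lambda>i t x. g i x * \<tau>t i t x) (V N) t x + R1 N t x)"
      by (intro t_deriv_add[OF t_deriv_transfer[OF U1(1) Suc.prems(4) _ \<tau>t(1)] R1(1)])
    then have "t_deriv (U (Suc N))
        (\<lambda>t x. transfer (U1 N) t x + weighted (\<lambda>i t x. g i x * \<tau>t i t x) (V N) t x + R1 N t x)"
      by (rule t_deriv_cong[rotated]) (simp add: Suc.prems(3))
    from t_deriv_unique[OF U1(1) this tx] show ?thesis by (simp add: R'_def)
  qed
  obtain U1x where U1x: "\<And>N. x_deriv (U1 N) (U1x N)"
    using U1(2) unfolding s(1) by (rule regular_imp_x_deriv) (rule that)
  have IH: "regular True a s' U1x" "regular True a s (\<lambda>N t x. U1 (Suc N) t x - U1 N t x)"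
    using Suc.IH[of s' U1 R' U1x, OF s(2) _ rec1 U1x] U1(2) R' Suc.prems(2) s(1) by auto
  have "t_deriv (V N) (U1x N)" for N
    using regular_x_controlled[OF regular_regular_x[OF U1(2)]]
      regular_x_controlled[OF regular_regular_x[OF IH(1)]]
    by (intro t_deriv_x_deriv_commute[OF Suc.prems(4) U1(1) U1x]) (auto simp: controlled_def)
  then have "regular True (Suc a) s V"
    using Vx IH(1) unfolding s(1) by (intro regular_SucI[where F' = U1x]) auto
  moreover have "t_deriv (\<lambda>t x. U (Suc N) t x - U N t x) (\<lambda>t x. U1 (Suc N) t x - U1 N t x)" for N
    using U1(1) unfolding t_deriv_def by (auto intro!: derivative_intros)
  then have "regular True (Suc a) (Suc s) (\<lambda>N t x. U (Suc N) t x - U N t x)"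
    using \<Delta>x IH(2) by (intro regular_SucI[where F' = "\<lambda>N t x. U1 (Suc N) t x - U1 N t x"]) auto
  ultimately show ?case by blast
qed

definition iterate :: "(real \<Rightarrow> real) \<Rightarrow> nat \<Rightarrow> real \<Rightarrow> real \<Rightarrow> real" where
  "iterate w N t = (average k g (\<lambda>i. \<tau> i t) ^^ N) w"

lemma iterate_Suc: "iterate w (Suc N) t x = transfer (iterate w N) t x"
  by (simp add: iterate_def average_def weighted_def)

lemma iterate_regular:
  assumes "regular_x False (Suc n) (\<lambda>_ _. w)"
  shows "regular False n (Suc n) (iterate w)"
proof (rule regular_pointwise)
  show "smooth_coeff n (Suc n) (iterate w N)" for N
  proof (induction N)
    case 0
    show ?case
      using regular_t_independent[OF assms, of n] by (simp add: iterate_def[abs_def])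
  next
    case (Suc N)
    have "smooth_coeff n (Suc n) (transfer (iterate w N))"
      using regular_weighted[OF Suc smooth_g] by simp
    then show ?case by (rule regular_cong) (simp add: iterate_Suc)
  qed
qed

lemma iterate_derivatives_decay:
  assumes w: "regular_x False (Suc n) (\<lambda>_ _. w)"
  shows iterate_oscillation_decays: "decaying (\<lambda>N t x. iterate w N t x - iterate w N t 0)"
    and iterate_steps_decay: "regular True n (Suc n) (\<lambda>N t x. iterate w (Suc N) t x - iterate w N t x)"
proof -
  obtain V where V: "\<And>N. x_deriv (iterate w N) (V N)"
    using iterate_regular[OF w] by (rule regular_imp_x_deriv) (rule that)
  have "regular True n n V \<and> regular True n (Suc n) (\<lambda>N t x. iterate w (Suc N) t x - iterate w N t x)"
    by (rule derivatives_decay[of n n "iterate w" "\<lambda>_ _ _. 0" V, OF _ _ _ V iterate_regular[OF w] regular_zero]) (auto simp: iterate_Suc)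
  moreover from this have "decaying V"
    using regular_regular_x regular_x_controlled unfolding controlled_def by blast
  then show "decaying (\<lambda>N t x. iterate w N t x - iterate w N t 0)"
    by (rule decaying_increment[OF _ V])
  ultimately show "regular True n (Suc n) (\<lambda>N t x. iterate w (Suc N) t x - iterate w N t x)"
    by blast
qed

text \<open>
  The limit is a telescoping series of steps, to which \<open>regular_series_C_on\<close> applies.
\<close>
lemma iterate_limit_C_on:
  assumes w: "regular_x False (Suc n) (\<lambda>_ _. w)"
    and lim: "\<And>t. t \<in> I \<Longrightarrow> (\<lambda>N. iterate w N t 0) \<longlonglongrightarrow> \<phi> t"
  shows "C_on n I \<phi>"
proof -
  have "C_on n I (\<lambda>t. \<Sum>N. iterate w (Suc N) t 0 - iterate w N t 0)"
    using regular_series_C_on[OF iterate_steps_decay[OF w]] by simp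
  then have "C_on n I (\<lambda>t. w 0 + (\<Sum>N. iterate w (Suc N) t 0 - iterate w N t 0))"
    by (rule C_on_add_const)
  then show ?thesis
  proof (rule C_on_cong[OF open_I, rotated])
    fix t assume "t \<in> I"
    from sums_unique[OF telescope_sums[OF lim[OF this]]]
    show "w 0 + (\<Sum>N. iterate w (Suc N) t 0 - iterate w N t 0) = \<phi> t"
      by (simp add: iterate_def)
  qed
qed

end

section \<open>Curves of Hoelder functions\<close>

lemma diffI_has_derivative:
  assumes "times_differentiable n v" "i < n" "x \<in> {0..1}"
  shows "(diffI i v has_real_derivative diffI (Suc i) v x) (at x within {0..1})"
  using assms by (simp add: times_differentiable_def has_real_derivative_iff_has_vector_derivative
      vector_derivative_works)

lemma diffI_eqI:
  assumes "(diffI i v has_real_derivative D) (at x within {0..1})" "x \<in> {0..1}"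
  shows "diffI (Suc i) v x = D"
  using vector_derivative_within_cbox[of 0 1 x "diffI i v" D] assms
  by (simp add: has_real_derivative_iff_has_vector_derivative cbox_interval)

lemma diffI_linear:
  assumes "times_differentiable n u" "times_differentiable n v" "i \<le> n" "x \<in> {0..1}"
  shows "diffI i (\<lambda>x. a * u x + b * v x) x = a * diffI i u x + b * diffI i v x"
    and "i < n \<Longrightarrow> ((diffI i (\<lambda>x. a * u x + b * v x)) has_real_derivative
      a * diffI (Suc i) u x + b * diffI (Suc i) v x) (at x within {0..1})"
proof -
  let ?w = "\<lambda>x. a * u x + b * v x"
  have deriv: "(diffI i ?w has_real_derivative a * diffI (Suc i) u x + b * diffI (Suc i) v x)
      (at x within {0..1})"
    if "i < n" and eq: "\<And>x. x \<in> {0..1} \<Longrightarrow> diffI i ?w x = a * diffI i u x + b * diffI i v x"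
      and x: "x \<in> {0..1}" for i x
  proof (rule has_field_derivative_transform_within[OF _ zero_less_one x])
    show "((\<lambda>x. a * diffI i u x + b * diffI i v x) has_real_derivative
        a * diffI (Suc i) u x + b * diffI (Suc i) v x) (at x within {0..1})"
      by (intro DERIV_add DERIV_cmult diffI_has_derivative[OF assms(1) that(1) x]
          diffI_has_derivative[OF assms(2) that(1) x])
  qed (rule eq[symmetric])
  have eq: "diffI i ?w x = a * diffI i u x + b * diffI i v x" if "i \<le> n" "x \<in> {0..1}" for i x
    using that
  proof (induction i arbitrary: x)
    case (Suc i)
    show ?case
      by (rule diffI_eqI[OF deriv Suc.prems(2)]) (use Suc in auto)
  qed simp
  show "diffI i ?w x = a * diffI i u x + b * diffI i v x"
    by (rule eq[OF assms(3,4)])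
  show "i < n \<Longrightarrow> (diffI i ?w has_real_derivative a * diffI (Suc i) u x + b * diffI (Suc i) v x)
      (at x within {0..1})"
    using eq by (intro deriv assms(4)) auto
qed

lemma CH_bounded:
  assumes "v \<in> CH n \<delta>" "i \<le> n"
  obtains A where "\<And>x. x \<in> {0..1} \<Longrightarrow> \<bar>diffI i v x\<bar> \<le> A"
proof -
  have "bdd_above ((\<lambda>x. \<bar>diffI i v x\<bar>) ` {0..1})" using assms by (simp add: CH_def)
  then obtain A where A: "\<forall>y\<in>(\<lambda>x. \<bar>diffI i v x\<bar>) ` {0..1}. y \<le> A" unfolding bdd_above_def ..
  show thesis by (rule that) (rule A[rule_format, OF imageI])
qed

lemma CH_hoelder:
  assumes "v \<in> CH n \<delta>"
  obtains H where "\<And>x y. x \<in> {0..1} \<Longrightarrow> y \<in> {0..1} \<Longrightarrow> x \<noteq> y \<Longrightarrow>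
    \<bar>diffI n v x - diffI n v y\<bar> / \<bar>x - y\<bar> powr \<delta> \<le> H"
proof -
  have "bdd_above (holder_quotients \<delta> (diffI n v))" using assms by (simp add: CH_def)
  then obtain H where H: "\<forall>q\<in>holder_quotients \<delta> (diffI n v). q \<le> H" unfolding bdd_above_def ..
  show thesis by (rule that, rule H[rule_format]) (unfold holder_quotients_def, blast)
qed

lemma CH_linear:
  assumes u: "u \<in> CH n \<delta>" and v: "v \<in> CH n \<delta>"
  shows "(\<lambda>x. a * u x + b * v x) \<in> CH n \<delta>"
proof -
  let ?w = "\<lambda>x. a * u x + b * v x"
  have d: "times_differentiable n u" "times_differentiable n v"
    using u v by (auto simp: CH_def)
  have eq: "diffI i ?w x = a * diffI i u x + b * diffI i v x" if "i \<le> n" "x \<in> {0..1}" for i x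
    by (rule diffI_linear(1)[OF d that])
  have "times_differentiable n ?w"
    unfolding times_differentiable_def real_differentiable_def
    using diffI_linear(2)[OF d] by (blast intro: less_imp_le)
  moreover have "bdd_above ((\<lambda>x. \<bar>diffI i ?w x\<bar>) ` {0..1})" if i: "i \<le> n" for i
  proof -
    obtain A where A: "\<And>x. x \<in> {0..1} \<Longrightarrow> \<bar>diffI i u x\<bar> \<le> A"
      by (rule CH_bounded[OF u i]) (rule that)
    obtain B where B: "\<And>x. x \<in> {0..1} \<Longrightarrow> \<bar>diffI i v x\<bar> \<le> B"
      by (rule CH_bounded[OF v i]) (rule that)
    have "\<bar>diffI i ?w x\<bar> \<le> \<bar>a\<bar> * A + \<bar>b\<bar> * B" if x: "x \<in> {0..1}" for x
    proof -
      have "\<bar>diffI i ?w x\<bar> \<le> \<bar>a\<bar> * \<bar>diffI i u x\<bar> + \<bar>b\<bar> * \<bar>diffI i v x\<bar>"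
        unfolding eq[OF i x] abs_mult[symmetric] by (rule abs_triangle_ineq)
      also have "\<dots> \<le> \<bar>a\<bar> * A + \<bar>b\<bar> * B"
        using A[OF x] B[OF x] by (intro add_mono mult_left_mono) auto
      finally show ?thesis .
    qed
    then show ?thesis unfolding bdd_above_def by blast
  qed
  moreover have "bdd_above (holder_quotients \<delta> (diffI n ?w))"
  proof -
    obtain A where A: "\<And>x y. x \<in> {0..1} \<Longrightarrow> y \<in> {0..1} \<Longrightarrow> x \<noteq> y \<Longrightarrow>
        \<bar>diffI n u x - diffI n u y\<bar> / \<bar>x - y\<bar> powr \<delta> \<le> A"
      by (rule CH_hoelder[OF u]) (rule that)
    obtain B where B: "\<And>x y. x \<in> {0..1} \<Longrightarrow> y \<in> {0..1} \<Longrightarrow> x \<noteq> y \<Longrightarrow>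
        \<bar>diffI n v x - diffI n v y\<bar> / \<bar>x - y\<bar> powr \<delta> \<le> B"
      by (rule CH_hoelder[OF v]) (rule that)
    have "\<bar>diffI n ?w x - diffI n ?w y\<bar> / \<bar>x - y\<bar> powr \<delta> \<le> \<bar>a\<bar> * A + \<bar>b\<bar> * B"
      if xy: "x \<in> {0..1}" "y \<in> {0..1}" "x \<noteq> y" for x y
    proof -
      let ?U = "diffI n u x - diffI n u y" and ?V = "diffI n v x - diffI n v y"
      have "\<bar>diffI n ?w x - diffI n ?w y\<bar> = \<bar>a * ?U + b * ?V\<bar>"
        using xy by (simp add: eq algebra_simps)
      also have "\<dots> \<le> \<bar>a\<bar> * \<bar>?U\<bar> + \<bar>b\<bar> * \<bar>?V\<bar>"
        unfolding abs_mult[symmetric] by (rule abs_triangle_ineq)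
      finally have "\<bar>diffI n ?w x - diffI n ?w y\<bar> / \<bar>x - y\<bar> powr \<delta>
          \<le> (\<bar>a\<bar> * \<bar>?U\<bar> + \<bar>b\<bar> * \<bar>?V\<bar>) / \<bar>x - y\<bar> powr \<delta>"
        by (rule divide_right_mono) simp
      also have "\<dots> = \<bar>a\<bar> * (\<bar>?U\<bar> / \<bar>x - y\<bar> powr \<delta>) + \<bar>b\<bar> * (\<bar>?V\<bar> / \<bar>x - y\<bar> powr \<delta>)"
        by (simp add: add_divide_distrib)
      also have "\<dots> \<le> \<bar>a\<bar> * A + \<bar>b\<bar> * B"
        using A[OF xy] B[OF xy] by (intro add_mono mult_left_mono) auto
      finally show ?thesis .
    qed
    then show ?thesis unfolding bdd_above_def holder_quotients_def by blast
  qed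
  ultimately show ?thesis by (simp add: CH_def)
qed

lemma abs_diffI_le_norm_CH:
  assumes "v \<in> CH n \<delta>" "i \<le> n" "x \<in> {0..1}"
  shows "\<bar>diffI i v x\<bar> \<le> norm_CH n \<delta> v"
proof -
  have "\<bar>diffI i v x\<bar> \<le> norm_C0 (diffI i v)"
    unfolding norm_C0_def using assms by (intro cSUP_upper) (auto simp: CH_def)
  also have "\<dots> \<le> norm_C n v"
    unfolding norm_C_def using assms by (intro Max_ge) auto
  also have "\<dots> \<le> norm_CH n \<delta> v" by (simp add: norm_CH_def)
  finally show ?thesis .
qed

text \<open>
  Below the top order continuity comes from differentiability, at the top order from the Hoelder
  bound.
\<close>
lemma diffI_continuous_CH:
  assumes v: "v \<in> CH n \<delta>" and "0 < \<delta>" "i \<le> n"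
  shows "continuous_on {0..1} (diffI i v)"
proof (cases "i < n")
  case True
  then have "diffI i v differentiable_on {0..1}"
    using v by (auto simp: CH_def times_differentiable_def differentiable_on_def)
  then show ?thesis by (rule differentiable_imp_continuous_on)
next
  case False
  then have i: "i = n" using assms by simp
  obtain H where H: "\<And>x y. x \<in> {0..1} \<Longrightarrow> y \<in> {0..1} \<Longrightarrow> x \<noteq> y \<Longrightarrow>
      \<bar>diffI n v x - diffI n v y\<bar> / \<bar>x - y\<bar> powr \<delta> \<le> H"
    by (rule CH_hoelder[OF v]) (rule that)
  have H': "\<bar>diffI n v y - diffI n v x\<bar> \<le> H * \<bar>y - x\<bar> powr \<delta>" if "x \<in> {0..1}" "y \<in> {0..1}" for x y
  proof (cases "x = y")
    case False
    then show ?thesis using H[of y x] that by (simp add: divide_le_eq)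
  qed (use \<open>0 < \<delta>\<close> in simp)
  show ?thesis
    unfolding i continuous_on_def
  proof
    fix x :: real assume x: "x \<in> {0..1}"
    have "((\<lambda>y. \<bar>y - x\<bar> powr \<delta>) \<longlongrightarrow> \<bar>x - x\<bar> powr \<delta>) (at x within {0..1})"
      using \<open>0 < \<delta>\<close> by (intro tendsto_powr' tendsto_intros) auto
    then have "((\<lambda>y. H * \<bar>y - x\<bar> powr \<delta>) \<longlongrightarrow> 0) (at x within {0..1})"
      using tendsto_mult_left[of _ 0 _ H] \<open>0 < \<delta>\<close> by simp
    then have "((\<lambda>y. diffI n v y - diffI n v x) \<longlongrightarrow> 0) (at x within {0..1})"
      by (rule Lim_null_comparison[rotated])
        (use H'[OF x] in \<open>auto simp: eventually_at intro!: exI[of _ 1]\<close>)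
    then show "(diffI n v \<longlongrightarrow> diffI n v x) (at x within {0..1})"
      by (simp add: LIM_zero_iff)
  qed
qed

lemma smooth_I_continuous:
  assumes "smooth_I w"
  shows "continuous_on {0..1} (diffI i w)"
proof -
  have "diffI i w differentiable_on {0..1}"
    using assms by (auto simp: smooth_I_def times_differentiable_def differentiable_on_def)
  then show ?thesis by (rule differentiable_imp_continuous_on)
qed

text \<open>
  Difference quotients within the interval suffice, also at its end points.
\<close>
lemma lipschitz_bounds_derivative:
  assumes "L-lipschitz_on {0..1} f" "(f has_real_derivative D) (at x within {0..1})" "x \<in> {0..1}"
  shows "\<bar>D\<bar> \<le> L"
proof -
  have "((\<lambda>y. (f y - f x) / (y - x)) \<longlongrightarrow> D) (at x within {0..1})"
    using assms(2) by (simp add: has_field_derivative_iff)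
  moreover have "\<forall>\<^sub>F y in at x within {0..1}. norm ((f y - f x) / (y - x)) \<le> L"
    unfolding eventually_at
  proof (intro exI[of _ 1] conjI ballI impI)
    fix y assume y: "y \<in> {0..1::real}" "y \<noteq> x \<and> dist y x < 1"
    have "dist (f y) (f x) \<le> L * dist y x"
      using assms y by (intro lipschitz_onD) auto
    then show "norm ((f y - f x) / (y - x)) \<le> L"
      using y by (simp add: dist_real_def divide_le_eq)
  qed simp
  moreover have "at x within {0..1} \<noteq> bot"
    using assms(3) by (simp add: trivial_limit_within islimpt_Icc)
  ultimately show ?thesis
    using tendsto_upperbound[OF tendsto_norm] by fastforce
qed

lemma lipschitz_derivative_le_Lip:
  assumes "\<exists>L. L-lipschitz_on {0..1} f" "(f has_real_derivative D) (at x within {0..1})" "x \<in> {0..1}"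
  shows "\<bar>D\<bar> \<le> Lip f"
  unfolding Lip_def using assms lipschitz_bounds_derivative
  by (intro cInf_greatest) auto

context strip
begin

lemma regular_x_diffI:
  assumes "\<And>i. i \<le> s \<Longrightarrow> strip_cont (\<lambda>t. diffI i (F t))"
    and "\<And>t. t \<in> I \<Longrightarrow> times_differentiable s (F t)"
  shows "regular_x False s (\<lambda>_. F)"
proof -
  have "regular_x False j (\<lambda>_ t. diffI i (F t))" if "i + j = s" for i j
    using that
  proof (induction j arbitrary: i)
    case 0
    then show ?case using assms(1) by (simp add: controlled_def)
  next
    case (Suc j)
    have "x_deriv (\<lambda>t. diffI i (F t)) (\<lambda>t. diffI (Suc i) (F t))"
      unfolding x_deriv_def using Suc.prems
      by (intro ballI diffI_has_derivative[OF assms(2)]) auto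
    then show ?case
      using Suc.IH[of "Suc i"] Suc.prems assms(1)[of i]
      by (intro regular_x_SucI) (auto simp: controlled_def simp del: diffI.simps)
  qed
  from this[of 0 s] show ?thesis by simp
qed

lemma regular_x_t_independent:
  assumes "\<And>i. i \<le> s \<Longrightarrow> continuous_on {0..1} (diffI i v)" "times_differentiable s v"
  shows "regular_x False s (\<lambda>_ _. v)"
proof (rule regular_x_diffI)
  fix i assume "i \<le> s"
  then show "strip_cont (\<lambda>t. diffI i v)"
    unfolding strip_cont_def
    by (intro continuous_on_compose2[OF assms(1), of i] continuous_intros) auto
qed (rule assms(2))

text \<open>
  Continuity in \<open>x\<close> for each \<open>t\<close>, together with continuity in \<open>t\<close> uniformly in \<open>x\<close>, is joint
  continuity.
\<close>
lemma strip_cont_uniform: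
  assumes "\<And>t. t \<in> I \<Longrightarrow> continuous_on {0..1} (f t)"
    and "\<And>t. t \<in> I \<Longrightarrow> (b t \<longlongrightarrow> 0) (at 0)"
    and "\<And>t h x. t \<in> I \<Longrightarrow> t + h \<in> I \<Longrightarrow> x \<in> {0..1} \<Longrightarrow> \<bar>f (t + h) x - f t x\<bar> \<le> b t h"
  shows "strip_cont f"
  unfolding strip_cont_def continuous_on_iff
proof (intro ballI allI impI)
  fix p and e :: real assume p: "p \<in> I \<times> {0..1::real}" and e: "0 < e"
  define t x where "t = fst p" and "x = snd p"
  have tx: "t \<in> I" "x \<in> {0..1}" using p by (auto simp: t_def x_def)
  obtain d1 where d1: "d1 > 0" "\<And>y. y \<in> {0..1} \<Longrightarrow> dist y x < d1 \<Longrightarrow> dist (f t y) (f t x) < e/2"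
    using assms(1)[OF tx(1), unfolded continuous_on_iff, rule_format, OF tx(2) half_gt_zero[OF e]]
    by blast
  have "\<forall>\<^sub>F h in at 0. dist (b t h) 0 < e/2"
    using assms(2)[OF tx(1)] e by (intro tendstoD) auto
  then obtain d2 where d2: "d2 > 0" "\<And>h. h \<noteq> 0 \<Longrightarrow> dist h 0 < d2 \<Longrightarrow> \<bar>b t h\<bar> < e/2"
    by (auto simp: eventually_at)
  show "\<exists>d>0. \<forall>q\<in>I \<times> {0..1}. dist q p < d \<longrightarrow> dist (f (fst q) (snd q)) (f (fst p) (snd p)) < e"
  proof (intro exI[of _ "min d1 d2"] conjI ballI impI)
    fix q assume q: "q \<in> I \<times> {0..1::real}" "dist q p < min d1 d2"
    define h y where "h = fst q - t" and "y = snd q"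
    have hy: "t + h \<in> I" "y \<in> {0..1}" using q by (auto simp: h_def y_def)
    have "dist (fst q) (fst p) < min d1 d2" "dist (snd q) (snd p) < min d1 d2"
      using q(2) dist_fst_le[of q p] dist_snd_le[of q p] by auto
    then have small: "dist h 0 < d2" "dist y x < d1"
      by (auto simp: h_def y_def t_def x_def dist_real_def)
    have "\<bar>f (t + h) y - f t y\<bar> < e/2"
    proof (cases "h = 0")
      case False
      then show ?thesis using assms(3)[OF tx(1) hy] d2(2)[OF False small(1)] by simp
    qed (use e in simp)
    moreover have "\<bar>f t y - f t x\<bar> < e/2"
      using d1(2)[OF hy(2) small(2)] by (simp add: dist_real_def)
    ultimately have "\<bar>f (t + h) y - f t x\<bar> < e" by linarith
    then show "dist (f (fst q) (snd q)) (f (fst p) (snd p)) < e"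
      by (simp add: dist_real_def h_def y_def t_def x_def)
  qed (use d1 d2 in auto)
qed

text \<open>
  Convergence in the norm of \<open>C\<^sup>m\<^sup>+\<^sup>\<delta>\<close> bounds \<open>diffI i\<close> for all \<open>i \<le> m\<close> uniformly in \<open>x\<close>, so the
  derivatives of the curve are jointly continuous and are derivatives for each fixed \<open>x\<close>. All
  functions involved belong to \<open>C\<^sup>m\<^sup>+\<^sup>\<delta>\<close>, which makes the suprema in the norm meaningful.
\<close>
lemma C_curve_smooth_coeff:
  assumes curve: "C_curve m \<delta> p I F" and "0 < \<delta>" "a \<le> p" "a \<le> s" "s \<le> m"
  shows "smooth_coeff a s F"
proof -
  obtain D where D: "(\<forall>t\<in>I. \<forall>x\<in>{0..1}. D 0 t x = F t x) \<and>
      (\<forall>j\<le>p. \<forall>t\<in>I. D j t \<in> CH m \<delta>) \<and>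
      (\<forall>j<p. \<forall>t\<in>I.
        ((\<lambda>h. norm_CH m \<delta> (\<lambda>x. (D j (t + h) x - D j t x) / h - D (Suc j) t x)) \<longlongrightarrow> 0) (at 0)) \<and>
      (\<forall>t\<in>I. ((\<lambda>h. norm_CH m \<delta> (\<lambda>x. D p (t + h) x - D p t x)) \<longlongrightarrow> 0) (at 0))"
    using curve unfolding C_curve_def ..
  note D0 = D[THEN conjunct1, rule_format]
    and CH = D[THEN conjunct2, THEN conjunct1, rule_format]
    and quot = D[THEN conjunct2, THEN conjunct2, THEN conjunct1, rule_format]
    and top = D[THEN conjunct2, THEN conjunct2, THEN conjunct2, rule_format]
  have diff: "\<bar>diffI i (D p (t + h)) x - diffI i (D p t) x\<bar> \<le> norm_CH m \<delta> (\<lambda>x. D p (t + h) x - D p t x)"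
    if "i \<le> m" "t \<in> I" "t + h \<in> I" "x \<in> {0..1}" for i t h x
  proof -
    have *: "D p (t + h) \<in> CH m \<delta>" "D p t \<in> CH m \<delta>" using CH that by auto
    have "\<bar>diffI i (\<lambda>x. 1 * D p (t + h) x + (-1) * D p t x) x\<bar>
        \<le> norm_CH m \<delta> (\<lambda>x. 1 * D p (t + h) x + (-1) * D p t x)"
      by (rule abs_diffI_le_norm_CH[OF CH_linear[OF *] that(1,4)])
    then show ?thesis
      using diffI_linear(1)[of m "D p (t + h)" "D p t" i x 1 "-1"] * that by (simp add: CH_def)
  qed
  have quot_diff: "\<bar>(diffI i (D j (t + h)) x - diffI i (D j t) x) / h - diffI i (D (Suc j) t) x\<bar>
      \<le> norm_CH m \<delta> (\<lambda>x. (D j (t + h) x - D j t x) / h - D (Suc j) t x)"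
    if j: "j < p" and "i \<le> m" "t \<in> I" "t + h \<in> I" "x \<in> {0..1}" for i j t h x
  proof -
    have *: "D j (t + h) \<in> CH m \<delta>" "D j t \<in> CH m \<delta>" "D (Suc j) t \<in> CH m \<delta>" using CH that by auto
    let ?q = "\<lambda>x. (1/h) * D j (t + h) x + (- 1/h) * D j t x"
    have q: "?q \<in> CH m \<delta>" by (rule CH_linear[OF *(1,2)])
    have "\<bar>diffI i (\<lambda>x. 1 * ?q x + (-1) * D (Suc j) t x) x\<bar>
        \<le> norm_CH m \<delta> (\<lambda>x. 1 * ?q x + (-1) * D (Suc j) t x)"
      by (rule abs_diffI_le_norm_CH[OF CH_linear[OF q *(3)] that(2,5)])
    moreover have "diffI i (\<lambda>x. 1 * ?q x + (-1) * D (Suc j) t x) x =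
        1 * ((1/h) * diffI i (D j (t + h)) x + (- 1/h) * diffI i (D j t) x) + (-1) * diffI i (D (Suc j) t) x"
      using diffI_linear(1)[of m ?q "D (Suc j) t" i x 1 "-1"]
        diffI_linear(1)[of m "D j (t + h)" "D j t" i x "1/h" "-1/h"] q * that
      by (simp only: CH_def mem_Collect_eq)
    moreover have "(\<lambda>x. 1 * ?q x + (-1) * D (Suc j) t x) = (\<lambda>x. (D j (t + h) x - D j t x) / h - D (Suc j) t x)"
      by (intro ext) (simp add: diff_divide_distrib)
    ultimately show ?thesis by (simp add: diff_divide_distrib)
  qed
  have cont: "strip_cont (\<lambda>t. diffI i (D j t))" if j: "j \<le> p" and i: "i \<le> m" for i j
  proof (cases "j = p")
    case True
    show ?thesis unfolding True
      by (rule strip_cont_uniform[where b = "\<lambda>t h. norm_CH m \<delta> (\<lambda>x. D p (t + h) x - D p t x)"])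
        (use diffI_continuous_CH[OF CH \<open>0 < \<delta>\<close> i] top diff i in auto)
  next
    case False
    then have jp: "j < p" using j by simp
    let ?b = "\<lambda>t h. \<bar>h\<bar> * (norm_CH m \<delta> (\<lambda>x. (D j (t + h) x - D j t x) / h - D (Suc j) t x)
        + norm_CH m \<delta> (D (Suc j) t))"
    show ?thesis
    proof (rule strip_cont_uniform[where b = ?b])
      show "continuous_on {0..1} (diffI i (D j t))" if "t \<in> I" for t
        by (rule diffI_continuous_CH[OF CH[OF j that] \<open>0 < \<delta>\<close> i])
      show "(?b t \<longlongrightarrow> 0) (at 0)" if "t \<in> I" for t
      proof -
        have "(?b t \<longlongrightarrow> \<bar>0\<bar> * (0 + norm_CH m \<delta> (D (Suc j) t))) (at 0)"
          by (intro tendsto_mult tendsto_add tendsto_const tendsto_rabs tendsto_ident_at quot jp that)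
        then show ?thesis by simp
      qed
      show "\<bar>diffI i (D j (t + h)) x - diffI i (D j t) x\<bar> \<le> ?b t h"
        if tx: "t \<in> I" "t + h \<in> I" "x \<in> {0..1}" for t h x
      proof (cases "h = 0")
        case False
        let ?Q = "(diffI i (D j (t + h)) x - diffI i (D j t) x) / h" and ?E = "diffI i (D (Suc j) t) x"
        have "\<bar>?Q\<bar> \<le> \<bar>?Q - ?E\<bar> + \<bar>?E\<bar>" by linarith
        also have "\<dots> \<le> norm_CH m \<delta> (\<lambda>x. (D j (t + h) x - D j t x) / h - D (Suc j) t x)
            + norm_CH m \<delta> (D (Suc j) t)"
          using jp by (intro add_mono quot_diff[OF jp i tx] abs_diffI_le_norm_CH[OF CH i tx(3)] tx) auto
        finally have "\<bar>h\<bar> * \<bar>?Q\<bar> \<le> ?b t h" by (rule mult_left_mono) simp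
        moreover have "\<bar>h\<bar> * \<bar>?Q\<bar> = \<bar>diffI i (D j (t + h)) x - diffI i (D j t) x\<bar>"
          using False by (simp add: abs_divide)
        ultimately show ?thesis by metis
      qed simp
    qed
  qed
  have x: "regular_x False s (\<lambda>_. D j)" if "j \<le> p" "s \<le> m" for j s
    using CH[OF that(1)] that
    by (intro regular_x_diffI cont) (auto simp: CH_def times_differentiable_def)
  have t_deriv: "t_deriv (D j) (D (Suc j))" if j: "j < p" for j
    unfolding t_deriv_def
  proof (intro ballI)
    fix t x assume tx: "t \<in> I" "x \<in> {0..1::real}"
    have "((\<lambda>h. (D j (t + h) x - D j t x) / h - D (Suc j) t x) \<longlongrightarrow> 0) (at 0)"
    proof (rule Lim_null_comparison[OF _ quot[OF j tx(1)]])
      have "\<forall>\<^sub>F h in at 0. t + h \<in> I"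
      proof -
        obtain e where "e > 0" "ball t e \<subseteq> I" using open_I tx(1) open_contains_ball by blast
        then show ?thesis
          by (auto simp: eventually_at dist_real_def subset_iff intro!: exI[of _ e])
      qed
      then show "\<forall>\<^sub>F h in at 0. norm ((D j (t + h) x - D j t x) / h - D (Suc j) t x)
          \<le> norm_CH m \<delta> (\<lambda>x. (D j (t + h) x - D j t x) / h - D (Suc j) t x)"
        by eventually_elim (use quot_diff[OF j, of 0 t _ x] tx in auto)
    qed
    then show "((\<lambda>s. D j s x) has_real_derivative D (Suc j) t x) (at t)"
      by (simp add: DERIV_def LIM_zero_iff)
  qed
  have "smooth_coeff a s (D j)" if "a + j \<le> p" "a \<le> s" "s \<le> m" for a s j
    using that
  proof (induction a arbitrary: s j)
    case (Suc a)
    then obtain s' where s: "s = Suc s'" by (cases s) auto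
    show ?case
      unfolding s using Suc.prems s
      by (intro regular_SucI[OF Suc.IH[of "Suc j"] t_deriv x]) auto
  qed (simp add: x)
  then have "smooth_coeff a s (D 0)" using assms by simp
  then show ?thesis by (rule regular_cong) (rule D0)
qed

end

section \<open>Stationary measures\<close>

lemma stationary_measure_integrable:
  fixes f :: "real \<Rightarrow> real"
  assumes "stationary_measure k g T \<mu>" "continuous_on {0..1} f"
  shows "integrable \<mu> f"
proof -
  interpret prob_space \<mu> using assms(1) by (simp add: stationary_measure_def)
  have sets: "sets \<mu> = sets (restrict_space borel {0..1})"
    using assms(1) by (simp add: stationary_measure_def)
  have "f \<in> borel_measurable (restrict_space borel {0..1})"
    by (rule borel_measurable_continuous_on_restrict[OF assms(2)])
  then have "f \<in> borel_measurable \<mu>"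
    using measurable_cong_sets[OF sets refl] by blast
  moreover have "space \<mu> = {0..1}"
    using sets_eq_imp_space_eq[OF sets] by (simp add: space_restrict_space)
  moreover obtain B where "\<forall>x\<in>{0..1}. norm (f x) \<le> B"
    using compact_imp_bounded[OF compact_continuous_image[OF assms(2)]] by (auto simp: bounded_iff)
  ultimately show ?thesis
    using integrable_const_bound[of f B] by auto
qed

lemma stationary_measure_average:
  assumes \<mu>: "stationary_measure k g T \<mu>"
    and g: "\<And>i. i \<in> {1..k} \<Longrightarrow> continuous_on {0..1} (g i)"
    and T: "\<And>i. i \<in> {1..k} \<Longrightarrow> continuous_on {0..1} (T i)" "\<And>i. i \<in> {1..k} \<Longrightarrow> T i ` {0..1} \<subseteq> {0..1}"
    and f: "continuous_on {0..1} f"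
  shows "(\<integral>x. average k g T f x \<partial>\<mu>) = (\<integral>x. f x \<partial>\<mu>)"
proof -
  have "integrable \<mu> (\<lambda>x. g i x * f (T i x))" if "i \<in> {1..k}" for i
    by (intro stationary_measure_integrable[OF \<mu>] continuous_on_mult g
        continuous_on_compose2[OF f T(1)] T(2) that)
  then have "(\<integral>x. average k g T f x \<partial>\<mu>) = (\<Sum>i=1..k. \<integral>x. g i x * f (T i x) \<partial>\<mu>)"
    unfolding average_def by (intro Bochner_Integration.integral_sum)
  then show ?thesis using \<mu> f by (simp add: stationary_measure_def)
qed

lemma stationary_measure_near_constant:
  fixes f :: "real \<Rightarrow> real"
  assumes \<mu>: "stationary_measure k g T \<mu>" and f: "continuous_on {0..1} f"
    and b: "\<And>x. x \<in> {0..1} \<Longrightarrow> \<bar>f x - c\<bar> \<le> b"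
  shows "\<bar>(\<integral>x. f x \<partial>\<mu>) - c\<bar> \<le> b"
proof -
  interpret prob_space \<mu> using \<mu> by (simp add: stationary_measure_def)
  have space: "space \<mu> = {0..1}"
    using \<mu> sets_eq_imp_space_eq[of \<mu> "restrict_space borel {0..1}"]
    by (simp add: stationary_measure_def space_restrict_space)
  have int: "integrable \<mu> f" by (rule stationary_measure_integrable[OF \<mu> f])
  have "(\<integral>x. f x \<partial>\<mu>) \<le> c + b" "c - b \<le> (\<integral>x. f x \<partial>\<mu>)"
  proof -
    have "f x \<le> c + b" "c - b \<le> f x" if "x \<in> space \<mu>" for x
      using b[of x] that unfolding space abs_le_iff by auto
    then show "(\<integral>x. f x \<partial>\<mu>) \<le> c + b" "c - b \<le> (\<integral>x. f x \<partial>\<mu>)"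
      by (intro integral_le_const integral_ge_const int AE_I2; simp)+
  qed
  then show ?thesis by (simp add: abs_le_iff)
qed

section \<open>Smooth dependence of the stationary measure\<close>

theorem corollary1p5:
  fixes k l m r :: nat
    and \<epsilon> \<beta> \<eta> :: real
    and T :: "real \<Rightarrow> nat \<Rightarrow> real \<Rightarrow> real"
    and T0 :: "nat \<Rightarrow> real \<Rightarrow> real"
    and Tc :: "nat \<Rightarrow> nat \<Rightarrow> real \<Rightarrow> real"
    and g :: "real \<Rightarrow> nat \<Rightarrow> real \<Rightarrow> real"
    and g0 :: "nat \<Rightarrow> real \<Rightarrow> real"
    and gc :: "nat \<Rightarrow> nat \<Rightarrow> real \<Rightarrow> real"
    and \<mu> :: "real \<Rightarrow> real \<Rightarrow> real measure"
    and w :: "real \<Rightarrow> real"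
    and \<theta> :: real
  assumes "k \<ge> 2" "l \<ge> 2" "m \<ge> 2" "r \<ge> 1"
    and "\<epsilon> > 0" "0 < \<beta>" "\<beta> < 1" "0 < \<eta>" "\<eta> < 1"
    and T_contraction: "\<And>t i. t \<in> {-\<epsilon><..<\<epsilon>} \<Longrightarrow> i \<in> {1..k} \<Longrightarrow> T t i \<in> CH m \<beta> \<and> contraction_I (T t i)"
    and T0: "\<And>i. i \<in> {1..k} \<Longrightarrow> T0 i \<in> CH m \<beta> \<and> T0 i ` {0..1} \<subseteq> {0..1}"
    and Tc: "\<And>i j. i \<in> {1..k} \<Longrightarrow> j \<in> {1..m-1} \<Longrightarrow> Tc i j \<in> CH m \<beta> \<and> Tc i j ` {0..1} \<subseteq> {0..1}"
    and T_expansion: "\<And>i. i \<in> {1..k} \<Longrightarrow> has_expansion m \<beta> (m-1) (\<lambda>t. T t i) (T0 i) (Tc i)"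
    and T_curve: "\<And>i. i \<in> {1..k} \<Longrightarrow> C_curve m \<beta> (m-1) {-\<epsilon><..<\<epsilon>} (\<lambda>t. T t i)"
    and dT_small: "\<And>i. i \<in> {1..k} \<Longrightarrow> norm_C 1 (diffI 1 (T0 i)) < 1"
    and dT_equal: "\<And>i j x. i \<in> {1..k} \<Longrightarrow> j \<in> {1..k} \<Longrightarrow> x \<in> {0..1} \<Longrightarrow>
           diffI 1 (T0 i) x = diffI 1 (T0 j) x"
    and g: "\<And>s i. s \<in> {-\<epsilon><..<\<epsilon>} \<Longrightarrow> i \<in> {1..k} \<Longrightarrow> g s i \<in> CH l \<eta> \<and> g s i ` {0..1} \<subseteq> {0<..}"
    and g_sum: "\<And>s x. s \<in> {-\<epsilon><..<\<epsilon>} \<Longrightarrow> x \<in> {0..1} \<Longrightarrow> (\<Sum>i=1..k. g s i x) = 1"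
    and average_contraction: "\<And>t s. t \<in> {-\<epsilon><..<\<epsilon>} \<Longrightarrow> s \<in> {-\<epsilon><..<\<epsilon>} \<Longrightarrow>
           (\<Sum>i=1..k. norm_C0 (g s i) * Lip (T t i)) < 1"
    and g0: "\<And>i. i \<in> {1..k} \<Longrightarrow> g0 i \<in> CH l \<eta> \<and> g0 i ` {0..1} \<subseteq> {0<..}"
    and gc: "\<And>i j. i \<in> {1..k} \<Longrightarrow> j \<in> {1..r} \<Longrightarrow> gc i j \<in> CH l \<eta>"
    and g_expansion: "\<And>i. i \<in> {1..k} \<Longrightarrow> has_expansion l \<eta> r (\<lambda>s. g s i) (g0 i) (gc i)"
    and \<mu>: "\<And>t s. t \<in> {-\<epsilon><..<\<epsilon>} \<Longrightarrow> s \<in> {-\<epsilon><..<\<epsilon>} \<Longrightarrow> stationary_measure k (g s) (T t) (\<mu> t s)"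
    and w: "smooth_I w"
    and \<theta>: "\<theta> \<in> {-\<epsilon><..<\<epsilon>}"
  shows "C_on (min l m - 1) {-\<epsilon><..<\<epsilon>} (\<lambda>t. \<integral>x. w x \<partial>(\<mu> t \<theta>))"
proof -
  define n where "n = min l m - 1"
  let ?I = "{-\<epsilon><..<\<epsilon>}"
  interpret strip ?I by standard simp
  have n: "n \<le> m - 1" "Suc n \<le> m" "Suc n \<le> l"
    using assms(2,3) by (auto simp: n_def)
  have dT: "(T t i has_real_derivative diffI 1 (T t i) x) (at x within {0..1})"
    if "i \<in> {1..k}" "t \<in> ?I" "x \<in> {0..1}" for i t x
    using diffI_has_derivative[of m "T t i" 0 x] T_contraction[OF that(2,1)] that(3) assms(3)
    by (simp add: CH_def)
  have dg: "(g \<theta> i has_real_derivative diffI 1 (g \<theta> i) x) (at x within {0..1})"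
    if "i \<in> {1..k}" "x \<in> {0..1}" for i x
    using diffI_has_derivative[of l "g \<theta> i" 0 x] g[OF \<theta> that(1)] that(2) assms(2)
    by (simp add: CH_def)
  \<comment> \<open>The contraction hypotheses are about Lipschitz constants, which bound the derivatives.\<close>
  have Lip: "\<bar>diffI 1 (T t i) x\<bar> \<le> Lip (T t i)"
    if "i \<in> {1..k}" "t \<in> ?I" "x \<in> {0..1}" for i t x
    using T_contraction[OF that(2,1)] unfolding contraction_I_def
    by (intro lipschitz_derivative_le_Lip[OF _ dT[OF that] that(3)]) blast
  have g_le: "g \<theta> i x \<le> norm_C0 (g \<theta> i)" if "i \<in> {1..k}" "x \<in> {0..1}" for i x
  proof -
    have "bdd_above ((\<lambda>x. \<bar>diffI 0 (g \<theta> i) x\<bar>) ` {0..1})"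
      using g[OF \<theta> that(1)] unfolding CH_def mem_Collect_eq by (metis le0)
    then have "\<bar>g \<theta> i x\<bar> \<le> norm_C0 (g \<theta> i)"
      unfolding norm_C0_def using that(2) by (intro cSUP_upper) auto
    then show ?thesis by simp
  qed
  interpret ifs_family ?I k n "\<lambda>i t. T t i" "\<lambda>i t. diffI 1 (T t i)" "g \<theta>" "\<lambda>i. diffI 1 (g \<theta> i)"
  proof
    fix i assume i: "i \<in> {1..k}"
    show "T t i x \<in> {0..1}" if "t \<in> ?I" "x \<in> {0..1}" for t x
      using T_contraction[OF that(1) i] that(2) unfolding contraction_I_def by blast
    show "smooth_coeff n (Suc n) (\<lambda>t. T t i)"
      by (rule C_curve_smooth_coeff[OF T_curve[OF i] \<open>0 < \<beta>\<close> n(1) _ n(2)]) simp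
    show "x_deriv (\<lambda>t. T t i) (\<lambda>t. diffI 1 (T t i))"
      unfolding x_deriv_def using dT[OF i] by blast
    have "regular_x False l (\<lambda>_ _. g \<theta> i)"
      using g[OF \<theta> i] diffI_continuous_CH[OF _ \<open>0 < \<eta>\<close>]
      by (intro regular_x_t_independent) (auto simp: CH_def)
    then show "regular_x False (Suc n) (\<lambda>_ _. g \<theta> i)"
      using regular_mono[of False 0 l _ "Suc n"] n(3) by simp
    show "0 < g \<theta> i x" if "x \<in> {0..1}" for x
      using g[OF \<theta> i] that by blast
    show "\<bar>diffI 1 (T t i) x\<bar> < 1" if "t \<in> ?I" "x \<in> {0..1}" for t x
      using Lip[OF i that] T_contraction[OF that(1) i] unfolding contraction_I_def by linarith
  next
    fix t x assume tx: "t \<in> ?I" "x \<in> {0..1::real}"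
    have "(\<Sum>i=1..k. g \<theta> i x * \<bar>diffI 1 (T t i) x\<bar>) \<le> (\<Sum>i=1..k. norm_C0 (g \<theta> i) * Lip (T t i))"
    proof (rule sum_mono)
      fix i assume i: "i \<in> {1..k}"
      have "0 < g \<theta> i x" using g[OF \<theta> i] tx(2) by blast
      then show "g \<theta> i x * \<bar>diffI 1 (T t i) x\<bar> \<le> norm_C0 (g \<theta> i) * Lip (T t i)"
        using g_le[OF i tx(2)] Lip[OF i tx] by (intro mult_mono) auto
    qed
    then show "(\<Sum>i=1..k. g \<theta> i x * \<bar>diffI 1 (T t i) x\<bar>) < 1"
      using average_contraction[OF tx(1) \<theta>] by linarith
  qed (use dg g_sum[OF \<theta>] in auto)
  have w_regular: "regular_x False (Suc n) (\<lambda>_ _. w)"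
    using w smooth_I_continuous[OF w] by (intro regular_x_t_independent) (auto simp: smooth_I_def)
  have cont: "continuous_on {0..1} (iterate w N t)" if "t \<in> ?I" for N t
    using regular_x_controlled[OF regular_regular_x[OF iterate_regular[OF w_regular]]] that
    by (intro strip_cont_x[of "iterate w N"]) (simp_all add: controlled_def)
  have "C_on n ?I (\<lambda>t. \<integral>x. w x \<partial>(\<mu> t \<theta>))"
  proof (rule iterate_limit_C_on[OF w_regular])
    fix t assume t: "t \<in> ?I"
    have stat: "stationary_measure k (g \<theta>) (T t) (\<mu> t \<theta>)" by (rule \<mu>[OF t \<theta>])
    have g_cont: "continuous_on {0..1} (g \<theta> i)" if "i \<in> {1..k}" for i
      using g[OF \<theta> that] diffI_continuous_CH[of "g \<theta> i" l \<eta> 0] \<open>0 < \<eta>\<close> by simp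
    have T_cont: "continuous_on {0..1} (T t i)" if "i \<in> {1..k}" for i
      using T_contraction[OF t that] diffI_continuous_CH[of "T t i" m \<beta> 0] \<open>0 < \<beta>\<close> by simp
    have T_image: "T t i ` {0..1} \<subseteq> {0..1}" if "i \<in> {1..k}" for i
      using T_contraction[OF t that] by (simp add: contraction_I_def)
    have invariant: "(\<integral>x. iterate w N t x \<partial>(\<mu> t \<theta>)) = (\<integral>x. w x \<partial>(\<mu> t \<theta>))" for N
    proof (induction N)
      case (Suc N)
      have "(\<integral>x. average k (g \<theta>) (T t) (iterate w N t) x \<partial>(\<mu> t \<theta>)) = (\<integral>x. iterate w N t x \<partial>(\<mu> t \<theta>))"
        by (rule stationary_measure_average[OF stat g_cont T_cont T_image cont[OF t]])
      then show ?case using Suc by (simp add: iterate_def)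
    qed (simp add: iterate_def)
    obtain \<delta> C \<rho> where d: "\<delta> > 0" "C \<ge> 0" "0 < \<rho>" "\<rho> < 1"
      "\<And>N s x. s \<in> ?I \<Longrightarrow> x \<in> {0..1} \<Longrightarrow> \<bar>s - t\<bar> < \<delta> \<Longrightarrow>
        \<bar>iterate w N s x - iterate w N s 0\<bar> \<le> C * \<rho> ^ N"
      by (rule decayingE[OF iterate_oscillation_decays[OF w_regular] t]) (rule that)
    have "\<bar>iterate w N t 0 - (\<integral>x. w x \<partial>(\<mu> t \<theta>))\<bar> \<le> C * \<rho> ^ N" for N
      using stationary_measure_near_constant[OF stat cont[OF t, of N],
            where c = "iterate w N t 0" and b = "C * \<rho> ^ N"]
        d(5)[OF t, of _ N] d(1) by (simp add: invariant abs_minus_commute)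
    then have "norm (iterate w N t 0 - (\<integral>x. w x \<partial>(\<mu> t \<theta>))) \<le> C * \<rho> ^ N" for N
      by simp
    moreover have null: "(\<lambda>N. C * \<rho> ^ N) \<longlonglongrightarrow> 0"
      using d by (intro tendsto_mult_right_zero LIMSEQ_power_zero) auto
    ultimately have "(\<lambda>N. iterate w N t 0 - (\<integral>x. w x \<partial>(\<mu> t \<theta>))) \<longlonglongrightarrow> 0"
      by (intro Lim_null_comparison[OF always_eventually null] allI)
    then show "(\<lambda>N. iterate w N t 0) \<longlonglongrightarrow> (\<integral>x. w x \<partial>(\<mu> t \<theta>))"
      by (simp add: LIM_zero_iff)
  qed
  then show ?thesis by (simp add: n_def)
qed
end
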